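(* Let $1<p<\infty$, let $W,U$ be matrix $A_p$ weights on $\mathbb{R}^d$, let $\mathcal D$ be a dyadic grid, and let $A=\{A_I^\varepsilon: I\in\mathcal D,\varepsilon\in\mathcal S\}$ be a sequence of $n\times n$ matrices; write $A^*=\{(A_I^\varepsilon)^*\}$. Define $\mathcal B(W,U,A,p)=\sup_{K\in\mathcal D}\frac1{|K|}\sum_{I\in\mathcal D(K)}\sum_{\varepsilon\in\mathcal S}\|V_I(W,p)A_I^\varepsilon V_K(U,p)^{-1}\|^2$ and the operator $\Pi^{W,U,p}_A\vec f=\sum_{\varepsilon\in\mathcal S}\sum_{I\in\mathcal D}V_I(W,p)A_I^\varepsilon\, m_I(U^{-1/p}\vec f)\,h_I^\varepsilon$. Then the following are equivalent: (a) $\Pi_A^{W,U,p}$ is bounded on $L^p(\mathbb{R}^d;\mathbb{C}^n)$; (b) $\sup_{J\in\mathcal D}\frac1{|J|}\sum_{\varepsilon\in\mathcal S}\sum_{I\in\mathcal D(J)}\|V_I(W,p)A_I^\varepsilon V_I(U,p)^{-1}\|^2<\infty$; (c) $\mathcal B(W,U,A,p)<\infty$ if $2\le p<\infty$, and $\mathcal B(U^{1-p'},W^{1-p'},A^*,p')<\infty$ if $1<p\le2$; (d) $\Pi_{A^*}^{U^{1-p'},W^{1-p'},p'}$ is bounded on $L^{p'}(\mathbb{R}^d;\mathbb{C}^n)$. Moreover, for every $1<p<\infty$, each of $\mathcal B(W,U,A,p)<\infty$ and $\mathcal B(U^{1-p'},W^{1-p'},A^*,p')<\infty$ implies (b).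
   Context: $M_n(\mathbb{C})$: $n\times n$ complex matrices with operator norm $\|\cdot\|$; $|\cdot|$ Euclidean norm on $\mathbb{C}^n$. For a cube $I$ and locally integrable $F$, $m_IF=|I|^{-1}\int_IF$ (entrywise). A matrix weight is a locally integrable $W:\mathbb{R}^d\to M_n(\mathbb{C})$ positive definite a.e.; $p'=p/(p-1)$; $W$ is a matrix $A_p$ weight if $\sup_I \frac{1}{|I|}\int_I\big(\frac{1}{|I|}\int_I\|W^{1/p}(x)W^{-1/p}(t)\|^{p'}dt\big)^{p/p'}dx<\infty$ over all cubes ($W$ is matrix $A_p$ iff $W^{1-p'}$ is matrix $A_{p'}$). For $1<q<\infty$, a matrix $A_q$ weight $X$ and a cube $I$, the reducing operator $V_I(X,q)$ is a positive definite matrix with $|V_I(X,q)\vec e|\approx|I|^{-1/q}(\int_I|X^{1/q}(x)\vec e|^qdx)^{1/q}$ for all $\vec e\in\mathbb{C}^n$, constants depending only on $n,q$ (the statement does not depend on the choice). A dyadic grid $\mathcal D$ is a collection of cubes such that for each $k\in\mathbb{Z}$ the cubes of side $2^{-k}$ in $\mathcal D$ partition $\mathbb{R}^d$ and each is a union of $2^d$ cubes of side $2^{-k-1}$ in $\mathcal D$; $\mathcal D(J)=\{I\in\mathcal D:I\subseteq J\}$. Haar functions: for an interval $I$ with left/right halves $I_\ell,I_r$, $h_I^1=|I|^{-1/2}\chi_I$, $h_I^0=|I|^{-1/2}(\chi_{I_\ell}-\chi_{I_r})$; for a cube $I=I_1\times\cdots\times I_d$ and $\varepsilon\in\{0,1\}^d$,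 $h_I^\varepsilon(x)=\prod_ih_{I_i}^{\varepsilon_i}(x_i)$; $\mathcal S=\{0,1\}^d\setminus\{(1,\ldots,1)\}$. *)

theory Defs
  imports "HOL-Analysis.Analysis"
begin

type_synonym ('n) cmat = "complex^'n^'n"

definition mat_adj :: "complex^'n^'m \<Rightarrow> complex^'m^'n" where
  "mat_adj M = (\<chi> i j. cnj (M $ j $ i))"

definition mnorm :: "complex^'n^'m \<Rightarrow> real" where
  "mnorm M = onorm (\<lambda>v. M *v v)"

definition posdef :: "complex^'n^'n \<Rightarrow> bool" where
  "posdef M \<longleftrightarrow> mat_adj M = M \<and>
     (\<forall>v. v \<noteq> 0 \<longrightarrow> 0 < Re (\<Sum>i\<in>UNIV. cnj (v $ i) * (M *v v) $ i))"

text \<open>Real power of a positive definite matrix via the spectral calculus: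
  the matrix acting as \<open>\<lambda> powr r\<close> on each eigenvector with eigenvalue \<open>\<lambda>\<close>.\<close>
definition mpow :: "complex^'n^'n \<Rightarrow> real \<Rightarrow> complex^'n^'n" where
  "mpow M r = (THE B. \<forall>v (lam::real). M *v v = complex_of_real lam *s v \<longrightarrow>
                      B *v v = complex_of_real (lam powr r) *s v)"

text \<open>Power of an extended nonnegative real (used with positive exponents).\<close>
definition enn_powr :: "ennreal \<Rightarrow> real \<Rightarrow> ennreal" where
  "enn_powr a r = (if a = top then top else ennreal (enn2real a powr r))"

definition dcube :: "real^'d \<Rightarrow> real \<Rightarrow> (real^'d) set" where
  "dcube a l = {x. \<forall>i. a $ i \<le> x $ i \<and> x $ i < a $ i + l}"

definition is_cube :: "(real^'d) set \<Rightarrow> bool" where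
  "is_cube I \<longleftrightarrow> (\<exists>a l. l > 0 \<and> I = dcube a l)"

definition cube_side :: "(real^'d) set \<Rightarrow> real" where
  "cube_side I = (THE l. l > 0 \<and> (\<exists>a. I = dcube a l))"

definition cube_corner :: "(real^'d) set \<Rightarrow> real^'d" where
  "cube_corner I = (THE a. I = dcube a (cube_side I))"

definition vol :: "(real^'d) set \<Rightarrow> real" where
  "vol I = measure lebesgue I"

definition locally_integrable_mat :: "(real^'d \<Rightarrow> complex^'n^'n) \<Rightarrow> bool" where
  "locally_integrable_mat W \<longleftrightarrow>
     (\<forall>i j K. compact K \<longrightarrow> (\<lambda>x. W x $ i $ j) absolutely_integrable_on K)"

definition matrix_weight :: "(real^'d \<Rightarrow> complex^'n^'n) \<Rightarrow> bool" where
  "matrix_weight W \<longleftrightarrow> locally_integrable_mat W \<and> (AE x in lebesgue. posdef (W x))"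

definition matrix_Ap :: "real \<Rightarrow> (real^'d \<Rightarrow> complex^'n^'n) \<Rightarrow> bool" where
  "matrix_Ap p W \<longleftrightarrow> matrix_weight W \<and>
     (SUP I\<in>Collect is_cube.
        ennreal (1 / vol I) *
        (\<integral>\<^sup>+ x\<in>I. enn_powr
            (ennreal (1 / vol I) *
              (\<integral>\<^sup>+ t\<in>I. ennreal (mnorm (mpow (W x) (1/p) ** mpow (W t) (-1/p)) powr (p/(p-1))) \<partial>lebesgue))
            (p / (p/(p-1))) \<partial>lebesgue)) < top"

definition reducing_ops :: "(real^'d \<Rightarrow> complex^'n^'n) \<Rightarrow> real \<Rightarrow> ((real^'d) set \<Rightarrow> complex^'n^'n) \<Rightarrow> bool" where
  "reducing_ops X q V \<longleftrightarrow> (\<exists>c C. c > 0 \<and> C > 0 \<and> (\<forall>I. is_cube I \<longrightarrow> posdef (V I) \<and>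
     (\<forall>e. let R = enn_powr (ennreal (1 / vol I) *
                     (\<integral>\<^sup>+ x\<in>I. ennreal (norm (mpow (X x) (1/q) *v e) powr q) \<partial>lebesgue)) (1/q)
          in ennreal c * R \<le> ennreal (norm (V I *v e)) \<and> ennreal (norm (V I *v e)) \<le> ennreal C * R)))"

definition dyadic_grid :: "(real^'d) set set \<Rightarrow> bool" where
  "dyadic_grid D \<longleftrightarrow>
     (\<forall>I\<in>D. \<exists>a (k::int). I = dcube a (2 powr (- real_of_int k))) \<and>
     (\<forall>k::int.
        (\<forall>x. \<exists>!I. I \<in> D \<and> (\<exists>a. I = dcube a (2 powr (- real_of_int k))) \<and> x \<in> I) \<and>
        (\<forall>I\<in>D. (\<exists>a. I = dcube a (2 powr (- real_of_int k))) \<longrightarrow>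
           (\<exists>C. C \<subseteq> {J\<in>D. \<exists>a. J = dcube a (2 powr (- real_of_int (k + 1)))} \<and>
                card C = 2 ^ CARD('d) \<and> \<Union>C = I)))"

definition dsub :: "(real^'d) set set \<Rightarrow> (real^'d) set \<Rightarrow> (real^'d) set set" where
  "dsub D J = {I\<in>D. I \<subseteq> J}"

text \<open>Signatures: eps i = True encodes eps_i = 1. S excludes (1,...,1).\<close>
definition sigS :: "('d \<Rightarrow> bool) set" where
  "sigS = {eps. eps \<noteq> (\<lambda>_. True)}"

definition haar :: "(real^'d) set \<Rightarrow> ('d \<Rightarrow> bool) \<Rightarrow> real^'d \<Rightarrow> real" where
  "haar I eps x = (\<Prod>i\<in>UNIV.
     (let a = cube_corner I $ i; l = cube_side I; t = x $ i in
      if eps i then (if a \<le> t \<and> t < a + l then 1 / sqrt l else 0)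
      else (if a \<le> t \<and> t < a + l/2 then 1 / sqrt l
            else if a + l/2 \<le> t \<and> t < a + l then - 1 / sqrt l else 0)))"

definition avg :: "(real^'d) set \<Rightarrow> (real^'d \<Rightarrow> complex^'n) \<Rightarrow> complex^'n" where
  "avg I g = (1 / vol I) *\<^sub>R (LINT x:I|lebesgue. g x)"

text \<open>Finite truncation (over a finite F \<subseteq> D) of Pi_A^{W,U,q}, given reducing operators VW = V_I(W,q).\<close>
definition Pi_trunc :: "((real^'d) set \<Rightarrow> complex^'n^'n) \<Rightarrow> (real^'d \<Rightarrow> complex^'n^'n) \<Rightarrow> real
    \<Rightarrow> ((real^'d) set \<Rightarrow> ('d \<Rightarrow> bool) \<Rightarrow> complex^'n^'n)
    \<Rightarrow> (real^'d) set set \<Rightarrow> (real^'d \<Rightarrow> complex^'n) \<Rightarrow> real^'d \<Rightarrow> complex^'n" where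
  "Pi_trunc VW U q A F f x =
     (\<Sum>eps\<in>sigS. \<Sum>I\<in>F. haar I eps x *\<^sub>R
        ((VW I ** A I eps) *v avg I (\<lambda>y. mpow (U y) (-1/q) *v f y)))"

text \<open>Boundedness on L^q: uniform bound for all finite truncations.\<close>
definition bounded_Lq :: "(real^'d) set set \<Rightarrow> real
    \<Rightarrow> ((real^'d) set set \<Rightarrow> (real^'d \<Rightarrow> complex^'n) \<Rightarrow> real^'d \<Rightarrow> complex^'n) \<Rightarrow> bool" where
  "bounded_Lq D q T \<longleftrightarrow> (\<exists>C\<ge>0. \<forall>f. f \<in> borel_measurable lebesgue \<longrightarrow>
      (\<integral>\<^sup>+ x. ennreal (norm (f x) powr q) \<partial>lebesgue) < top \<longrightarrow>
      (\<forall>F. finite F \<longrightarrow> F \<subseteq> D \<longrightarrow>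
         (\<integral>\<^sup>+ x. ennreal (norm (T F f x) powr q) \<partial>lebesgue)
           \<le> ennreal C * (\<integral>\<^sup>+ x. ennreal (norm (f x) powr q) \<partial>lebesgue)))"

definition Bq :: "(real^'d) set set \<Rightarrow> ((real^'d) set \<Rightarrow> complex^'n^'n) \<Rightarrow> ((real^'d) set \<Rightarrow> complex^'n^'n)
    \<Rightarrow> ((real^'d) set \<Rightarrow> ('d \<Rightarrow> bool) \<Rightarrow> complex^'n^'n) \<Rightarrow> ennreal" where
  "Bq D VW VU A = (SUP K\<in>D. ennreal (1 / vol K) *
      infsum (\<lambda>I. \<Sum>eps\<in>sigS. ennreal ((mnorm (VW I ** A I eps ** matrix_inv (VU K)))\<^sup>2)) (dsub D K))"

definition Cb :: "(real^'d) set set \<Rightarrow> ((real^'d) set \<Rightarrow> complex^'n^'n) \<Rightarrow> ((real^'d) set \<Rightarrow> complex^'n^'n)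
    \<Rightarrow> ((real^'d) set \<Rightarrow> ('d \<Rightarrow> bool) \<Rightarrow> complex^'n^'n) \<Rightarrow> ennreal" where
  "Cb D VW VU A = (SUP J\<in>D. ennreal (1 / vol J) *
      (\<Sum>eps\<in>sigS. infsum (\<lambda>I. ennreal ((mnorm (VW I ** A I eps ** matrix_inv (VU I)))\<^sup>2)) (dsub D J)))"

definition adj_seq :: "((real^'d) set \<Rightarrow> ('d \<Rightarrow> bool) \<Rightarrow> complex^'n^'n) \<Rightarrow> ((real^'d) set \<Rightarrow> ('d \<Rightarrow> bool) \<Rightarrow> complex^'n^'n)" where
  "adj_seq A = (\<lambda>I eps. mat_adj (A I eps))"

end

theory Submission
  imports Defs
begin

text \<open>The matrix \<open>A\<^sub>p\<close> condition is used only in the form \<open>mnorm (V I ** Vd I) \<le> c\<close> for the reducing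
  operators of a weight and of its dual. It makes \<open>V I\<close> comparable to the inverse of \<open>Vd I\<close>, so that (b) for
  the dual data is equivalent to (b), and every other implication has to be shown for one side only.

  Everything rests on stopping times on dyadic cubes. Stopping when \<open>V J ** matrix_inv (V K)\<close> becomes large
  selects cubes of total measure at most \<open>vol J / 2\<close>; off the stopped cubes \<open>V K\<close> may be replaced by \<open>V J\<close>, and
  the stopped ones are absorbed. This turns (c) into (b). For (b) implies (a), one pairs the paraproduct
  with a test function \<open>\<phi>\<close>. A Calderon-Zygmund stopping time gives
  \<open>\<Sum> a\<^sub>I \<bar>\<phi>\<^sub>I\<bar> \<le> C \<integral>\<^sub>J M \<phi>\<close> for Haar coefficients \<open>\<phi>\<^sub>I\<close> and a Carleson sequence \<open>a\<close>, and the Carleson embedding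
  theorem reduces the claim to the maximal function of the averages \<open>norm (V I *v m\<^sub>I (U\<^bsup>-1/p\<^esup> f))\<close>, which is bounded
  because \<open>norm (U\<^bsup>-1/p\<^esup> e)\<^bsup>p'\<^esup>\<close> satisfies a reverse Hoelder inequality uniformly in \<open>e\<close>. For (a) implies (b),
  one tests on \<open>U\<^bsup>1/p\<^esup> matrix_inv (V J) e\<close> restricted to \<open>J\<close> and interpolates the \<open>L\<^sup>2\<close> norm of the image between \<open>L\<^sup>p\<close> and
  \<open>L\<^bsup>p'\<^esup>\<close>, where the second norm is again controlled by the paraproduct estimate.\<close>

section \<open>Positive definite matrices and their real powers\<close>

text \<open>All estimates are made for finite subfamilies of the grid, with constants independent of
  the subfamily. No infinite Haar series occurs, and every norm or Carleson constant that has to be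
  absorbed is finite from the start. Reverse Hoelder is needed because Hoelder's inequality with the
  exponents \<open>p\<close> and \<open>q\<close> alone leads to the maximal function of
  \<open>norm (f x) powr p\<close> at exponent 1, where Doob's inequality fails. A slightly larger
  exponent on the weight leaves an exponent below \<open>p\<close> on \<open>f\<close>. The split at
  \<open>p = 2\<close> in (c) comes from comparing square sums with L^p norms on one cube: only for
  \<open>2 <= p\<close> does the L^p bound for the image of a test function control its L^2 norm
  directly. For \<open>p <= 2\<close> the same argument runs on the dual side, at the exponent
  \<open>q >= 2\<close>. Condition (b) follows from (a) at every exponent because the missing
  integrability comes from the L^q estimate, at the price of only the square root of the Carleson
  constant.\<close>

lemma symmetric_eigenvectors_span:
  fixes T :: "'a::euclidean_space \<Rightarrow> 'a"
  assumes lin: "linear T" and sym: "\<And>x y. T x \<bullet> y = x \<bullet> T y"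
  shows "span {v. \<exists>t::real. T v = t *\<^sub>R v} = UNIV"
proof (rule ccontr)
  let ?E = "{v. \<exists>t::real. T v = t *\<^sub>R v}"
  \<comment> \<open>\<open>N\<close> is the orthogonal complement of all eigenvectors, nonzero by
    assumption and invariant under \<open>T\<close>. The quadratic form of \<open>T\<close> has a
    maximiser on the unit sphere of \<open>N\<close>, and that maximiser will turn out to be an
    eigenvector, a contradiction.\<close>
  define N where "N = {y. \<forall>x\<in>?E. y \<bullet> x = 0}"
  assume "span ?E \<noteq> UNIV"
  then obtain a where a: "a \<noteq> 0" "\<forall>x\<in>span ?E. a \<bullet> x = 0"
    using span_not_UNIV_orthogonal[of ?E] by auto
  have clN: "closed N"
  proof -
    have "N = (\<Inter>x\<in>?E. {y. y \<bullet> x = 0})" by (auto simp: N_def)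
    moreover have "closed {y. y \<bullet> x = 0}" for x :: 'a
      by (intro closed_Collect_eq continuous_intros)
    ultimately show ?thesis by auto
  qed
  have subN: "x \<in> N \<Longrightarrow> y \<in> N \<Longrightarrow> s *\<^sub>R x + t *\<^sub>R y \<in> N" for x y s t
    by (auto simp: N_def inner_add_left)
  have TN: "T y \<in> N" if "y \<in> N" for y
    using that by (auto simp: N_def sym)
  let ?K = "N \<inter> sphere 0 1"
  have "compact ?K" using clN by (simp add: closed_Int_compact)
  moreover have "a /\<^sub>R norm a \<in> ?K"
    using a by (auto simp: N_def span_base)
  moreover have "continuous_on ?K (\<lambda>y. y \<bullet> T y)"
    using lin by (intro continuous_intros linear_continuous_on linear_conv_bounded_linear[THEN iffD1])
  ultimately obtain y0 where y0: "y0 \<in> ?K" and max: "\<And>y. y \<in> ?K \<Longrightarrow> y \<bullet> T y \<le> y0 \<bullet> T y0"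
    using continuous_attains_sup[of ?K "\<lambda>y. y \<bullet> T y"] by blast
  define m where "m = y0 \<bullet> T y0"
  have le: "y \<bullet> T y \<le> m * (y \<bullet> y)" if "y \<in> N" for y
  proof (cases "y = 0")
    case False
    have "y /\<^sub>R norm y \<in> ?K" using that False by (auto simp: N_def)
    from max[OF this] have "(y \<bullet> T y) / (norm y)^2 \<le> m"
      by (simp add: linear_scale[OF lin] m_def power2_eq_square divide_inverse ac_simps)
    then show ?thesis using False by (simp add: divide_le_eq power2_norm_eq_inner)
  qed (simp add: linear_0[OF lin])
  define z where "z = T y0 - m *\<^sub>R y0"
  have y01: "y0 \<bullet> y0 = 1" using y0 by (simp add: norm_eq_1)
  have zN: "z \<in> N" using subN[OF TN y0[THEN IntD1], of y0 1 "-m"] y0 by (simp add: z_def)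
  have y0z: "y0 \<bullet> z = 0" by (simp add: z_def inner_diff_right y01 m_def)
  have zT: "z \<bullet> T y0 = z \<bullet> z" 
    using y0z by (simp add: z_def inner_diff_right inner_diff_left inner_commute)
  define c where "c = m * (z \<bullet> z) - z \<bullet> T z"
  have q: "2 * t * (z \<bullet> z) \<le> t^2 * c" for t
  proof -
    have "y0 + t *\<^sub>R z \<in> N" using subN[of y0 z 1 t] y0 zN by simp
    from le[OF this] have "m + 2 * t * (z \<bullet> z) + t^2 * (z \<bullet> T z) \<le> m * (1 + t^2 * (z \<bullet> z))"
      using y0z y01 zT sym[of y0 z]
      by (simp add: linear_add[OF lin] linear_scale[OF lin] inner_add_left inner_add_right m_def[symmetric]
          inner_commute power2_eq_square algebra_simps)
    then show ?thesis by (simp add: c_def algebra_simps)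
  qed
  \<comment> \<open>First variation: \<open>q\<close> compares a term linear in \<open>t\<close>
    with a quadratic one, so for small positive \<open>t\<close> the residual \<open>z\<close> of
    the eigenvalue equation must vanish.\<close>
  have "z = 0"
  proof (rule ccontr)
    assume "z \<noteq> 0"
    then have zz: "z \<bullet> z > 0" by simp
    define t where "t = (z \<bullet> z) / (\<bar>c\<bar> + 1)"
    have t: "t > 0" using zz by (simp add: t_def)
    have "2 * (z \<bullet> z) \<le> t * c" using q[of t] t by (simp add: power2_eq_square)
    also have "\<dots> \<le> t * (\<bar>c\<bar> + 1)" using t by (intro mult_left_mono) auto
    also have "\<dots> = z \<bullet> z" by (simp add: t_def)
    finally show False using zz by simp
  qed
  then have "y0 \<in> ?E" by (auto simp: z_def)
  then have "y0 \<bullet> y0 = 0" using y0 by (auto simp: N_def)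
  then show False using y01 by simp
qed

lemma of_real_vector_scale: "complex_of_real c *s (v :: complex^'n) = c *\<^sub>R v"
  by (simp add: vec_eq_iff complex_eq_iff)

lemma inner_mat_adj:
  fixes M :: "complex^'n^'m"
  shows "(mat_adj M *v x) \<bullet> y = x \<bullet> (M *v y)"
proof -
  have cc: "inner (cnj m * a) b = inner a (m * b)" for m a b :: complex
    by (simp add: inner_complex_def algebra_simps)
  have "(mat_adj M *v x) \<bullet> y = (\<Sum>i\<in>UNIV. \<Sum>j\<in>UNIV. inner (x $ j) (M $ j $ i * y $ i))"
    by (simp add: inner_vec_def matrix_vector_mult_def mat_adj_def inner_sum_left cc)
  also have "\<dots> = (\<Sum>j\<in>UNIV. \<Sum>i\<in>UNIV. inner (x $ j) (M $ j $ i * y $ i))"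
    by (rule sum.swap)
  also have "\<dots> = x \<bullet> (M *v y)"
    by (simp add: inner_vec_def matrix_vector_mult_def inner_sum_right)
  finally show ?thesis .
qed

lemma mat_adj_mat_adj [simp]: "mat_adj (mat_adj M) = M"
  by (simp add: mat_adj_def vec_eq_iff)

lemma inner_mat_adj': "x \<bullet> (mat_adj M *v y) = (M *v x) \<bullet> y"
  using inner_mat_adj[of "mat_adj M" x y] by simp

lemma mat_adj_eqI:
  fixes B C :: "complex^'n^'n"
  assumes "\<And>x y. (B *v x) \<bullet> y = x \<bullet> (C *v y)"
  shows "mat_adj B = C"
proof -
  have "mat_adj B *v y = C *v y" for y
  proof -
    have "x \<bullet> (mat_adj B *v y) = x \<bullet> (C *v y)" for x
      by (simp add: inner_mat_adj' assms)
    then show ?thesis by (metis vector_eq_rdot inner_commute)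
  qed
  then show ?thesis by (simp add: matrix_eq)
qed

text \<open>The real inner product of \<open>complex^'n\<close> is the real part of the Hermitian
  one. Positive definiteness thus becomes a statement in a real Euclidean space, where the
  eigenvector lemma applies.\<close>

lemma posdef_alt:
  "posdef M \<longleftrightarrow> mat_adj M = M \<and> (\<forall>v. v \<noteq> 0 \<longrightarrow> 0 < v \<bullet> (M *v v))"
proof -
  have "Re (\<Sum>i\<in>UNIV. cnj (v $ i) * (M *v v) $ i) = v \<bullet> (M *v v)" for v
    by (simp add: inner_vec_def inner_complex_def)
  then show ?thesis by (simp add: posdef_def)
qed

lemma posdef_sym: "posdef M \<Longrightarrow> (M *v x) \<bullet> y = x \<bullet> (M *v y)"
  by (metis inner_mat_adj posdef_alt)

definition eigs :: "complex^'n^'n \<Rightarrow> (complex^'n) set" where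
  "eigs M = {v. \<exists>t::real. M *v v = t *\<^sub>R v}"

lemma posdef_span_eigs: "posdef M \<Longrightarrow> span (eigs M) = UNIV"
  unfolding eigs_def by (rule symmetric_eigenvectors_span) (auto simp: posdef_sym)

lemma posdef_eig_pos:
  assumes "posdef M" "M *v v = t *\<^sub>R v" "v \<noteq> 0" shows "t > 0"
proof -
  have "0 < v \<bullet> (M *v v)" using assms by (auto simp: posdef_alt)
  moreover have "0 \<le> v \<bullet> v" by simp
  ultimately show ?thesis using assms by (auto simp: zero_less_mult_iff not_less)
qed

lemma posdef_matrix_eqI:
  assumes "posdef M" and eq: "\<And>t v. M *v v = t *\<^sub>R v \<Longrightarrow> B *v v = C *v v"
  shows "B = (C :: complex^'n^'m)"
proof -
  have "B *v v = C *v v" for v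
  proof -
    have "v \<in> span (eigs M)" using posdef_span_eigs[OF assms(1)] by simp
    then show ?thesis
      by (rule linear_eq_on[rotated 2]) (use eq in \<open>auto simp: eigs_def\<close>)
  qed
  then show ?thesis by (simp add: matrix_eq)
qed

lemma continuous_on_matrix_mult:
  fixes F G :: "'a::topological_space \<Rightarrow> complex^'n^'n"
  assumes "continuous_on S F" "continuous_on S G"
  shows "continuous_on S (\<lambda>x. F x ** G x)"
  unfolding matrix_matrix_mult_def
  by (intro continuous_on_vec_lambda continuous_intros continuous_on_component assms)

lemma matrix_scaleR_mult: "(c *\<^sub>R M) *v v = c *\<^sub>R (M *v (v::complex^'n))"
  by (simp add: matrix_vector_mult_def vec_eq_iff scaleR_sum_right)

text \<open>Polynomial functional calculus by Horner's scheme. Continuity of \<open>G\<close> in the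
  matrix is recorded because the measurability of \<open>mpow\<close> rests on it.\<close>

lemma poly_matrix:
  "\<exists>G :: complex^'n^'n \<Rightarrow> complex^'n^'n. continuous_on UNIV G \<and>
     (\<forall>M t v. M *v v = t *\<^sub>R v \<longrightarrow> G M *v v = poly q t *\<^sub>R v)"
proof (induction q)
  case 0
  show ?case by (rule exI[of _ "\<lambda>_. 0"]) auto
next
  case (pCons a q)
  then obtain G :: "complex^'n^'n \<Rightarrow> complex^'n^'n" where G: "continuous_on UNIV G"
    "\<And>M t v. M *v v = t *\<^sub>R v \<Longrightarrow> G M *v v = poly q t *\<^sub>R v" by blast
  show ?case
  proof (intro exI conjI allI impI)
    show "continuous_on UNIV (\<lambda>M. a *\<^sub>R mat 1 + M ** G M)"
      by (intro continuous_intros continuous_on_matrix_mult G)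
    fix M :: "complex^'n^'n" and t v assume ev: "M *v v = t *\<^sub>R v"
    show "(a *\<^sub>R mat 1 + M ** G M) *v v = poly (pCons a q) t *\<^sub>R v"
      using G(2)[OF ev] ev
      by (simp add: matrix_vector_mult_add_rdistrib matrix_scaleR_mult matrix_vector_mul_assoc[symmetric]
          linear_scale[OF matrix_vector_mul_linear] algebra_simps)
  qed
qed

lemma poly_interpolation:
  fixes f :: "real \<Rightarrow> real"
  assumes "finite L" shows "\<exists>q. \<forall>t\<in>L. poly q t = f t"
  using assms
proof induction
  case (insert a L)
  then obtain q where q: "\<forall>t\<in>L. poly q t = f t" by blast
  define P where "P = (\<Prod>t\<in>L. [:-t, 1:])"
  have P0: "poly P t = 0" if "t \<in> L" for t
    using that insert by (auto simp: P_def poly_prod)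
  have Pa: "poly P a \<noteq> 0" using insert by (auto simp: P_def poly_prod)
  show ?case
    by (rule exI[of _ "q + smult ((f a - poly q a) / poly P a) P"]) (use q P0 Pa in auto)
qed auto

text \<open>A polynomial interpolating \<open>f\<close> at the finitely many eigenvalues of a basis
  of eigenvectors does it. There are no other eigenvalues: eigenvectors to a further one would be
  orthogonal to the whole basis.\<close>

lemma matrix_fun_exists:
  fixes M :: "complex^'n^'n" and f :: "real \<Rightarrow> real"
  assumes "posdef M"
  shows "\<exists>B. \<forall>t v. M *v v = t *\<^sub>R v \<longrightarrow> B *v v = f t *\<^sub>R v"
proof -
  obtain X where X: "X \<subseteq> eigs M" "independent X" "eigs M \<subseteq> span X"
    using maximal_independent_subset by blast
  have fX: "finite X" using X(2) independent_imp_finite by blast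
  have sX: "span X = UNIV"
    using X posdef_span_eigs[OF assms] by (metis span_mono span_span top.extremum_uniqueI)
  define e where "e v = (SOME t. M *v v = t *\<^sub>R v)" for v
  have e: "M *v v = e v *\<^sub>R v" if "v \<in> X" for v
    using that X(1) unfolding e_def eigs_def by (metis (mono_tags, lifting) mem_Collect_eq subsetD someI_ex)
  obtain q where q: "\<forall>t\<in>e ` X. poly q t = f t"
    using poly_interpolation[of "e ` X" f] fX by auto
  obtain G :: "complex^'n^'n \<Rightarrow> complex^'n^'n" where
    G: "\<And>M t v. M *v v = t *\<^sub>R v \<Longrightarrow> G M *v v = poly q t *\<^sub>R v"
    using poly_matrix by blast
  have "G M *v v = f t *\<^sub>R v" if v: "M *v v = t *\<^sub>R v" for t v
  proof (cases "t \<in> e ` X")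
    case True then show ?thesis using G[OF v] q by auto
  next
    case False
    have "v \<bullet> x = 0" if "x \<in> X" for x
    proof -
      have "t * (v \<bullet> x) = e x * (v \<bullet> x)"
        using posdef_sym[OF assms, of v x] v e[OF that] by simp
      moreover have "t \<noteq> e x" using False that by auto
      ultimately show ?thesis by simp
    qed
    then have "v \<bullet> v = 0"
      using sX by (metis UNIV_I orthogonal_def orthogonal_to_span)
    then show ?thesis by simp
  qed
  then show ?thesis by blast
qed

text \<open>The definite description in \<open>mpow_def\<close> denotes because eigenvectors span,
  which gives uniqueness. From here on \<open>mpow\<close> is accessed only through its action on
  eigenvectors.\<close>

lemma mpow_eig:
  fixes M :: "complex^'n^'n"
  assumes M: "posdef M" and "M *v v = t *\<^sub>R v"
  shows "mpow M r *v v = (t powr r) *\<^sub>R v"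
proof -
  let ?P = "\<lambda>B. \<forall>v (t::real). M *v v = complex_of_real t *s v \<longrightarrow> B *v v = complex_of_real (t powr r) *s v"
  obtain B where B: "?P B"
    using matrix_fun_exists[OF M, of "\<lambda>t. t powr r"] by (auto simp: of_real_vector_scale)
  have "?P (mpow M r)" unfolding mpow_def
  proof (rule theI[of ?P, OF B])
    fix C assume C: "?P C"
    show "C = B" by (rule posdef_matrix_eqI[OF M]) (use B C in \<open>metis of_real_vector_scale\<close>)
  qed
  then show ?thesis using assms by (auto simp: of_real_vector_scale)
qed

lemma mpow_mult:
  fixes M :: "complex^'n^'n"
  assumes M: "posdef M"
  shows "mpow M r ** mpow M s = mpow M (r + s)"
proof (rule posdef_matrix_eqI[OF M])
  fix t v assume "M *v v = t *\<^sub>R v"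
  from mpow_eig[OF M this] show "mpow M r ** mpow M s *v v = mpow M (r + s) *v v"
    by (simp add: matrix_vector_mul_assoc[symmetric] linear_scale[OF matrix_vector_mul_linear] powr_add mult.commute)
qed

lemma mpow_0:
  fixes M :: "complex^'n^'n"
  assumes M: "posdef M" shows "mpow M 0 = mat 1"
proof (rule posdef_matrix_eqI[OF M])
  fix t v assume ev: "M *v v = t *\<^sub>R v"
  then show "mpow M 0 *v v = mat 1 *v v"
    using mpow_eig[OF M ev, of 0] posdef_eig_pos[OF M ev] by (cases "v = 0") auto
qed

text \<open>Eigenvectors with different eigenvalues are orthogonal, so the identity holds on
  eigenvectors; linearity in each argument extends it.\<close>

lemma mpow_sym:
  fixes M :: "complex^'n^'n"
  assumes M: "posdef M" shows "(mpow M r *v x) \<bullet> y = x \<bullet> (mpow M r *v y)"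
proof -
  have ev: "(mpow M r *v x) \<bullet> y = x \<bullet> (mpow M r *v y)"
    if x: "M *v x = t *\<^sub>R x" and y: "M *v y = s *\<^sub>R y" for x y t s
  proof -
    have "t * (x \<bullet> y) = s * (x \<bullet> y)" using posdef_sym[OF M, of x y] x y by simp
    then show ?thesis using mpow_eig[OF M x, of r] mpow_eig[OF M y, of r] by auto
  qed
  have 1: "(mpow M r *v x) \<bullet> y = x \<bullet> (mpow M r *v y)" if "x \<in> eigs M" for x y
  proof (rule linear_eq_on[of "\<lambda>y. (mpow M r *v x) \<bullet> y" "\<lambda>y. x \<bullet> (mpow M r *v y)"])
    show "linear (\<lambda>y. (mpow M r *v x) \<bullet> y)" by (simp add: bounded_linear.linear bounded_linear_inner_right)
    show "linear (\<lambda>y. x \<bullet> (mpow M r *v y))"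
      by (rule linear_compose[unfolded o_def, OF matrix_vector_mul_linear])
        (simp add: bounded_linear.linear bounded_linear_inner_right)
    show "y \<in> span (eigs M)" using posdef_span_eigs[OF M] by simp
  qed (use ev that in \<open>auto simp: eigs_def\<close>)
  show ?thesis
  proof (rule linear_eq_on[of "\<lambda>x. (mpow M r *v x) \<bullet> y" "\<lambda>x. x \<bullet> (mpow M r *v y)"])
    show "linear (\<lambda>x. x \<bullet> (mpow M r *v y))" by (simp add: bounded_linear.linear bounded_linear_inner_left)
    show "linear (\<lambda>x. (mpow M r *v x) \<bullet> y)"
      by (rule linear_compose[unfolded o_def, OF matrix_vector_mul_linear])
        (simp add: bounded_linear.linear bounded_linear_inner_left)
    show "x \<in> span (eigs M)" using posdef_span_eigs[OF M] by simp
  qed (use 1 in auto)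
qed

lemma mpow_posdef:
  fixes M :: "complex^'n^'n"
  assumes M: "posdef M" shows "posdef (mpow M r)"
  unfolding posdef_alt
proof (intro conjI allI impI)
  show "mat_adj (mpow M r) = mpow M r" by (rule mat_adj_eqI) (rule mpow_sym[OF M])
  fix v :: "complex^'n" assume v: "v \<noteq> 0"
  \<comment> \<open>Positivity comes from the square of the self-adjoint and injective half
    power.\<close>
  have eq: "mpow M r = mpow M (r/2) ** mpow M (r/2)" by (simp add: mpow_mult[OF M])
  have "mpow M (- (r/2)) *v (mpow M (r/2) *v v) = v"
    using mpow_mult[OF M, of "-(r/2)" "r/2"] by (simp add: matrix_vector_mul_assoc mpow_0[OF M])
  then have "mpow M (r/2) *v v \<noteq> 0" using v by auto
  then show "0 < v \<bullet> (mpow M r *v v)"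
    unfolding eq matrix_vector_mul_assoc[symmetric] mpow_sym[OF M, of "r/2" v, symmetric] by simp
qed

lemma mpow_mpow:
  fixes M :: "complex^'n^'n"
  assumes M: "posdef M" shows "mpow (mpow M r) s = mpow M (r * s)"
proof (rule posdef_matrix_eqI[OF M])
  fix t v assume ev: "M *v v = t *\<^sub>R v"
  show "mpow (mpow M r) s *v v = mpow M (r * s) *v v"
    using mpow_eig[OF mpow_posdef[OF M] mpow_eig[OF M ev], of r s] mpow_eig[OF M ev, of "r * s"]
    by (simp add: powr_powr)
qed

lemma mult_axis: "M *v axis k (1::complex) = column k M"
  by (simp add: matrix_vector_mult_def axis_def column_def vec_eq_iff if_distrib cong: if_cong)

lemma continuous_approx_poly:
  fixes f :: "real \<Rightarrow> real"
  assumes "continuous_on {a..b} f" "0 < e"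
  shows "\<exists>q. \<forall>t\<in>{a..b}. \<bar>f t - poly q t\<bar> < e"
proof -
  obtain g where g: "real_polynomial_function g" "\<And>x. x \<in> {a..b} \<Longrightarrow> \<bar>f x - g x\<bar> < e"
    using Stone_Weierstrass_real_polynomial_function[OF _ assms] by (metis compact_Icc real_norm_def)
  then obtain c n where "g = (\<lambda>x. \<Sum>i\<le>n. c i * x ^ i)"
    using real_polynomial_function_iff_sum by blast
  then have "poly (\<Sum>i\<le>n. monom (c i) i) x = g x" for x
    by (simp add: poly_sum poly_monom)
  then show ?thesis using g by metis
qed

text \<open>A pointwise limit of continuous matrix functions: \<open>q m\<close> approximates the
  power on an interval growing to the positive half-line, and each fixed matrix has all its
  eigenvalues in that interval for large \<open>m\<close>.\<close>

lemma mpow_measurable: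
  fixes W :: "'a \<Rightarrow> complex^'n^'n"
  assumes W: "W \<in> borel_measurable M" and pd: "\<And>x. posdef (W x)"
  shows "(\<lambda>x. mpow (W x) r) \<in> borel_measurable M"
proof -
  have "\<exists>q. \<forall>t\<in>{inverse (Suc m)..Suc m}. \<bar>t powr r - poly q t\<bar> < inverse (Suc m)" for m
    by (rule continuous_approx_poly) (auto intro!: continuous_intros simp: field_simps)
  then obtain q where q: "\<And>m t. t\<in>{inverse (Suc m)..Suc m} \<Longrightarrow> \<bar>t powr r - poly (q m) t\<bar> < inverse (Suc m)"
    by metis
  have "\<forall>m. \<exists>G :: complex^'n^'n \<Rightarrow> complex^'n^'n. continuous_on UNIV G \<and>
     (\<forall>M t v. M *v v = t *\<^sub>R v \<longrightarrow> G M *v v = poly (q m) t *\<^sub>R v)"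
    using poly_matrix by blast
  then obtain G :: "nat \<Rightarrow> complex^'n^'n \<Rightarrow> complex^'n^'n" where Gc: "\<And>m. continuous_on UNIV (G m)"
    and G: "\<And>m M t v. M *v v = t *\<^sub>R v \<Longrightarrow> G m M *v v = poly (q m) t *\<^sub>R v"
    by metis
  have lim: "(\<lambda>m. G m A) \<longlonglongrightarrow> mpow A r" if A: "posdef A" for A :: "complex^'n^'n"
  proof -
    let ?S = "{v. (\<lambda>m. G m A *v v) \<longlonglongrightarrow> mpow A r *v v}"
    have "subspace ?S"
      unfolding subspace_def
      by (auto simp: matrix_vector_right_distrib linear_scale[OF matrix_vector_mul_linear] intro!: tendsto_intros)
    moreover have "eigs A \<subseteq> ?S"
    proof
      fix v assume "v \<in> eigs A"
      then obtain t where ev: "A *v v = t *\<^sub>R v" by (auto simp: eigs_def)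
      show "v \<in> ?S"
      proof (cases "v = 0")
        case False
        then have t: "t > 0" using posdef_eig_pos[OF A ev] by simp
        have "(\<lambda>m. poly (q m) t) \<longlonglongrightarrow> t powr r"
        proof (rule LIM_zero_cancel, rule Lim_null_comparison[OF _ LIMSEQ_inverse_real_of_nat])
          obtain n1 n2 :: nat where n: "t < real n1" "inverse t < real n2" using reals_Archimedean2 by metis
          show "\<forall>\<^sub>F m in sequentially. norm (poly (q m) t - t powr r) \<le> inverse (real (Suc m))"
            using eventually_ge_at_top[of "max n1 n2"]
          proof eventually_elim
            case (elim m)
            have "inverse t \<le> real (Suc m)" using n elim by (auto simp: max_def split: if_splits)
            then have "inverse (real (Suc m)) \<le> t"
              using t by (metis inverse_inverse_eq inverse_positive_iff_positive le_imp_inverse_le)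
            moreover have "t \<le> real (Suc m)" using n elim by (auto simp: max_def split: if_splits)
            ultimately show ?case using q[of t m] by (auto simp: abs_minus_commute)
          qed
        qed
        then show ?thesis using G[OF ev] mpow_eig[OF A ev] by (auto intro!: tendsto_intros)
      qed auto
    qed
    ultimately have "?S = UNIV"
      using span_minimal[of "eigs A" ?S] posdef_span_eigs[OF A] by auto
    then have l: "(\<lambda>m. G m A *v v) \<longlonglongrightarrow> mpow A r *v v" for v by blast
    have e: "B $ i $ j = (B *v axis j 1) $ i" for B :: "complex^'n^'n" and i j
      by (simp add: mult_axis column_def)
    show ?thesis
      by (intro vec_tendstoI) (use tendsto_vec_nth[OF l] in \<open>simp add: e\<close>)
  qed
  show ?thesis
  proof (rule borel_measurable_LIMSEQ_metric)
    show "(\<lambda>x. G m (W x)) \<in> borel_measurable M" for m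
      using W borel_measurable_continuous_onI[OF Gc] by (rule measurable_compose)
    show "(\<lambda>m. G m (W x)) \<longlonglongrightarrow> mpow (W x) r" for x using lim[OF pd] .
  qed
qed

section \<open>Operator norms\<close>

lemma mnorm_ge: "norm (M *v v) \<le> mnorm M * norm (v :: complex^'n)"
  unfolding mnorm_def by (rule onorm) simp

lemma mnorm_nonneg: "0 \<le> mnorm (M :: complex^'n^'m)"
  unfolding mnorm_def by (rule onorm_pos_le) simp

lemma mnorm_le:
  assumes "\<And>v. norm (M *v v) \<le> b * norm (v :: complex^'n)"
  shows "mnorm M \<le> b"
  unfolding mnorm_def by (rule onorm_le) (rule assms)

lemma mnorm_mult: "mnorm (A ** B) \<le> mnorm A * mnorm (B :: complex^'n^'m)"
proof (rule mnorm_le)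
  fix v
  have "norm (A ** B *v v) \<le> mnorm A * norm (B *v v)"
    unfolding matrix_vector_mul_assoc[symmetric] by (rule mnorm_ge)
  also have "\<dots> \<le> mnorm A * (mnorm B * norm v)"
    by (intro mult_left_mono mnorm_ge mnorm_nonneg)
  finally show "norm (A ** B *v v) \<le> mnorm A * mnorm B * norm v" by simp
qed

lemma mnorm_mat_adj_le: "mnorm (mat_adj M) \<le> mnorm (M :: complex^'n^'m)"
proof (rule mnorm_le)
  fix v
  let ?u = "mat_adj M *v v"
  have "norm ?u * norm ?u = v \<bullet> (M *v ?u)"
    by (metis inner_mat_adj power2_eq_square power2_norm_eq_inner)
  also have "\<dots> \<le> norm v * norm (M *v ?u)" by (rule norm_cauchy_schwarz)
  also have "\<dots> \<le> norm v * (mnorm M * norm ?u)" by (intro mult_left_mono mnorm_ge) auto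
  finally have "norm ?u * norm ?u \<le> (mnorm M * norm v) * norm ?u" by (simp add: ac_simps)
  then show "norm ?u \<le> mnorm M * norm v"
    by (cases "norm ?u = 0") (auto simp: mnorm_nonneg)
qed

lemma mnorm_mat_adj [simp]: "mnorm (mat_adj M) = mnorm (M :: complex^'n^'m)"
  using mnorm_mat_adj_le[of M] mnorm_mat_adj_le[of "mat_adj M"] by simp

lemma mat_adj_mult: "mat_adj (A ** B) = mat_adj B ** mat_adj (A :: complex^'n^'m)"
  by (simp add: mat_adj_def matrix_matrix_mult_def vec_eq_iff mult.commute)

lemma norm_le_sum_basis:
  fixes M :: "complex^'n^'m"
  shows "norm (M *v v) \<le> (\<Sum>k\<in>UNIV. norm (M *v axis k 1) * norm (v $ k))"
proof -
  have "M *v v = (\<Sum>k\<in>UNIV. (v $ k) *s (M *v axis k 1))"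
    by (simp only: mult_axis) (simp add: matrix_mult_sum)
  also have "norm \<dots> \<le> (\<Sum>k\<in>UNIV. norm ((v $ k) *s (M *v axis k 1)))" by (rule norm_sum)
  also have "\<dots> = (\<Sum>k\<in>UNIV. norm (M *v axis k 1) * norm (v $ k))"
    by (simp add: norm_vec_def L2_set_def norm_mult power_mult_distrib sum_distrib_left[symmetric]
        real_sqrt_mult mult.commute)
  finally show ?thesis .
qed

lemma mnorm_le_sum: "mnorm (M :: complex^'n^'m) \<le> (\<Sum>k\<in>UNIV. norm (M *v axis k 1))"
proof (rule mnorm_le)
  fix v
  have "norm (M *v v) \<le> (\<Sum>k\<in>UNIV. norm (M *v axis k 1) * norm (v $ k))" by (rule norm_le_sum_basis)
  also have "\<dots> \<le> (\<Sum>k\<in>UNIV. norm (M *v axis k 1) * norm v)"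
    by (intro sum_mono mult_left_mono component_le_norm_cart Finite_Cartesian_Product.norm_nth_le) auto
  finally show "norm (M *v v) \<le> (\<Sum>k\<in>UNIV. norm (M *v axis k 1)) * norm v"
    by (simp add: sum_distrib_right)
qed

text \<open>The operator norm is at most the Hilbert-Schmidt norm. This turns square sums of matrix
  norms into square sums over basis vectors, to which Parseval applies.\<close>

lemma mnorm_sq_le_sum: "(mnorm (M :: complex^'n^'m))\<^sup>2 \<le> (\<Sum>k\<in>UNIV. (norm (M *v axis k 1))\<^sup>2)"
proof -
  let ?s = "\<Sum>k\<in>UNIV. (norm (M *v axis k 1))\<^sup>2"
  have s: "0 \<le> ?s" by (simp add: sum_nonneg)
  have "mnorm M \<le> sqrt ?s"
  proof (rule mnorm_le)
    fix v
    have "norm (M *v v) \<le> (\<Sum>k\<in>UNIV. \<bar>norm (M *v axis k 1)\<bar> * \<bar>norm (v $ k)\<bar>)"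
      using norm_le_sum_basis[of M v] by simp
    also have "\<dots> \<le> L2_set (\<lambda>k. norm (M *v axis k 1)) UNIV * L2_set (\<lambda>k. norm (v $ k)) UNIV"
      by (rule L2_set_mult_ineq)
    finally show "norm (M *v v) \<le> sqrt ?s * norm v" by (simp add: L2_set_def norm_vec_def)
  qed
  then show ?thesis using s mnorm_nonneg[of M] by (metis power_mono real_sqrt_pow2)
qed

lemma posdef_inverse:
  fixes V :: "complex^'n^'n"
  assumes "posdef V"
  shows "matrix_inv V ** V = mat 1" "V ** matrix_inv V = mat 1" "mat_adj (matrix_inv V) = matrix_inv V"
proof -
  have m1: "mpow V 1 = V"
    by (rule posdef_matrix_eqI[OF assms]) (use mpow_eig[OF assms, where r=1] posdef_eig_pos[OF assms] in \<open>force\<close>)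
  \<comment> \<open>The spectral power with exponent -1 is a two-sided inverse.\<close>
  have "invertible V" unfolding invertible_def
    using mpow_mult[OF assms, of 1 "-1"] mpow_mult[OF assms, of "-1" 1] by (auto simp: m1 mpow_0[OF assms])
  then show 1: "matrix_inv V ** V = mat 1" and 2: "V ** matrix_inv V = mat 1"
    unfolding invertible_def matrix_inv_def by (metis (mono_tags, lifting) someI_ex)+
  show "mat_adj (matrix_inv V) = matrix_inv V"
  proof (rule mat_adj_eqI)
    fix x y
    have "(matrix_inv V *v x) \<bullet> y = (matrix_inv V *v x) \<bullet> (V *v (matrix_inv V *v y))"
      by (simp add: matrix_vector_mul_assoc 2)
    also have "\<dots> = x \<bullet> (matrix_inv V *v y)"
      unfolding posdef_sym[OF assms, symmetric] by (simp add: matrix_vector_mul_assoc 2)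
    finally show "(matrix_inv V *v x) \<bullet> y = x \<bullet> (matrix_inv V *v y)" .
  qed
qed

lemma posdef_mult_inv:
  fixes V :: "complex^'n^'n"
  assumes "posdef V"
  shows "matrix_inv V *v (V *v x) = x" "V *v (matrix_inv V *v x) = x"
  by (simp_all add: matrix_vector_mul_assoc posdef_inverse[OF assms])

lemma posdef_adj: "posdef V \<Longrightarrow> mat_adj V = V"
  by (simp add: posdef_alt)

section \<open>Cubes and dyadic grids\<close>

lemma dcube_corner_mem: "l > 0 \<Longrightarrow> a \<in> dcube a l"
  by (auto simp: dcube_def)

text \<open>Needed so that the definite descriptions behind \<open>cube_side\<close> and
  \<open>cube_corner\<close> denote.\<close>

lemma dcube_eq_iff:
  assumes "l > 0" "m > 0"
  shows "dcube a l = dcube b m \<longleftrightarrow> a = b \<and> l = m"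
proof
  assume eq: "dcube a l = dcube b m"
  have mem: "a \<in> dcube b m" "b \<in> dcube a l"
    using dcube_corner_mem[OF assms(1), of a] dcube_corner_mem[OF assms(2), of b] eq by auto
  have "a $ i = b $ i" for i
    by (rule antisym) (use mem in \<open>auto simp: dcube_def\<close>)
  then have "a = b" by (simp add: vec_eq_iff)
  have mem': "(\<chi> i. a $ i + r) \<in> dcube a s \<longleftrightarrow> 0 \<le> r \<and> r < s" for r s
    by (auto simp: dcube_def)
  have eq': "dcube a l = dcube a m" using eq \<open>a = b\<close> by simp
  have "l = m" using mem'[of l l] mem'[of l m] mem'[of m l] mem'[of m m] assms unfolding eq' by linarith
  with \<open>a = b\<close> show "a = b \<and> l = m" by simp
qed auto

lemma cube_side_dcube [simp]: "l > 0 \<Longrightarrow> cube_side (dcube a l) = l"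
  unfolding cube_side_def by (rule the_equality) (auto simp: dcube_eq_iff)

lemma cube_corner_dcube [simp]: "l > 0 \<Longrightarrow> cube_corner (dcube a l) = a"
  unfolding cube_corner_def by (rule the_equality) (auto simp: dcube_eq_iff)

lemma dcube_borel [measurable]: "dcube a l \<in> sets borel"
proof -
  have eq: "dcube a l = (\<Inter>i\<in>UNIV. {x. a $ i \<le> x $ i} \<inter> {x. x $ i < a $ i + l})"
    by (auto simp: dcube_def)
  have "closed {x. a $ i \<le> x $ i}" "open {x. x $ i < a $ i + l}" for i
    by (intro closed_Collect_le open_Collect_less continuous_intros)+
  then show ?thesis unfolding eq by (intro sets.finite_INT) auto
qed

lemma dcube_lmeasurable: "dcube a l \<in> lmeasurable"
proof -
  have "dcube a l \<subseteq> cbox a (a + (\<chi> i. l))"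
    by (force simp: dcube_def mem_box_cart less_eq_real_def)+
  then have "bounded (dcube a l)" using bounded_cbox bounded_subset by blast
  then show ?thesis by (intro bounded_set_imp_lmeasurable) auto
qed

lemma vol_dcube:
  fixes a :: "real^'d" assumes "l > 0" shows "vol (dcube a l) = l ^ CARD('d)"
proof -
  let ?b = "a + (\<chi> i. l)"
  have 1: "box a ?b \<subseteq> dcube a l" "dcube a l \<subseteq> cbox a ?b"
    by (force simp: dcube_def mem_box_cart less_eq_real_def)+
  have c: "measure lebesgue (cbox a ?b) = l ^ CARD('d)"
    using assms by (simp add: content_cbox_cart interval_ne_empty_cart)
  have b: "measure lebesgue (box a ?b) = l ^ CARD('d)"
    using c by (simp add: measure_lborel_box_eq measure_lborel_cbox_eq)
  show ?thesis unfolding vol_def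
    using measure_mono_fmeasurable[OF 1(1), of lebesgue] measure_mono_fmeasurable[OF 1(2), of lebesgue]
      dcube_lmeasurable[of a l] b c by auto
qed

definition lev :: "(real^'d) set \<Rightarrow> int" where
  "lev I = (THE k. cube_side I = 2 powr (- real_of_int k))"

lemma lev_dcube [simp]: "lev (dcube a (2 powr (- real_of_int k))) = k"
  unfolding lev_def by (rule the_equality) (auto simp: powr_inj)

text \<open>\<open>s i\<close> chooses the upper half in direction \<open>i\<close>, so the sign of
  a Haar function on a child can be read off from \<open>s\<close>.\<close>

definition child :: "(real^'d) set \<Rightarrow> ('d \<Rightarrow> bool) \<Rightarrow> (real^'d) set" where
  "child I s = dcube (cube_corner I + (\<chi> i. if s i then cube_side I / 2 else 0)) (cube_side I / 2)"

lemma ex1_same: "\<exists>!x. P x \<Longrightarrow> P a \<Longrightarrow> P b \<Longrightarrow> a = b"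
  by blast

section \<open>The grid axioms and the position of the children\<close>

locale grid =
  fixes D :: "(real^'d) set set"
  assumes grid: "dyadic_grid D"
begin

lemmas grid_dcube = grid[unfolded dyadic_grid_def, THEN conjunct1, rule_format]
lemmas grid_partition = grid[unfolded dyadic_grid_def, THEN conjunct2, THEN spec, THEN conjunct1, THEN spec]
lemmas grid_children = grid[unfolded dyadic_grid_def, THEN conjunct2, THEN spec, THEN conjunct2, rule_format]

lemma D_dcube:
  assumes "I \<in> D"
  shows "I = dcube (cube_corner I) (2 powr (- real_of_int (lev I)))"
    and "cube_side I = 2 powr (- real_of_int (lev I))"
proof -
  obtain a k where "I = dcube a (2 powr (- real_of_int k))"
    using grid_dcube[OF assms] by blast
  then show "I = dcube (cube_corner I) (2 powr (- real_of_int (lev I)))"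
    and "cube_side I = 2 powr (- real_of_int (lev I))" by simp_all
qed

lemma D_level_iff:
  "I \<in> D \<Longrightarrow> (\<exists>a. I = dcube a (2 powr (- real_of_int k))) \<longleftrightarrow> lev I = k"
proof
  assume "I \<in> D" "lev I = k"
  then show "\<exists>a. I = dcube a (2 powr (- real_of_int k))" using D_dcube(1)[of I] by blast
qed auto

lemma D_exists: "\<exists>I\<in>D. lev I = k \<and> x \<in> I"
proof -
  obtain I where "I \<in> D" "\<exists>a. I = dcube a (2 powr (- real_of_int k))" "x \<in> I"
    using grid_partition[of k x] by (elim ex1E) blast
  then show ?thesis using D_level_iff[of I k] by blast
qed

lemma D_unique:
  assumes "I \<in> D" "J \<in> D" "lev I = lev J" "x \<in> I" "x \<in> J"
  shows "I = J"
proof -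
  have "I \<in> D \<and> (\<exists>a. I = dcube a (2 powr (- real_of_int (lev J)))) \<and> x \<in> I"
    "J \<in> D \<and> (\<exists>a. J = dcube a (2 powr (- real_of_int (lev J)))) \<and> x \<in> J"
    using assms by (simp_all add: D_level_iff)
  then show ?thesis by (rule ex1_same[OF grid_partition[of "lev J" x]])
qed

lemma D_is_cube: "I \<in> D \<Longrightarrow> is_cube I"
  unfolding is_cube_def using D_dcube(1)[of I] by (metis powr_gt_zero zero_neq_numeral)

lemma D_lmeasurable: "I \<in> D \<Longrightarrow> I \<in> lmeasurable"
  using D_dcube(1)[of I] dcube_lmeasurable by metis

lemma D_borel: "I \<in> D \<Longrightarrow> I \<in> sets borel"
  using D_dcube(1)[of I] dcube_borel by metis

lemma D_sets [measurable, simp]: "I \<in> D \<Longrightarrow> I \<in> sets lebesgue"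
  using D_borel by auto

lemma D_nonempty: "I \<in> D \<Longrightarrow> \<exists>x. x \<in> I"
  using D_dcube(1)[of I] dcube_corner_mem by (metis powr_gt_zero zero_neq_numeral)

lemma D_vol: "I \<in> D \<Longrightarrow> vol I = (2 powr (- real_of_int (lev I))) ^ CARD('d)"
  by (subst D_dcube(1)) (auto simp: vol_dcube)

lemma D_vol_pos [simp]: "I \<in> D \<Longrightarrow> 0 < vol I"
  by (simp add: D_vol)

lemma D_vol_nz [simp]: "I \<in> D \<Longrightarrow> vol I \<noteq> 0"
  by (metis D_vol_pos less_irrefl)

text \<open>The axioms only say that a cube is a union of smaller cubes of the next level; where
  these lie has to be found. The cube \<open>J\<close> of that union containing the expected corner
  \<open>y\<close> is shown to have \<open>y\<close> as its own corner.\<close>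

lemma child_in_D:
  assumes I: "I \<in> D" shows "child I s \<in> D" "lev (child I s) = lev I + 1"
proof -
  define a l where "a = cube_corner I" and "l = cube_side I"
  define k where "k = lev I"
  have l: "l > 0" and lk: "l = 2 powr (- real_of_int k)"
    using D_dcube(2)[OF I] by (auto simp: l_def k_def)
  have Ia: "I = dcube a l" using D_dcube[OF I] by (simp add: a_def l_def)
  have l2: "l / 2 = 2 powr (- real_of_int (k + 1))" by (simp add: lk powr_diff powr_minus divide_simps powr_add)
  obtain C where C: "C \<subseteq> {J\<in>D. \<exists>a. J = dcube a (2 powr (- real_of_int (k + 1)))}" "\<Union>C = I"
    using grid_children[OF I, of k] I by (auto simp: D_level_iff k_def)
  have CD0: "J \<in> D \<and> lev J = k + 1" if "J \<in> C" for J
  proof -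
    have h: "J \<in> D \<and> (\<exists>a. J = dcube a (2 powr (- real_of_int (k + 1))))"
      using subsetD[OF C(1) that] by (rule CollectD)
    then have "lev J = k + 1" using D_level_iff[of J "k + 1"] by simp
    with h show ?thesis by (intro conjI conjunct1[OF h])
  qed
  have CD: "\<And>J. J \<in> C \<Longrightarrow> J \<in> D \<and> (\<exists>b. J = dcube b (l/2) \<and> (\<forall>i. a $ i \<le> b $ i \<and> b $ i \<le> a $ i + l/2))"
  proof -
    fix J assume J: "J \<in> C"
    obtain b where b: "J = dcube b (l/2)"
      using D_dcube(1)[of J] CD0[OF J] unfolding l2 by metis
    have sub: "J \<subseteq> dcube a l" using J C(2) Ia by auto
    have "a $ i \<le> b $ i" for i
      using sub b dcube_corner_mem[of "l/2" b] l by (auto simp: dcube_def)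
    moreover have "b $ i \<le> a $ i + l/2" for i
    proof (rule ccontr)
      assume neg: "\<not> b $ i \<le> a $ i + l/2"
      \<comment> \<open>Moving along the diagonal by \<open>t\<close> stays inside \<open>J\<close>
        but leaves the parent in direction \<open>i\<close>.\<close>
      define t where "t = max 0 (a $ i + l - b $ i)"
      have t: "0 \<le> t" "t < l/2" using neg l by (auto simp: t_def max_def)
      have "(\<chi> j. b $ j + t) \<in> J" using t by (auto simp: b dcube_def)
      then have "b $ i + t < a $ i + l" using sub by (auto simp: dcube_def)
      then show False by (auto simp: t_def)
    qed
    ultimately show "J \<in> D \<and> (\<exists>b. J = dcube b (l/2) \<and> (\<forall>i. a $ i \<le> b $ i \<and> b $ i \<le> a $ i + l/2))"
      using b CD0[OF J] by metis
  qed
  define y where "y = a + (\<chi> i. if s i then l / 2 else 0)"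
  have "y \<in> I" using l by (auto simp: Ia y_def dcube_def)
  then obtain J where J: "J \<in> C" "y \<in> J" using C(2) by auto
  then obtain b where b: "J = dcube b (l/2)" "\<And>i. a $ i \<le> b $ i" "\<And>i. b $ i \<le> a $ i + l/2"
    using CD by blast
  have "b = y"
  proof -
    have "b $ i = y $ i" for i
    proof (rule ccontr)
      assume ne: "b $ i \<noteq> y $ i"
      have yb: "b $ i \<le> y $ i" "y $ i < b $ i + l/2" using J b(1) by (auto simp: dcube_def)
      have si: "s i" using ne yb b(2)[of i] by (auto simp: y_def split: if_splits)
      have bi: "a $ i < b $ i" "b $ i < a $ i + l/2" using ne yb b(2)[of i] si l by (auto simp: y_def)
      \<comment> \<open>If \<open>J\<close> started strictly between the two expected positions in
        direction \<open>i\<close>, the cube through \<open>z\<close>, which starts at the edge of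
        the parent, would contain \<open>b\<close> too and so overlap \<open>J\<close>.\<close>
      define z where "z = (\<chi> j. if j = i then a $ i else b $ j)"
      have "z \<in> I"
        unfolding Ia dcube_def z_def using b(2,3) l
        by (auto intro: le_less_trans[OF b(3)])
      then obtain J' where J': "J' \<in> C" "z \<in> J'" using C(2) by auto
      then obtain b' where b': "J' = dcube b' (l/2)" "\<And>i. a $ i \<le> b' $ i"
        using CD by blast
      have zb: "b' $ j \<le> z $ j \<and> z $ j < b' $ j + l/2" for j using J' b'(1) by (auto simp: dcube_def)
      have b'i: "b' $ i = a $ i" using zb[of i] b'(2)[of i] by (auto simp: z_def)
      have "b \<in> J'" unfolding b'(1) dcube_def
      proof (intro CollectI allI)
        fix j show "b' $ j \<le> b $ j \<and> b $ j < b' $ j + l / 2"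
          using zb[of j] bi b'i by (cases "j = i") (auto simp: z_def)
      qed
      moreover have "b \<in> J" using l b(1) by (auto simp: dcube_corner_mem)
      ultimately have "J = J'" using D_unique[of J J' b] CD0[OF J(1)] CD0[OF J'(1)] by simp
      then have "b = b'" using b(1) b'(1) l by (simp add: dcube_eq_iff)
      then show False using bi b'i by simp
    qed
    then show ?thesis by (simp add: vec_eq_iff)
  qed
  then have "child I s = J" using b(1) unfolding child_def y_def a_def l_def by simp
  then show "child I s \<in> D" "lev (child I s) = lev I + 1"
    using CD0[OF J(1)] by (simp_all add: k_def)
qed

lemma D_side_pos: "I \<in> D \<Longrightarrow> 0 < cube_side I"
  using D_dcube(2) by simp

lemma mem_D_iff: "I \<in> D \<Longrightarrow> x \<in> I \<longleftrightarrow> (\<forall>i. cube_corner I $ i \<le> x $ i \<and> x $ i < cube_corner I $ i + cube_side I)"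
  using D_dcube[of I] by (auto simp: dcube_def)

lemma mem_child_iff: "x \<in> child I s \<longleftrightarrow> (\<forall>i. cube_corner I $ i + (if s i then cube_side I / 2 else 0) \<le> x $ i \<and>
    x $ i < cube_corner I $ i + (if s i then cube_side I else cube_side I / 2))"
  by (auto simp: child_def dcube_def field_simps)

lemma child_subset:
  assumes "I \<in> D" shows "child I s \<subseteq> I"
proof
  fix x assume x: "x \<in> child I s"
  have "cube_corner I $ i \<le> x $ i \<and> x $ i < cube_corner I $ i + cube_side I" for i
    using x[unfolded mem_child_iff, rule_format, of i] D_side_pos[OF assms] by (auto split: if_splits)
  then show "x \<in> I" using mem_D_iff[OF assms] by blast
qed

lemma Union_child:
  assumes "I \<in> D" shows "(\<Union>s. child I s) = I"
proof
  show "I \<subseteq> (\<Union>s. child I s)"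
  proof
    fix x assume x: "x \<in> I"
    have "x \<in> child I (\<lambda>i. cube_corner I $ i + cube_side I / 2 \<le> x $ i)"
      using x mem_D_iff[OF assms] D_side_pos[OF assms] by (auto simp: mem_child_iff)
    then show "x \<in> (\<Union>s. child I s)" by blast
  qed
qed (use child_subset[OF assms] in auto)

lemma child_disjoint:
  assumes "I \<in> D" "s \<noteq> s'" shows "child I s \<inter> child I s' = {}"
proof (rule ccontr)
  assume "child I s \<inter> child I s' \<noteq> {}"
  then obtain x where x: "x \<in> child I s" "x \<in> child I s'" by blast
  have "s i = s' i" for i
    using x(1)[unfolded mem_child_iff, rule_format, of i] x(2)[unfolded mem_child_iff, rule_format, of i]
    by (auto split: if_splits)
  then show False using assms by auto
qed

lemma disjoint_child: "I \<in> D \<Longrightarrow> disjoint_family_on (child I) UNIV"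
  using child_disjoint by (auto simp: disjoint_family_on_def)

lemma vol_child:
  assumes "I \<in> D" shows "vol (child I s) = vol I / 2 ^ CARD('d)"
  using D_side_pos[OF assms] D_vol[OF assms] D_dcube(2)[OF assms]
  by (simp add: child_def vol_dcube power_divide)

section \<open>Nesting of dyadic cubes, finiteness and induction\<close>

lemma parent:
  assumes "I \<in> D" shows "\<exists>J\<in>D. \<exists>s. I = child J s"
proof -
  obtain x where x: "x \<in> I" using D_nonempty assms by blast
  obtain J where J: "J \<in> D" "lev J = lev I - 1" "x \<in> J" using D_exists by blast
  then obtain s where s: "x \<in> child J s" using Union_child by blast
  have "I = child J s" by (rule D_unique[OF assms child_in_D(1)[OF J(1)] _ x s]) (simp add: child_in_D(2) J)
  then show ?thesis using J by blast
qed

lemma ancestor: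
  assumes "I \<in> D" shows "\<exists>J\<in>D. lev J = lev I - int m \<and> I \<subseteq> J"
proof (induction m)
  case (Suc m)
  then obtain J where J: "J \<in> D" "lev J = lev I - int m" "I \<subseteq> J" by blast
  obtain K s where "K \<in> D" "J = child K s" using parent[OF J(1)] by blast
  then show ?case using J child_subset child_in_D(2) by (intro bexI[of _ K]) auto
qed (use assms in auto)

lemma D_nested:
  assumes I: "I \<in> D" and J: "J \<in> D" and x: "x \<in> I" "x \<in> J" and l: "lev J \<le> lev I"
  shows "I \<subseteq> J"
proof -
  obtain K where K: "K \<in> D" "lev K = lev I - int (nat (lev I - lev J))" "I \<subseteq> K" using ancestor[OF I] by blast
  then have "K = J" using D_unique[OF K(1) J _ _ x(2)] l x(1) by auto
  then show ?thesis using K by simp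
qed

lemma D_trichotomy: "I \<in> D \<Longrightarrow> J \<in> D \<Longrightarrow> I \<inter> J \<noteq> {} \<Longrightarrow> I \<subseteq> J \<or> J \<subseteq> I"
  using D_nested by (metis disjoint_iff linorder_le_cases)

lemma subset_lev:
  assumes "I \<in> D" "J \<in> D" "I \<subseteq> J" shows "lev J \<le> lev I"
proof (rule ccontr)
  assume "\<not> lev J \<le> lev I"
  obtain x where "x \<in> I" using D_nonempty assms by blast
  then have "J \<subseteq> I" using D_nested[of J I x] assms \<open>\<not> lev J \<le> lev I\<close> by auto
  then have "I = J" using assms(3) by blast
  then show False using \<open>\<not> lev J \<le> lev I\<close> by simp
qed

lemma psubset_lev:
  assumes "I \<in> D" "J \<in> D" "I \<subset> J" shows "lev J < lev I"
proof -
  obtain x where "x \<in> I" using D_nonempty assms by blast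
  then have "lev I \<noteq> lev J" using D_unique[OF assms(1,2), of x] assms(3) by blast
  then show ?thesis using subset_lev[of I J] assms by auto
qed

lemma subset_child:
  assumes "I \<in> D" "J \<in> D" "I \<subset> J" shows "\<exists>s. I \<subseteq> child J s"
proof -
  obtain x where x: "x \<in> I" using D_nonempty assms by blast
  then obtain s where s: "x \<in> child J s" using Union_child[OF assms(2)] assms(3) by blast
  have "I \<subseteq> child J s"
    using D_nested[OF assms(1) child_in_D(1)[OF assms(2)] x s] psubset_lev[OF assms] child_in_D(2)[OF assms(2), of s]
    by simp
  then show ?thesis by blast
qed

lemma finite_desc: "J \<in> D \<Longrightarrow> finite {I\<in>D. I \<subseteq> J \<and> lev I \<le> N}"
proof (induction "nat (N - lev J)" arbitrary: J)
  case 0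
  have "{I\<in>D. I \<subseteq> J \<and> lev I \<le> N} \<subseteq> {J}"
    using 0 psubset_lev by force
  then show ?case using finite_subset by blast
next
  case (Suc n)
  have "finite {I\<in>D. I \<subseteq> child J s \<and> lev I \<le> N}" for s
    using Suc child_in_D[OF Suc(3), of s] by auto
  then have "finite (insert J (\<Union>s. {I\<in>D. I \<subseteq> child J s \<and> lev I \<le> N}))" by simp
  moreover have "{I\<in>D. I \<subseteq> J \<and> lev I \<le> N} \<subseteq> insert J (\<Union>s. {I\<in>D. I \<subseteq> child J s \<and> lev I \<le> N})"
  proof
    fix I assume I: "I \<in> {I\<in>D. I \<subseteq> J \<and> lev I \<le> N}"
    show "I \<in> insert J (\<Union>s. {I\<in>D. I \<subseteq> child J s \<and> lev I \<le> N})"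
    proof (cases "I = J")
      case False
      then obtain s where "I \<subseteq> child J s" using subset_child[of I J] I Suc(3) by auto
      then show ?thesis using I by auto
    qed simp
  qed
  ultimately show ?case by (rule finite_subset[rotated])
qed

text \<open>Stopping cubes need not belong to \<open>F\<close>, but only those containing a cube of
  \<open>F\<close> matter. This is what keeps every stopping family finite.\<close>

lemma finite_between:
  assumes "finite F" "F \<subseteq> D" "J \<in> D"
  shows "finite {K\<in>D. K \<subseteq> J \<and> (\<exists>I\<in>F. I \<subseteq> K)}"
proof -
  have "finite (\<Union>I\<in>F. {K\<in>D. K \<subseteq> J \<and> lev K \<le> lev I})"
    using assms finite_desc by auto
  moreover have "{K\<in>D. K \<subseteq> J \<and> (\<exists>I\<in>F. I \<subseteq> K)} \<subseteq> (\<Union>I\<in>F. {K\<in>D. K \<subseteq> J \<and> lev K \<le> lev I})"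
    using subset_lev assms(2) by auto
  ultimately show ?thesis by (rule finite_subset[rotated])
qed

text \<open>Induction from small cubes to large ones. It is well founded because beyond the finest
  level of the finite family \<open>F\<close> no cube contains a cube of \<open>F\<close>.\<close>

lemma level_induct [consumes 3, case_names base step]:
  assumes J: "J \<in> D" and F: "finite F" "F \<subseteq> D"
    and base: "\<And>J. J \<in> D \<Longrightarrow> (\<And>I. I \<in> F \<Longrightarrow> \<not> I \<subseteq> J) \<Longrightarrow> P J"
    and step: "\<And>J. J \<in> D \<Longrightarrow> (\<And>K. K \<in> D \<Longrightarrow> K \<subset> J \<Longrightarrow> P K) \<Longrightarrow> P J"
  shows "P J"
proof -
  obtain N where N: "\<And>I. I \<in> F \<Longrightarrow> lev I \<le> N"
    using F(1) by (metis Max_ge finite_imageI image_eqI)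
  show ?thesis using J
  proof (induction "nat (N + 1 - lev J)" arbitrary: J rule: less_induct)
    case less
    show ?case
    proof (cases "lev J \<le> N")
      case True
      show ?thesis
      proof (rule step[OF less(2)])
        fix K assume K: "K \<in> D" "K \<subset> J"
        show "P K" by (rule less(1)) (use psubset_lev[OF K(1) less(2) K(2)] True K in auto)
      qed
    next
      case False
      then show ?thesis using base[OF less(2)] subset_lev N F less(2) by (metis order.trans subsetD)
    qed
  qed
qed

section \<open>Maximal cubes and stopping families\<close>

definition maxl :: "(real^'d) set set \<Rightarrow> (real^'d) set set" where
  "maxl S = {K\<in>S. \<forall>K'\<in>S. K \<subseteq> K' \<longrightarrow> K = K'}"

lemma maxl_disjoint:
  assumes "S \<subseteq> D" shows "disjoint (maxl S)"
  unfolding disjoint_def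
proof (intro ballI impI)
  fix A B assume AB: "A \<in> maxl S" "B \<in> maxl S" "A \<noteq> B"
  then have S: "A \<in> S" "B \<in> S" "A \<subseteq> B \<Longrightarrow> A = B" "B \<subseteq> A \<Longrightarrow> B = A" by (auto simp: maxl_def)
  show "A \<inter> B = {}"
  proof (rule ccontr)
    assume "A \<inter> B \<noteq> {}"
    then have "A \<subseteq> B \<or> B \<subseteq> A" using D_trichotomy[of A B] S(1,2) assms by auto
    then show False using S(3,4) AB(3) by auto
  qed
qed

lemma maxl_cover:
  assumes "finite S" "I \<in> S" shows "\<exists>K\<in>maxl S. I \<subseteq> K"
proof -
  obtain K where "K \<in> S" "I \<subseteq> K" "\<forall>b\<in>S. K \<subseteq> b \<longrightarrow> K = b"
    using finite_has_maximal2[OF assms] by blast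
  then show ?thesis by (intro bexI[of _ K]) (auto simp: maxl_def)
qed

text \<open>\<open>X\<close> consists of the maximal cubes strictly inside \<open>J\<close> that
  satisfy \<open>S\<close> and contain a cube of \<open>F\<close>. The last clause is the recursion
  used by all stopping arguments: any sum splits into an unstopped part, estimated by hand, and sums
  below the stopped cubes, left to the induction.\<close>

lemma stopping_family:
  assumes J: "J \<in> D" and F: "finite F" "F \<subseteq> D"
  shows "\<exists>X. finite X \<and> X \<subseteq> D \<and> disjoint X \<and>
    (\<forall>K\<in>X. S K \<and> K \<subset> J \<and> (\<forall>K'\<in>D. K \<subset> K' \<longrightarrow> K' \<subset> J \<longrightarrow> \<not> S K')) \<and>
    (\<forall>c :: _ \<Rightarrow> real. (\<Sum>I | I \<in> F \<and> I \<subseteq> J. c I) =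
       (\<Sum>I | I \<in> F \<and> I \<subseteq> J \<and> (\<forall>K\<in>D. I \<subseteq> K \<longrightarrow> K \<subset> J \<longrightarrow> \<not> S K). c I) + (\<Sum>K\<in>X. \<Sum>I | I \<in> F \<and> I \<subseteq> K. c I))"
proof -
  define T where "T = {K\<in>D. K \<subset> J \<and> S K \<and> (\<exists>I\<in>F. I \<subseteq> K)}"
  have fT: "finite T" by (rule finite_subset[OF _ finite_between[OF F J]]) (auto simp: T_def)
  have TD: "T \<subseteq> D" by (auto simp: T_def)
  let ?X = "maxl T"
  have X: "finite ?X" "?X \<subseteq> D" using fT TD by (auto simp: maxl_def)
  have dX: "disjoint ?X" by (rule maxl_disjoint[OF TD])
  show ?thesis
  proof (intro exI[of _ ?X] conjI X dX ballI allI)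
    fix K assume K: "K \<in> ?X"
    then have KT: "K \<in> T" and max: "\<And>K'. K' \<in> T \<Longrightarrow> K \<subseteq> K' \<Longrightarrow> K = K'" by (auto simp: maxl_def)
    have "\<not> S K'" if K': "K' \<in> D" "K \<subset> K'" "K' \<subset> J" for K'
    proof
      \<comment> \<open>A larger stopped cube contains the cube of \<open>F\<close> below
        \<open>K\<close>, so it lies in \<open>T\<close> as well; maximality in \<open>T\<close>
        therefore excludes it.\<close>
      assume "S K'"
      moreover obtain I where "I \<in> F" "I \<subseteq> K" using KT by (auto simp: T_def)
      ultimately have "K' \<in> T" using K' unfolding T_def by blast
      then show False using max[of K'] K' by auto
    qed
    then show "\<And>K'. K' \<in> D \<Longrightarrow> K \<subset> K' \<longrightarrow> K' \<subset> J \<longrightarrow> \<not> S K'" by blast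
    show "S K" "K \<subset> J" using KT by (auto simp: T_def)
  next
    fix c :: "_ \<Rightarrow> real"
    let ?U = "{I. I \<in> F \<and> I \<subseteq> J \<and> (\<forall>K\<in>D. I \<subseteq> K \<longrightarrow> K \<subset> J \<longrightarrow> \<not> S K)}"
    let ?V = "\<Union>K\<in>?X. {I. I \<in> F \<and> I \<subseteq> K}"
    have eq: "{I. I \<in> F \<and> I \<subseteq> J} = ?U \<union> ?V"
    proof
      show "{I. I \<in> F \<and> I \<subseteq> J} \<subseteq> ?U \<union> ?V"
      proof
        fix I assume I: "I \<in> {I. I \<in> F \<and> I \<subseteq> J}"
        show "I \<in> ?U \<union> ?V"
        proof (cases "I \<in> ?U")
          case False
          then obtain K where "K \<in> D" "I \<subseteq> K" "K \<subset> J" "S K" using I by blast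
          then have "K \<in> T" using I by (auto simp: T_def)
          then obtain L where "L \<in> ?X" "K \<subseteq> L" using maxl_cover[OF fT] by blast
          then have "I \<in> ?V" using \<open>I \<subseteq> K\<close> I by blast
          then show ?thesis by blast
        qed auto
      qed
      show "?U \<union> ?V \<subseteq> {I. I \<in> F \<and> I \<subseteq> J}" by (auto simp: maxl_def T_def)
    qed
    have disj: "?U \<inter> ?V = {}" by (auto simp: maxl_def T_def)
    have "sum c ?V = (\<Sum>K\<in>?X. \<Sum>I | I \<in> F \<and> I \<subseteq> K. c I)"
    proof (rule sum.UNION_disjoint)
      show "\<forall>i\<in>?X. \<forall>j\<in>?X. i \<noteq> j \<longrightarrow> {I \<in> F. I \<subseteq> i} \<inter> {I \<in> F. I \<subseteq> j} = {}"
      proof (intro ballI impI)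
        fix i j assume ij: "i \<in> ?X" "j \<in> ?X" "i \<noteq> j"
        then have "i \<inter> j = {}" using dX by (auto simp: disjoint_def)
        then show "{I \<in> F. I \<subseteq> i} \<inter> {I \<in> F. I \<subseteq> j} = {}"
          using D_nonempty F by blast
      qed
    qed (use X F in auto)
    moreover have "sum c (?U \<union> ?V) = sum c ?U + sum c ?V"
      using F(1) X(1) by (intro sum.union_disjoint disj) auto
    ultimately show "(\<Sum>I | I \<in> F \<and> I \<subseteq> J. c I) = sum c ?U + (\<Sum>K\<in>?X. \<Sum>I | I \<in> F \<and> I \<subseteq> K. c I)"
      by (simp only: eq)
  qed
qed

section \<open>Integrals over children and over disjoint families\<close>

lemma integral_children:
  fixes f :: "_ \<Rightarrow> 'b::{banach, second_countable_topology}"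
  assumes "I \<in> D" "set_integrable lebesgue I f"
  shows "(LINT x:I|lebesgue. f x) = (\<Sum>s\<in>UNIV. LINT x:child I s|lebesgue. f x)"
proof -
  have "set_integrable lebesgue (child I s) f" for s
    using assms child_in_D child_subset by (intro set_integrable_subset[OF assms(2)]) auto
  then have "(LINT x:(\<Union>s. child I s)|lebesgue. f x) = (\<Sum>s\<in>UNIV. LINT x:child I s|lebesgue. f x)"
    using disjoint_child[OF assms(1)] child_in_D(1)[OF assms(1)]
    by (intro set_integral_finite_Union) auto
  then show ?thesis unfolding Union_child[OF assms(1)] .
qed

lemma integral_disjoint_eq:
  fixes f :: "_ \<Rightarrow> 'b::{banach, second_countable_topology}"
  assumes "finite X" "X \<subseteq> D" "disjoint X" "\<And>K. K \<in> X \<Longrightarrow> set_integrable lebesgue K f"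
  shows "(LINT x:\<Union>X|lebesgue. f x) = (\<Sum>K\<in>X. LINT x:K|lebesgue. f x)"
proof -
  have "(LINT x:(\<Union>K\<in>X. K)|lebesgue. f x) = (\<Sum>K\<in>X. LINT x:K|lebesgue. f x)"
    using assms by (intro set_integral_finite_Union) (auto simp: disjoint_family_on_def disjoint_def)
  then show ?thesis by simp
qed

lemma integral_disjoint_le:
  fixes f :: "_ \<Rightarrow> real"
  assumes "finite X" "X \<subseteq> D" "disjoint X" "\<And>K. K \<in> X \<Longrightarrow> K \<subseteq> E" "E \<in> sets lebesgue"
    and f: "set_integrable lebesgue E f" "\<And>x. x \<in> E \<Longrightarrow> 0 \<le> f x"
  shows "(\<Sum>K\<in>X. LINT x:K|lebesgue. f x) \<le> (LINT x:E|lebesgue. f x)"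
proof -
  have K: "set_integrable lebesgue K f" if "K \<in> X" for K
    using assms that by (intro set_integrable_subset[OF f(1)]) auto
  have m: "\<Union>X \<in> sets lebesgue" using assms by (intro sets.finite_Union) auto
  have "(\<Sum>K\<in>X. LINT x:K|lebesgue. f x) = (LINT x:\<Union>X|lebesgue. f x)"
    using integral_disjoint_eq[OF assms(1-3) K] by simp
  also have "\<dots> \<le> (LINT x:E|lebesgue. f x)"
    unfolding set_lebesgue_integral_def
  proof (rule integral_mono)
    show "integrable lebesgue (\<lambda>x. indicat_real (\<Union> X) x *\<^sub>R f x)"
      using set_integrable_subset[OF f(1) m] assms(4) unfolding set_integrable_def by auto
    show "integrable lebesgue (\<lambda>x. indicat_real E x *\<^sub>R f x)" using f(1) unfolding set_integrable_def .
    show "indicat_real (\<Union> X) x *\<^sub>R f x \<le> indicat_real E x *\<^sub>R f x" for x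
      using assms(4) f(2) by (auto simp: indicator_def)
  qed
  finally show ?thesis .
qed

lemma D_integrable_const [simp]: "I \<in> D \<Longrightarrow> set_integrable lebesgue I (\<lambda>x. c :: 'b::{banach, second_countable_topology})"
  unfolding set_integrable_def using D_lmeasurable
  by (auto intro!: integrable_indicator simp: fmeasurable_def)

lemma D_integral_const [simp]: "I \<in> D \<Longrightarrow> (LINT x:I|lebesgue. c :: 'b::{banach, second_countable_topology}) = vol I *\<^sub>R c"
  unfolding set_lebesgue_integral_def vol_def using D_lmeasurable[of I]
  by (simp add: fmeasurable_def)

section \<open>Haar functions\<close>

text \<open>Up to normalisation this is the constant value of the Haar function of type
  \<open>e\<close> on the child \<open>s\<close>: a character of the group of sign patterns.\<close>

definition sg :: "('d \<Rightarrow> bool) \<Rightarrow> ('d \<Rightarrow> bool) \<Rightarrow> real" where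
  "sg e s = (\<Prod>i\<in>UNIV. if \<not> e i \<and> s i then - 1 else 1)"

lemma abs_sg [simp]: "\<bar>sg e s\<bar> = 1"
  unfolding sg_def abs_prod by (rule prod.neutral) auto

text \<open>The sum over all sign patterns factorises into a product over the coordinates of sums of
  two terms, and a coordinate where \<open>e\<close> and \<open>e'\<close> differ contributes the
  factor 0.\<close>

lemma sum_sg_mult: "(\<Sum>s\<in>UNIV. sg e s * sg e' s) = (if e = e' then 2 ^ CARD('d) else 0)"
proof -
  let ?f = "\<lambda>i (b::bool). (if \<not> e i \<and> b then - 1 else 1) * (if \<not> e' i \<and> b then - 1 else (1::real))"
  have "(\<Sum>s\<in>UNIV. sg e s * sg e' s) = (\<Sum>s\<in>PiE UNIV (\<lambda>_. UNIV). \<Prod>i\<in>UNIV. ?f i (s i))"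
    unfolding sg_def prod.distrib[symmetric] by (simp add: PiE_UNIV_domain)
  also have "\<dots> = (\<Prod>i\<in>UNIV. \<Sum>b\<in>UNIV. ?f i b)"
    by (rule prod_sum_PiE[symmetric]) auto
  also have "\<dots> = (\<Prod>i\<in>UNIV. if e i = e' i then 2 else 0)"
    by (intro prod.cong) (auto simp: UNIV_bool)
  also have "\<dots> = (if e = e' then 2 ^ CARD('d) else 0)"
  proof (cases "e = e'")
    case False
    then obtain i where "e i \<noteq> e' i" by auto
    then show ?thesis using False by (auto intro!: prod_zero)
  qed auto
  finally show ?thesis .
qed

lemma card_signs: "real (CARD('d \<Rightarrow> bool)) = 2 ^ CARD('d)"
proof -
  have "sg e s * sg e s = 1" for e s using abs_sg[of e s] by (simp add: abs_if split: if_splits)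
  then show ?thesis using sum_sg_mult[of e e for e] by simp
qed

lemma vol_children: "I \<in> D \<Longrightarrow> (\<Sum>s\<in>UNIV. vol (child I s)) = vol I"
  using card_signs by (simp add: vol_child)

text \<open>The signature missing from \<open>sigS\<close> is the constant character, so this is
  orthogonality to it: the Haar functions used have mean zero.\<close>

lemma sum_sg: "e \<in> sigS \<Longrightarrow> (\<Sum>s\<in>UNIV. sg e s) = 0"
  using sum_sg_mult[of e "\<lambda>_. True"] by (simp add: sigS_def sg_def[of "\<lambda>_. True"])

lemma haar_child:
  assumes I: "I \<in> D" and x: "x \<in> child I s"
  shows "haar I e x = sg e s / sqrt (vol I)"
proof -
  let ?l = "cube_side I"
  have l: "?l > 0" by (rule D_side_pos[OF I])
  have v: "sqrt (vol I) = (\<Prod>i\<in>(UNIV::'d set). sqrt ?l)"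
    using D_vol[OF I] D_dcube(2)[OF I] by (simp add: real_sqrt_power)
  have "haar I e x = (\<Prod>i\<in>UNIV. (if \<not> e i \<and> s i then - 1 else 1) / sqrt ?l)"
    unfolding haar_def Let_def
  proof (rule prod.cong[OF refl])
    fix i
    have "cube_corner I $ i + (if s i then cube_side I / 2 else 0) \<le> x $ i \<and>
      x $ i < cube_corner I $ i + (if s i then cube_side I else cube_side I / 2)"
      using x[unfolded mem_child_iff] by blast
    then show "(if e i then if cube_corner I $ i \<le> x $ i \<and> x $ i < cube_corner I $ i + cube_side I
                 then 1 / sqrt (cube_side I) else 0
         else if cube_corner I $ i \<le> x $ i \<and> x $ i < cube_corner I $ i + cube_side I / 2 then 1 / sqrt (cube_side I)
              else if cube_corner I $ i + cube_side I / 2 \<le> x $ i \<and> x $ i < cube_corner I $ i + cube_side I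
                   then - 1 / sqrt (cube_side I) else 0) =
        (if \<not> e i \<and> s i then - 1 else 1) / sqrt (cube_side I)"
      using l by (auto split: if_splits)
  qed
  then show ?thesis by (simp add: prod_dividef v sg_def)
qed

lemma haar_outside:
  assumes I: "I \<in> D" and x: "x \<notin> I"
  shows "haar I e x = 0"
proof -
  obtain i where i: "\<not> (cube_corner I $ i \<le> x $ i \<and> x $ i < cube_corner I $ i + cube_side I)"
    using x mem_D_iff[OF I, of x] by auto
  show ?thesis unfolding haar_def Let_def
    by (rule prod_zero[OF finite], rule bexI[of _ i]) (use i D_side_pos[OF I] in auto)
qed

lemma haar_eq_sum:
  assumes I: "I \<in> D"
  shows "haar I e x = (\<Sum>s\<in>UNIV. indicator (child I s) x * (sg e s / sqrt (vol I)))"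
proof (cases "x \<in> I")
  case True
  then obtain s where s: "x \<in> child I s" using Union_child[OF I] by blast
  have "(\<Sum>s'\<in>UNIV. indicator (child I s') x * (sg e s' / sqrt (vol I))) =
      (\<Sum>s'\<in>UNIV. if s' = s then sg e s' / sqrt (vol I) else 0)"
  proof (intro sum.cong refl)
    fix s'
    have "x \<notin> child I s'" if "s' \<noteq> s" using s child_disjoint[OF I that] by blast
    then show "indicator (child I s') x * (sg e s' / sqrt (vol I)) = (if s' = s then sg e s' / sqrt (vol I) else 0)"
      using s by auto
  qed
  then show ?thesis using haar_child[OF I s] by simp
next
  case False
  then have "x \<notin> child I s" for s using child_subset[OF I] by blast
  then show ?thesis using haar_outside[OF I False] by simp
qed

lemma haar_borel: "I \<in> D \<Longrightarrow> haar I e \<in> borel_measurable borel"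
proof -
  assume I: "I \<in> D"
  have "haar I e = (\<lambda>x. \<Sum>s\<in>UNIV. indicator (child I s) x * (sg e s / sqrt (vol I)))"
    by (rule ext) (rule haar_eq_sum[OF I])
  also have "\<dots> \<in> borel_measurable borel"
    using child_in_D(1)[OF I] D_borel
    by (intro borel_measurable_sum borel_measurable_times borel_measurable_indicator) auto
  finally show ?thesis .
qed

lemma abs_haar:
  assumes I: "I \<in> D" shows "\<bar>haar I e x\<bar> = indicator I x / sqrt (vol I)"
proof (cases "x \<in> I")
  case True
  then obtain s where "x \<in> child I s" using Union_child[OF I] by blast
  from haar_child[OF I this] show ?thesis using True less_imp_le[OF D_vol_pos[OF I]] by (simp add: abs_divide)
qed (use haar_outside[OF I] in simp)

end

section \<open>Hoelder's inequality\<close>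

text \<open>Young's inequality is applied to \<open>f\<close> and \<open>g\<close> divided by their
  norms. If one norm is zero, the product vanishes almost everywhere.\<close>

lemma Holder_integral:
  fixes f g :: "'a \<Rightarrow> real"
  assumes pq: "1 < p" "1 < q" "1 / p + 1 / q = 1"
    and [measurable]: "f \<in> borel_measurable M" "g \<in> borel_measurable M"
    and nn: "\<And>x. 0 \<le> f x" "\<And>x. 0 \<le> g x"
    and ip: "integrable M (\<lambda>x. f x powr p)" and iq: "integrable M (\<lambda>x. g x powr q)"
  shows "integrable M (\<lambda>x. f x * g x)"
    and "(\<integral>x. f x * g x \<partial>M) \<le> (\<integral>x. f x powr p \<partial>M) powr (1/p) * (\<integral>x. g x powr q \<partial>M) powr (1/q)"
proof -
  have young: "a * b \<le> a powr p / p + b powr q / q" if "0 \<le> a" "0 \<le> b" for a b :: real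
    using Youngs_inequality[OF pq that] .
  show int: "integrable M (\<lambda>x. f x * g x)"
  proof (rule Bochner_Integration.integrable_bound)
    show "integrable M (\<lambda>x. f x powr p / p + g x powr q / q)"
      using ip iq by auto
    show "AE x in M. norm (f x * g x) \<le> norm (f x powr p / p + g x powr q / q)"
      using young[OF nn] nn pq by (intro AE_I2) (auto simp: abs_mult)
  qed measurable
  define A B where "A = (\<integral>x. f x powr p \<partial>M)" and "B = (\<integral>x. g x powr q \<partial>M)"
  have A0: "A \<ge> 0" and B0: "B \<ge> 0" unfolding A_def B_def by (auto intro!: integral_nonneg_AE)
  have zero: "(\<integral>x. f x * g x \<partial>M) \<le> A powr (1/p) * B powr (1/q)" if "A = 0 \<or> B = 0"
  proof -
    have "AE x in M. f x * g x = 0"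
    proof (cases "A = 0")
      case True
      then have "AE x in M. f x powr p = 0"
        using ip unfolding A_def by (subst (asm) integral_nonneg_eq_0_iff_AE) auto
      then show ?thesis by eventually_elim auto
    next
      case False
      then have "AE x in M. g x powr q = 0"
        using that iq unfolding B_def by (subst (asm) integral_nonneg_eq_0_iff_AE) auto
      then show ?thesis by eventually_elim auto
    qed
    then have "(\<integral>x. f x * g x \<partial>M) = (\<integral>x. 0 \<partial>M)" by (intro integral_cong_AE) auto
    then show ?thesis using A0 B0 by simp
  qed
  show "(\<integral>x. f x * g x \<partial>M) \<le> A powr (1/p) * B powr (1/q)"
  proof (cases "A = 0 \<or> B = 0")
    case False
    then have AB: "A > 0" "B > 0" using A0 B0 by auto
    define c where "c = A powr (1/p) * B powr (1/q)"
    have c: "c > 0" using AB by (simp add: c_def)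
    have pt: "f x * g x \<le> c * (f x powr p / (p * A) + g x powr q / (q * B))" for x
    proof -
      have "(f x / A powr (1/p)) * (g x / B powr (1/q)) \<le> (f x / A powr (1/p)) powr p / p + (g x / B powr (1/q)) powr q / q"
        by (rule young) (use nn in auto)
      also have "\<dots> = f x powr p / (p * A) + g x powr q / (q * B)"
        using nn AB pq by (simp add: powr_divide powr_powr field_simps)
      finally show ?thesis using c unfolding c_def
        using AB by (simp add: field_simps)
    qed
    have "(\<integral>x. f x * g x \<partial>M) \<le> (\<integral>x. c * (f x powr p / (p * A) + g x powr q / (q * B)) \<partial>M)"
      using int ip iq pt by (intro integral_mono) auto
    also have "\<dots> = c * (A / (p * A) + B / (q * B))"
      using ip iq by (simp add: A_def[symmetric] B_def[symmetric])
    also have "\<dots> = c" using AB pq by (simp add: field_simps)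
    finally show ?thesis by (simp add: c_def)
  qed (rule zero)
qed

context grid
begin

section \<open>Maximal functions of finite families\<close>

text \<open>The maximal function over the cubes of \<open>F\<close> that contain \<open>x\<close>.
  Inserting 0 makes the maximum exist for empty \<open>F\<close> and yields the value 0 outside the
  union of \<open>F\<close>.\<close>

definition gmax :: "(real^'d) set set \<Rightarrow> ((real^'d) set \<Rightarrow> real) \<Rightarrow> real^'d \<Rightarrow> real" where
  "gmax F g x = Max (insert 0 ((\<lambda>I. g I * indicator I x) ` F))"

lemma gmax_nonneg: "finite F \<Longrightarrow> 0 \<le> gmax F g x"
  unfolding gmax_def by (rule Max_ge) auto

lemma gmax_ge: "finite F \<Longrightarrow> I \<in> F \<Longrightarrow> x \<in> I \<Longrightarrow> g I \<le> gmax F g x"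
  unfolding gmax_def by (rule Max_ge) (auto intro!: image_eqI[of _ _ I])

lemma gmax_le:
  assumes "finite F" "0 \<le> c" "\<And>I. I \<in> F \<Longrightarrow> x \<in> I \<Longrightarrow> g I \<le> c" shows "gmax F g x \<le> c"
  unfolding gmax_def using assms by (auto simp: indicator_def)

lemma gmax_outside: "finite F \<Longrightarrow> x \<notin> \<Union>F \<Longrightarrow> gmax F g x = 0"
  by (intro antisym gmax_le gmax_nonneg) auto

lemma gmax_borel [measurable]:
  assumes "finite F" "F \<subseteq> D" shows "gmax F g \<in> borel_measurable borel"
proof -
  have "(\<lambda>x. Max ((\<lambda>f. f x) ` (insert (\<lambda>_. 0) ((\<lambda>I x. g I * indicator I x) ` F)))) \<in> borel_measurable borel"
    using assms D_borel
    by (intro borel_measurable_Max) auto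
  moreover have "(\<lambda>f. f x) ` (insert (\<lambda>_. 0) ((\<lambda>I x. g I * indicator I x) ` F)) = insert 0 ((\<lambda>I. g I * indicator I x) ` F)" for x
    by auto
  ultimately have "(\<lambda>x. Max (insert 0 ((\<lambda>I. g I * indicator I x) ` F))) \<in> borel_measurable borel" by simp
  then show ?thesis unfolding gmax_def[abs_def] .
qed

lemma gmax_lebesgue [measurable]:
  "finite F \<Longrightarrow> F \<subseteq> D \<Longrightarrow> gmax F g \<in> borel_measurable lebesgue"
  using gmax_borel by (simp add: measurable_completion)

lemma gmax_bounded: "finite F \<Longrightarrow> gmax F g x \<le> (\<Sum>I\<in>F. \<bar>g I\<bar> * indicator I x)"
proof (intro gmax_le sum_nonneg)
  fix I assume I: "finite F" "I \<in> F" "x \<in> I"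
  have "g I \<le> \<bar>g I\<bar> * indicator I x" using I by simp
  also have "\<dots> \<le> (\<Sum>I\<in>F. \<bar>g I\<bar> * indicator I x)"
    by (rule member_le_sum) (use I in auto)
  finally show "g I \<le> (\<Sum>I\<in>F. \<bar>g I\<bar> * indicator I x)" .
qed auto

lemma Union_lmeasurable: "finite F \<Longrightarrow> F \<subseteq> D \<Longrightarrow> \<Union>F \<in> lmeasurable"
  using D_lmeasurable by (intro fmeasurable.finite_Union) auto

lemma integrable_bdd:
  fixes f :: "_ \<Rightarrow> 'b::{banach, second_countable_topology}"
  assumes "finite F" "F \<subseteq> D" and m: "f \<in> borel_measurable lebesgue" and b: "\<And>x. norm (f x) \<le> C * indicator (\<Union>F) x"
  shows "integrable lebesgue f"
proof (rule Bochner_Integration.integrable_bound[OF _ m])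
  have "\<Union>F \<in> fmeasurable lebesgue" by (rule Union_lmeasurable[OF assms(1,2)])
  then show "integrable lebesgue (\<lambda>x. \<bar>C\<bar> * indicator (\<Union>F) x :: real)"
    by (auto simp: fmeasurable_def intro!: integrable_mult_right)
  have "norm (f x) \<le> norm (\<bar>C\<bar> * indicator (\<Union>F) x)" for x
  proof (cases "x \<in> \<Union>F")
    case True then show ?thesis using b[of x] by (simp add: indicator_def)
  next
    case False then show ?thesis using b[of x] by (simp add: indicator_def)
  qed
  then show "AE x in lebesgue. norm (f x) \<le> norm (\<bar>C\<bar> * indicator (\<Union>F) x)" by simp
qed

lemma gmax_powr_bound:
  assumes "finite F" "0 < r"
  shows "norm (gmax F g x powr r) \<le> (\<Sum>I\<in>F. \<bar>g I\<bar>) powr r * indicator (\<Union>F) x"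
proof (cases "x \<in> \<Union>F")
  case True
  have "gmax F g x \<le> (\<Sum>I\<in>F. \<bar>g I\<bar>)"
    by (rule order.trans[OF gmax_bounded[OF assms(1)]]) (auto intro!: sum_mono simp: indicator_def)
  then show ?thesis using True assms gmax_nonneg[OF assms(1)] by (auto intro!: powr_mono2)
next
  case False
  then have "gmax F g x = 0" using gmax_outside[OF assms(1)] by auto
  then show ?thesis using False assms by auto
qed

lemma gmax_powr_integrable:
  "finite F \<Longrightarrow> F \<subseteq> D \<Longrightarrow> 0 < r \<Longrightarrow> integrable lebesgue (\<lambda>x. gmax F g x powr r)"
proof (rule integrable_bdd[of F, OF _ _ _ gmax_powr_bound])
  assume F: "finite F" "F \<subseteq> D"
  note [measurable] = gmax_lebesgue[OF F]
  show "(\<lambda>x. gmax F g x powr r) \<in> borel_measurable lebesgue" by measurable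
qed

lemma gmax_mult_integrable:
  assumes F: "finite F" "F \<subseteq> D" and \<Phi>: "\<And>I. I \<in> F \<Longrightarrow> set_integrable lebesgue I \<Phi>"
    and m: "\<Phi> \<in> borel_measurable lebesgue" and nn: "\<And>x. 0 \<le> \<Phi> x"
  shows "integrable lebesgue (\<lambda>x. gmax F g x * (\<Phi> x :: real))"
proof (rule Bochner_Integration.integrable_bound)
  show "integrable lebesgue (\<lambda>x. \<Sum>I\<in>F. \<bar>g I\<bar> * (indicator I x *\<^sub>R \<Phi> x))"
    using \<Phi> by (auto simp: set_integrable_def)
  show "(\<lambda>x. gmax F g x * \<Phi> x) \<in> borel_measurable lebesgue"
    using m gmax_lebesgue[OF F] by measurable
  have "norm (gmax F g x * \<Phi> x) \<le> norm (\<Sum>I\<in>F. \<bar>g I\<bar> * (indicator I x *\<^sub>R \<Phi> x))" for x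
  proof -
    have "gmax F g x * \<Phi> x \<le> (\<Sum>I\<in>F. \<bar>g I\<bar> * indicator I x) * \<Phi> x"
      by (intro mult_right_mono gmax_bounded F nn)
    then show ?thesis using nn[of x] gmax_nonneg[OF F(1), of g x]
      by (simp add: sum_distrib_right mult.assoc abs_mult)
  qed
  then show "AE x in lebesgue. norm (gmax F g x * \<Phi> x) \<le> norm (\<Sum>I\<in>F. \<bar>g I\<bar> * (indicator I x *\<^sub>R \<Phi> x))" by simp
qed

lemma sum_maxl:
  fixes c :: "_ \<Rightarrow> real"
  assumes F: "finite F" "F \<subseteq> D"
  shows "(\<Sum>I\<in>F. c I) = (\<Sum>K\<in>maxl F. \<Sum>I | I \<in> F \<and> I \<subseteq> K. c I)"
proof -
  have eq: "F = (\<Union>K\<in>maxl F. {I. I \<in> F \<and> I \<subseteq> K})"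
  proof
    show "F \<subseteq> (\<Union>K\<in>maxl F. {I. I \<in> F \<and> I \<subseteq> K})" using maxl_cover[OF F(1)] by auto
  qed auto
  have fin: "finite (maxl F)" using F by (auto simp: maxl_def)
  have "sum c (\<Union>K\<in>maxl F. {I. I \<in> F \<and> I \<subseteq> K}) = (\<Sum>K\<in>maxl F. \<Sum>I | I \<in> F \<and> I \<subseteq> K. c I)"
  proof (rule sum.UNION_disjoint[OF fin])
    show "\<forall>i\<in>maxl F. \<forall>j\<in>maxl F. i \<noteq> j \<longrightarrow> {I \<in> F. I \<subseteq> i} \<inter> {I \<in> F. I \<subseteq> j} = {}"
    proof (intro ballI impI)
      fix i j assume ij: "i \<in> maxl F" "j \<in> maxl F" "i \<noteq> j"
      then have dis: "i \<inter> j = {}" using maxl_disjoint[OF F(2)] by (auto simp: disjoint_def)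
      have "\<not> (I \<subseteq> i \<and> I \<subseteq> j)" if "I \<in> F" for I
        using D_nonempty[of I] that F(2) dis by auto
      then show "{I \<in> F. I \<subseteq> i} \<inter> {I \<in> F. I \<subseteq> j} = {}" by auto
    qed
  qed (use F in auto)
  then show ?thesis using eq by simp
qed

lemma Union_maxl:
  assumes "finite F" shows "\<Union>(maxl F) = \<Union>F"
proof
  show "\<Union>F \<subseteq> \<Union>(maxl F)" using maxl_cover[OF assms] by (auto dest: subsetD)
qed (auto simp: maxl_def)

lemma maxl_props:
  assumes "finite F" "F \<subseteq> D"
  shows "finite (maxl F)" "maxl F \<subseteq> D" "maxl F \<subseteq> F" "disjoint (maxl F)"
  using assms maxl_disjoint by (auto simp: maxl_def)

lemma integral_Union_maxl:
  fixes f :: "_ \<Rightarrow> real"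
  assumes F: "finite F" "F \<subseteq> D" "\<And>I. I \<in> F \<Longrightarrow> set_integrable lebesgue I f"
  shows "(LINT x:\<Union>F|lebesgue. f x) = (\<Sum>K\<in>maxl F. LINT x:K|lebesgue. f x)"
  unfolding Union_maxl[OF F(1), symmetric]
  by (rule integral_disjoint_eq) (use maxl_props[OF F(1,2)] F(3) in auto)

lemma set_integrable_Union_D:
  fixes f :: "_ \<Rightarrow> real"
  assumes F: "finite F" "F \<subseteq> D" "\<And>I. I \<in> F \<Longrightarrow> set_integrable lebesgue I f"
  shows "set_integrable lebesgue (\<Union>F) f"
proof -
  have "set_integrable lebesgue (\<Union>I\<in>F. I) f"
    using F by (intro set_integrable_UN) auto
  then show ?thesis by simp
qed

text \<open>Induction on the number of cubes: the smallest value of \<open>g\<close> is subtracted from all the others.\<close>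

lemma carleson_embedding:
  assumes "finite F" "F \<subseteq> D"
    and "\<And>I. I \<in> F \<Longrightarrow> 0 \<le> g I" "\<And>I. I \<in> F \<Longrightarrow> 0 \<le> c I"
    and "\<And>I. I \<in> F \<Longrightarrow> set_integrable lebesgue I \<Phi>"
    and "\<Phi> \<in> borel_measurable lebesgue" "\<And>x. 0 \<le> \<Phi> x"
    and "\<And>J. J \<in> F \<Longrightarrow> (\<Sum>I | I \<in> F \<and> I \<subseteq> J. c I) \<le> (LINT x:J|lebesgue. \<Phi> x)"
  shows "(\<Sum>I\<in>F. c I * g I) \<le> (\<integral>x. gmax F g x * \<Phi> x \<partial>lebesgue)"
  using assms
proof (induction "card F" arbitrary: F g rule: less_induct)
  case less
  note F = less(2,3) and g = less(4) and c = less(5) and \<Phi> = less(6-8) and hyp = less(9)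
  show ?case
  proof (cases "F = {}")
    case True
    then show ?thesis by (simp add: gmax_def)
  next
    case False
    define m where "m = Min (g ` F)"
    have m: "m \<in> g ` F" "\<And>I. I \<in> F \<Longrightarrow> m \<le> g I"
      using False F(1) by (auto simp: m_def)
    then have m0: "m \<ge> 0" using g by auto
    \<comment> \<open>The cubes where \<open>g\<close> attains its minimum \<open>m\<close> drop
      out, which makes the induction proceed; \<open>g - m\<close> stays nonnegative on the
      rest.\<close>
    define F' where "F' = {I\<in>F. m < g I}"
    have F': "finite F'" "F' \<subseteq> F" "F' \<subseteq> D" "card F' < card F"
      using F m by (auto simp: F'_def intro!: psubset_card_mono)
    have IH: "(\<Sum>I\<in>F'. c I * (g I - m)) \<le> (\<integral>x. gmax F' (\<lambda>I. g I - m) x * \<Phi> x \<partial>lebesgue)"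
    proof (rule less(1)[OF F'(4) F'(1,3)])
      fix J assume J: "J \<in> F'"
      have "(\<Sum>I | I \<in> F' \<and> I \<subseteq> J. c I) \<le> (\<Sum>I | I \<in> F \<and> I \<subseteq> J. c I)"
        using F F'(2) c by (intro sum_mono2) auto
      then show "(\<Sum>I | I \<in> F' \<and> I \<subseteq> J. c I) \<le> (LINT x:J|lebesgue. \<Phi> x)"
        using hyp[of J] J F' by auto
    qed (use F' c \<Phi> in \<open>auto simp: F'_def\<close>)
    \<comment> \<open>The bottom layer of height \<open>m\<close> is paid for by the hypothesis at
      the maximal cubes of \<open>F\<close>, which are disjoint.\<close>
    have c1: "(\<Sum>I\<in>F. c I) \<le> (LINT x:\<Union>F|lebesgue. \<Phi> x)"
    proof -
      have "(\<Sum>K\<in>maxl F. \<Sum>I | I \<in> F \<and> I \<subseteq> K. c I) \<le> (\<Sum>K\<in>maxl F. LINT x:K|lebesgue. \<Phi> x)"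
        using maxl_props[OF F] by (intro sum_mono hyp) auto
      then show ?thesis using integral_Union_maxl[OF F \<Phi>(1)] sum_maxl[OF F, of c] by simp
    qed
    have "(\<Sum>I\<in>F. c I * g I) = m * (\<Sum>I\<in>F. c I) + (\<Sum>I\<in>F. c I * (g I - m))"
      by (simp add: sum_distrib_left sum.distrib[symmetric] algebra_simps)
    also have "(\<Sum>I\<in>F. c I * (g I - m)) = (\<Sum>I\<in>F'. c I * (g I - m))"
    proof (rule sum.mono_neutral_right)
      show "\<forall>i\<in>F - F'. c i * (g i - m) = 0"
        using m(2) by (force simp: F'_def)
    qed (use F F' in auto)
    also have "m * (\<Sum>I\<in>F. c I) + \<dots> \<le> m * (LINT x:\<Union>F|lebesgue. \<Phi> x) + (\<integral>x. gmax F' (\<lambda>I. g I - m) x * \<Phi> x \<partial>lebesgue)"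
      using c1 IH m0 by (intro add_mono mult_left_mono)
    also have "\<dots> = (\<integral>x. m * (indicator (\<Union>F) x *\<^sub>R \<Phi> x) + gmax F' (\<lambda>I. g I - m) x * \<Phi> x \<partial>lebesgue)"
      unfolding set_lebesgue_integral_def
      using set_integrable_Union_D[OF F \<Phi>(1)] gmax_mult_integrable[OF F'(1,3) _ \<Phi>(2,3)] \<Phi>(1) F'(2)
      by (subst Bochner_Integration.integral_add) (auto simp: set_integrable_def)
    also have "\<dots> \<le> (\<integral>x. gmax F g x * \<Phi> x \<partial>lebesgue)"
    proof (rule integral_mono)
      show "integrable lebesgue (\<lambda>x. m * (indicator (\<Union>F) x *\<^sub>R \<Phi> x) + gmax F' (\<lambda>I. g I - m) x * \<Phi> x)"
        using set_integrable_Union_D[OF F \<Phi>(1)] gmax_mult_integrable[OF F'(1,3) _ \<Phi>(2,3)] \<Phi>(1) F'(2)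
        by (intro Bochner_Integration.integrable_add integrable_mult_right) (auto simp: set_integrable_def)
      show "integrable lebesgue (\<lambda>x. gmax F g x * \<Phi> x)" by (rule gmax_mult_integrable[OF F \<Phi>])
      fix x
      \<comment> \<open>The layers add up pointwise: \<open>m\<close> on the union plus the maximal
        function of \<open>g - m\<close> stays below the maximal function of
        \<open>g\<close>.\<close>
      have "m * indicator (\<Union>F) x + gmax F' (\<lambda>I. g I - m) x \<le> gmax F g x"
      proof (cases "x \<in> \<Union>F")
        case True
        then obtain I where I: "I \<in> F" "x \<in> I" by auto
        have mg: "m \<le> gmax F g x" using gmax_ge[OF F(1) I, of g] m(2)[OF I(1)] by simp
        have "gmax F' (\<lambda>I. g I - m) x \<le> gmax F g x - m"
        proof (rule gmax_le[OF F'(1)])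
          fix I assume "I \<in> F'" "x \<in> I"
          then show "g I - m \<le> gmax F g x - m" using gmax_ge[OF F(1), of I x g] F'(2) by auto
        qed (use mg in simp)
        then show ?thesis using True by simp
      next
        case False
        then have "gmax F' (\<lambda>I. g I - m) x = 0" using F'(1,2) by (intro gmax_outside) auto
        then show ?thesis using False gmax_nonneg[OF F(1)] by simp
      qed
      from mult_right_mono[OF this \<Phi>(3)[of x]]
      show "m * (indicator (\<Union>F) x *\<^sub>R \<Phi> x) + gmax F' (\<lambda>I. g I - m) x * \<Phi> x \<le> gmax F g x * \<Phi> x"
        by (simp add: algebra_simps)
    qed
    finally show ?thesis .
  qed
qed

section \<open>Doob's maximal inequality for finite families\<close>

lemma young_doob:
  fixes m s :: real
  assumes pq: "1 < q" "0 \<le> s" "s \<le> m"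
  shows "m powr q - s powr q \<le> q / (q - 1) * (m * (m powr (q - 1) - s powr (q - 1)))"
proof -
  define q' where "q' = q / (q - 1)"
  have q': "q' > 1" "1 / q + 1 / q' = 1" using pq by (auto simp: q'_def field_simps)
  \<comment> \<open>Young's inequality in this form bounds the increment of the \<open>q\<close>-th
    power by that of the power \<open>q - 1\<close>, which is one layer of Doob's
    inequality.\<close>
  have "m * s powr (q - 1) \<le> m powr q / q + (s powr (q - 1)) powr q' / q'"
    using pq q' by (intro Youngs_inequality) auto
  also have "(s powr (q - 1)) powr q' = s powr q" using pq by (simp add: powr_powr q'_def)
  finally have "q' * (m * s powr (q - 1)) \<le> q' * (m powr q / q + s powr q / q')"
    using q' by (intro mult_left_mono) auto
  also have "\<dots> = (q' - 1) * m powr q + s powr q"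
    using q' pq by (simp add: q'_def field_simps)
  finally have "m powr q - s powr q \<le> q' * (m powr q - m * s powr (q - 1))"
    by (simp add: algebra_simps)
  moreover have "m powr q = m * m powr (q - 1)" using pq by (cases "m = 0") (auto simp: powr_diff)
  ultimately show ?thesis by (simp add: q'_def algebra_simps)
qed

text \<open>A discrete layer-cake argument: the values of \<open>g\<close> are removed from below,
  \<open>s\<close> being the height already treated. A layer from \<open>s\<close> to
  \<open>m\<close> lives on the whole union of \<open>F\<close>, where \<open>m\<close> times the
  measure is at most the integral of \<open>\<phi>\<close>, and \<open>young_doob\<close> converts
  its height.\<close>

lemma doob_step:
  assumes "1 < q"
    and "finite F" "F \<subseteq> D" "0 \<le> s" "\<And>I. I \<in> F \<Longrightarrow> s \<le> g I"
    and "\<And>I. I \<in> F \<Longrightarrow> set_integrable lebesgue I \<phi>"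
    and "\<phi> \<in> borel_measurable lebesgue" "\<And>x. 0 \<le> \<phi> x"
    and "\<And>I. I \<in> F \<Longrightarrow> g I * vol I \<le> (LINT x:I|lebesgue. \<phi> x)"
  shows "(LINT x:\<Union>F|lebesgue. gmax F g x powr q - s powr q)
     \<le> q / (q - 1) * (LINT x:\<Union>F|lebesgue. \<phi> x * (gmax F g x powr (q - 1) - s powr (q - 1)))"
  using assms(2-)
proof (induction "card F" arbitrary: F s rule: less_induct)
  case less
  note F = less(2,3) and s = less(4,5) and \<phi> = less(6-8) and hyp = less(9)
  let ?q = "q / (q - 1)"
  have Um: "\<Union>F \<in> lmeasurable" by (rule Union_lmeasurable[OF F])
  show ?case
  proof (cases "F = {}")
    case True
    then show ?thesis by (simp add: set_lebesgue_integral_def)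
  next
    case False
    define m where "m = Min (g ` F)"
    have m: "m \<in> g ` F" "\<And>I. I \<in> F \<Longrightarrow> m \<le> g I"
      using False F(1) by (auto simp: m_def)
    have sm: "s \<le> m" using m s by auto
    then have m0: "m \<ge> 0" using s by auto
    define F' where "F' = {I\<in>F. m < g I}"
    have F': "finite F'" "F' \<subseteq> F" "F' \<subseteq> D" "card F' < card F"
      using F m by (auto simp: F'_def intro!: psubset_card_mono)
    have IH: "(LINT x:\<Union>F'|lebesgue. gmax F' g x powr q - m powr q)
      \<le> ?q * (LINT x:\<Union>F'|lebesgue. \<phi> x * (gmax F' g x powr (q - 1) - m powr (q - 1)))"
      by (rule less(1)[OF F'(4) F'(1,3) m0]) (use F' \<phi> hyp in \<open>auto simp: F'_def\<close>)
    \<comment> \<open>Stated for every exponent \<open>r\<close>, because both sides of the claim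
      are decomposed by it, with exponents \<open>q\<close> and \<open>q - 1\<close>. Off the union
      of \<open>F'\<close> the maximal function is constantly \<open>m\<close>.\<close>
    have split: "indicator (\<Union>F) x *\<^sub>R (gmax F g x powr r - s powr r)
      = indicator (\<Union>F) x * (m powr r - s powr r) + indicator (\<Union>F') x *\<^sub>R (gmax F' g x powr r - m powr r)" for x r
    proof (cases "x \<in> \<Union>F")
      case True
      then obtain I where I: "I \<in> F" "x \<in> I" by auto
      have mg: "m \<le> gmax F g x" using gmax_ge[OF F(1) I, of g] m(2)[OF I(1)] by simp
      show ?thesis
      proof (cases "x \<in> \<Union>F'")
        case True
        then obtain I' where I': "I' \<in> F'" "x \<in> I'" by auto
        have mg': "m \<le> gmax F' g x" using gmax_ge[OF F'(1) I', of g] I' unfolding F'_def by auto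
        have "gmax F g x = gmax F' g x"
        proof (rule antisym)
          show "gmax F g x \<le> gmax F' g x"
          proof (rule gmax_le[OF F(1) gmax_nonneg[OF F'(1)]])
            fix K assume K: "K \<in> F" "x \<in> K"
            show "g K \<le> gmax F' g x"
              by (cases "K \<in> F'") (use K mg' gmax_ge[OF F'(1) _ K(2), of g] in \<open>auto simp: F'_def\<close>)
          qed
          show "gmax F' g x \<le> gmax F g x"
            by (rule gmax_le[OF F'(1) gmax_nonneg[OF F(1)]]) (use gmax_ge[OF F(1)] F'(2) in auto)
        qed
        then show ?thesis using True \<open>x \<in> \<Union>F\<close> by simp
      next
        case False
        have "gmax F g x \<le> m"
          by (rule gmax_le[OF F(1) m0]) (use False in \<open>auto simp: F'_def not_less\<close>)
        then have "gmax F g x = m" using mg by simp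
        then show ?thesis using True False by simp
      qed
    next
      case False
      then have "x \<notin> \<Union>F'" using F'(2) by auto
      then show ?thesis using False by simp
    qed
    have int1: "integrable lebesgue (\<lambda>x. indicator (\<Union>F') x *\<^sub>R (gmax F' g x powr r - m powr r))" if "0 < r" for r
    proof -
      have "integrable lebesgue (\<lambda>x. indicator (\<Union>F') x *\<^sub>R (gmax F' g x powr r))"
        using gmax_powr_integrable[OF F'(1,3) that, of g] Union_lmeasurable[OF F'(1,3)]
        by (intro integrable_mult_indicator) (auto simp: fmeasurable_def)
      moreover have "integrable lebesgue (\<lambda>x. indicator (\<Union>F') x *\<^sub>R (m powr r))"
        using Union_lmeasurable[OF F'(1,3)] by (intro integrable_scaleR_left) (auto simp: fmeasurable_def)
      ultimately have "integrable lebesgue (\<lambda>x. indicator (\<Union>F') x *\<^sub>R (gmax F' g x powr r) - indicator (\<Union>F') x *\<^sub>R (m powr r))"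
        by (rule Bochner_Integration.integrable_diff)
      then show ?thesis unfolding scaleR_diff_right .
    qed
    have int2: "integrable lebesgue (\<lambda>x. \<phi> x * (indicator (\<Union>F') x *\<^sub>R (gmax F' g x powr r - m powr r)))" if "0 < r" for r
    proof (rule Bochner_Integration.integrable_bound)
      have "set_integrable lebesgue (\<Union>F') \<phi>" using \<phi>(1) F' by (intro set_integrable_Union_D) auto
      then show "integrable lebesgue (\<lambda>x. (indicator (\<Union>F') x *\<^sub>R \<phi> x) * ((\<Sum>I\<in>F'. \<bar>g I\<bar>) powr r + m powr r))"
        by (intro integrable_mult_left) (auto simp: set_integrable_def)
      show "(\<lambda>x. \<phi> x * (indicator (\<Union>F') x *\<^sub>R (gmax F' g x powr r - m powr r))) \<in> borel_measurable lebesgue"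
        using borel_measurable_integrable[OF int1[OF that]] \<phi>(2) by measurable
      have "norm (\<phi> x * (indicator (\<Union>F') x *\<^sub>R (gmax F' g x powr r - m powr r)))
         \<le> norm ((indicator (\<Union>F') x *\<^sub>R \<phi> x) * ((\<Sum>I\<in>F'. \<bar>g I\<bar>) powr r + m powr r))" for x
      proof -
        have "\<bar>gmax F' g x powr r - m powr r\<bar> \<le> (\<Sum>I\<in>F'. \<bar>g I\<bar>) powr r + m powr r"
        proof -
          have "gmax F' g x powr r \<le> (\<Sum>I\<in>F'. \<bar>g I\<bar>) powr r"
            using gmax_powr_bound[OF F'(1) that, of g x] mult_left_le[of "indicat_real (\<Union>F') x" "(\<Sum>I\<in>F'. \<bar>g I\<bar>) powr r"]
            by (auto simp: indicator_le_1)
          then show ?thesis using powr_ge_zero[of "gmax F' g x" r] powr_ge_zero[of m r] by linarith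
        qed
        then show ?thesis using \<phi>(3)[of x] by (auto simp: indicator_def abs_mult intro!: mult_left_mono)
      qed
      then show "AE x in lebesgue. norm (\<phi> x * (indicator (\<Union>F') x *\<^sub>R (gmax F' g x powr r - m powr r)))
         \<le> norm ((indicator (\<Union>F') x *\<^sub>R \<phi> x) * ((\<Sum>I\<in>F'. \<bar>g I\<bar>) powr r + m powr r))" by simp
    qed
    have U\<phi>: "integrable lebesgue (\<lambda>x. indicator (\<Union>F) x *\<^sub>R \<phi> x)"
      using set_integrable_Union_D[OF F \<phi>(1)] by (auto simp: set_integrable_def)
    \<comment> \<open>The averages over the disjoint maximal cubes are all at least
      \<open>m\<close>.\<close>
    have mU: "m * measure lebesgue (\<Union>F) \<le> (LINT x:\<Union>F|lebesgue. \<phi> x)"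
    proof -
      have "m * measure lebesgue (\<Union>F) = (LINT x:\<Union>F|lebesgue. m)"
        using Um by (simp add: set_lebesgue_integral_def fmeasurable_def)
      also have "\<dots> = (\<Sum>K\<in>maxl F. LINT x:K|lebesgue. m)"
        using F by (intro integral_Union_maxl) auto
      also have "\<dots> \<le> (\<Sum>K\<in>maxl F. LINT x:K|lebesgue. \<phi> x)"
      proof (rule sum_mono)
        fix K assume "K \<in> maxl F"
        then have K: "K \<in> F" "K \<in> D" using maxl_props[OF F] by auto
        have "vol K * m \<le> vol K * g K" using m(2)[OF K(1)] D_vol_pos[OF K(2)] by (intro mult_left_mono) auto
        moreover have "(LINT x:K|lebesgue. m) = vol K * m" using K by simp
        ultimately show "(LINT x:K|lebesgue. m) \<le> (LINT x:K|lebesgue. \<phi> x)"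
          using hyp[OF K(1)] by (simp only: mult.commute[of "g K"])
      qed
      also have "\<dots> = (LINT x:\<Union>F|lebesgue. \<phi> x)" using integral_Union_maxl[OF F \<phi>(1)] by simp
      finally show ?thesis .
    qed
    have iU: "integrable lebesgue (\<lambda>x. indicator (\<Union>F) x * c :: real)" for c
      using Um by (intro integrable_mult_left) (auto simp: fmeasurable_def)
    have "(LINT x:\<Union>F|lebesgue. gmax F g x powr q - s powr q) =
        measure lebesgue (\<Union>F) * (m powr q - s powr q) + (LINT x:\<Union>F'|lebesgue. gmax F' g x powr q - m powr q)"
      unfolding set_lebesgue_integral_def split
      using int1[of q] assms(1) iU Um
      by (subst Bochner_Integration.integral_add) (auto simp: fmeasurable_def)
    also have "\<dots> \<le> measure lebesgue (\<Union>F) * (?q * (m * (m powr (q - 1) - s powr (q - 1)))) +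
        ?q * (LINT x:\<Union>F'|lebesgue. \<phi> x * (gmax F' g x powr (q - 1) - m powr (q - 1)))"
      by (intro add_mono mult_left_mono young_doob IH assms s sm) auto
    also have "\<dots> = ?q * ((m powr (q - 1) - s powr (q - 1)) * (m * measure lebesgue (\<Union>F)) +
        (LINT x:\<Union>F'|lebesgue. \<phi> x * (gmax F' g x powr (q - 1) - m powr (q - 1))))"
      by (simp add: algebra_simps)
    also have "\<dots> \<le> ?q * ((m powr (q - 1) - s powr (q - 1)) * (LINT x:\<Union>F|lebesgue. \<phi> x) +
        (LINT x:\<Union>F'|lebesgue. \<phi> x * (gmax F' g x powr (q - 1) - m powr (q - 1))))"
      using assms(1) s sm mU by (intro mult_left_mono add_right_mono) (auto intro!: powr_mono2)
    also have "\<dots> = ?q * (LINT x:\<Union>F|lebesgue. \<phi> x * (gmax F g x powr (q - 1) - s powr (q - 1)))"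
    proof -
      have sp: "indicator (\<Union>F) x *\<^sub>R (\<phi> x * (gmax F g x powr (q - 1) - s powr (q - 1))) =
         (m powr (q - 1) - s powr (q - 1)) * (indicator (\<Union>F) x *\<^sub>R \<phi> x)
         + \<phi> x * (indicator (\<Union>F') x *\<^sub>R (gmax F' g x powr (q - 1) - m powr (q - 1)))" for x
        using arg_cong[OF split[of x "q - 1"], of "\<lambda>t. \<phi> x * t"] by (simp add: algebra_simps)
      have e: "indicator (\<Union>F') x *\<^sub>R (\<phi> x * (gmax F' g x powr (q - 1) - m powr (q - 1))) =
        \<phi> x * (indicator (\<Union>F') x *\<^sub>R (gmax F' g x powr (q - 1) - m powr (q - 1)))" for x
        by simp
      have "0 < q - 1" using assms(1) by simp
      show ?thesis
        unfolding set_lebesgue_integral_def sp e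
        using int2[OF \<open>0 < q - 1\<close>] U\<phi>
        by (subst Bochner_Integration.integral_add) auto
    qed
    finally show ?thesis .
  qed
qed

text \<open>The closing move of a duality argument: the quantity to be bounded reappears on the
  right with the power \<open>1 / q < 1\<close> and is divided out.\<close>

lemma powr_absorb:
  fixes X Y K :: real
  assumes pq: "1 < p" "1 < q" "1 / p + 1 / q = 1" and nn: "0 \<le> X" "0 \<le> Y" "0 \<le> K"
    and le: "X \<le> K * (Y powr (1/p) * X powr (1/q))"
  shows "X \<le> K powr p * Y"
proof (cases "X = 0")
  case False
  then have X: "X > 0" using nn by simp
  have "1 / p = 1 - 1 / q" using pq by simp
  then have "X powr (1/p) = X / X powr (1/q)" using X by (simp add: powr_diff)
  also have "\<dots> \<le> K * Y powr (1/p)" using le X by (simp add: divide_le_eq mult.assoc)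
  finally have "(X powr (1/p)) powr p \<le> (K * Y powr (1/p)) powr p" using pq by (intro powr_mono2) auto
  then show ?thesis using pq nn X by (simp add: powr_mult powr_powr)
qed (use nn in auto)

text \<open>\<open>doob_step\<close> from height 0, then Hoelder's inequality against the maximal
  function itself and absorption. The constant is the power of the conjugate exponent.\<close>

lemma doob:
  assumes q: "1 < q" and F: "finite F" "F \<subseteq> D"
    and \<phi>: "\<phi> \<in> borel_measurable lebesgue" "\<And>x. 0 \<le> \<phi> x" "integrable lebesgue (\<lambda>x. \<phi> x powr q)"
    and g: "\<And>I. I \<in> F \<Longrightarrow> 0 \<le> g I" "\<And>I. I \<in> F \<Longrightarrow> g I * vol I \<le> (LINT x:I|lebesgue. \<phi> x)"
  shows "(\<integral>x. gmax F g x powr q \<partial>lebesgue) \<le> (q / (q - 1)) powr q * (\<integral>x. \<phi> x powr q \<partial>lebesgue)"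
proof -
  define q' where "q' = q / (q - 1)"
  have q': "q' > 1" "1 / q + 1 / q' = 1" "1 / q' + 1 / q = 1" using q by (auto simp: q'_def field_simps)
  have iI: "set_integrable lebesgue I \<phi>" if "I \<in> D" for I
  proof -
    have "integrable lebesgue (\<lambda>x. \<phi> x * indicator I x)"
    proof (rule Holder_integral(1)[OF q q'(1,2)])
      have "(\<lambda>x. indicat_real I x powr q') = indicator I" by (auto simp: indicator_def)
      then show "integrable lebesgue (\<lambda>x. indicat_real I x powr q')"
        using D_integrable_const[OF that, of "1 :: real"] by (simp add: set_integrable_def)
    qed (use \<phi> that in auto)
    then show ?thesis by (simp add: set_integrable_def mult.commute)
  qed
  let ?G = "\<lambda>x. gmax F g x"
  have u: "indicator (\<Union>F) x *\<^sub>R (t * ?G x powr r) = t * ?G x powr r" if "0 < r" for x t r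
    using gmax_outside[OF F(1), of x g] that by (cases "x \<in> \<Union>F") auto
  have Gi: "integrable lebesgue (\<lambda>x. ?G x powr r)" if "0 < r" for r
    by (rule gmax_powr_integrable[OF F that])
  have pw: "(?G x powr (q - 1)) powr q' = ?G x powr q" for x
    using q by (simp add: powr_powr q'_def)
  have "(\<integral>x. ?G x powr q \<partial>lebesgue) \<le> q' * (\<integral>x. \<phi> x * ?G x powr (q - 1) \<partial>lebesgue)"
  proof -
    have "(LINT x:\<Union>F|lebesgue. ?G x powr q - 0 powr q)
      \<le> q / (q - 1) * (LINT x:\<Union>F|lebesgue. \<phi> x * (?G x powr (q - 1) - 0 powr (q - 1)))"
      using F(2) by (intro doob_step[OF q F order.refl g(1) iI \<phi>(1,2) g(2)]) auto
    moreover have "indicator (\<Union>F) x *\<^sub>R (?G x powr q - 0 powr q) = ?G x powr q" for x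
      using u[of q x 1] q by simp
    moreover have "indicator (\<Union>F) x *\<^sub>R (\<phi> x * (?G x powr (q - 1) - 0 powr (q - 1))) = \<phi> x * ?G x powr (q - 1)" for x
      using u[of "q - 1" x "\<phi> x"] q by simp
    ultimately show ?thesis by (simp only: set_lebesgue_integral_def q'_def)
  qed
  also have "\<dots> \<le> q' * ((\<integral>x. \<phi> x powr q \<partial>lebesgue) powr (1/q) * (\<integral>x. (?G x powr (q - 1)) powr q' \<partial>lebesgue) powr (1/q'))"
    using q q' \<phi> Gi[of q] gmax_lebesgue[OF F, of g] unfolding pw[symmetric]
    by (intro mult_left_mono Holder_integral(2)) auto
  finally show ?thesis unfolding pw q'_def[symmetric]
    using q' by (intro powr_absorb[OF q q'(1,2)]) auto
qed

section \<open>The dyadic paraproduct estimate\<close>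

definition mean :: "(real^'d \<Rightarrow> 'b::{banach, second_countable_topology}) \<Rightarrow> (real^'d) set \<Rightarrow> 'b" where
  "mean f I = (LINT x:I|lebesgue. f x) /\<^sub>R vol I"

definition hcoef :: "(real^'d \<Rightarrow> 'b::{banach, second_countable_topology}) \<Rightarrow> (real^'d) set \<Rightarrow> ('d \<Rightarrow> bool) \<Rightarrow> 'b" where
  "hcoef f I e = (\<integral>x. haar I e x *\<^sub>R f x \<partial>lebesgue)"

lemma child_integrable:
  fixes f :: "_ \<Rightarrow> 'b::{banach, second_countable_topology}"
  assumes "I \<in> D" "set_integrable lebesgue I f"
  shows "set_integrable lebesgue (child I s) f"
  using assms child_in_D child_subset by (intro set_integrable_subset[OF assms(2)]) auto

lemma hcoef_eq:
  fixes f :: "_ \<Rightarrow> 'b::{banach, second_countable_topology}"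
  assumes I: "I \<in> D" and f: "set_integrable lebesgue I f"
  shows "integrable lebesgue (\<lambda>x. haar I e x *\<^sub>R f x)"
    and "hcoef f I e = (\<Sum>s\<in>UNIV. (sg e s / sqrt (vol I)) *\<^sub>R (LINT x:child I s|lebesgue. f x))"
proof -
  have eq: "haar I e x *\<^sub>R f x = (\<Sum>s\<in>UNIV. (sg e s / sqrt (vol I)) *\<^sub>R (indicator (child I s) x *\<^sub>R f x))" for x
    unfolding haar_eq_sum[OF I] by (simp add: scaleR_sum_left mult.commute)
  have i: "integrable lebesgue (\<lambda>x. indicat_real (child I s) x *\<^sub>R f x)" for s
    using child_integrable[OF I f] unfolding set_integrable_def by blast
  show "integrable lebesgue (\<lambda>x. haar I e x *\<^sub>R f x)"
    unfolding eq by (intro Bochner_Integration.integrable_sum integrable_scaleR_right i)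
  show "hcoef f I e = (\<Sum>s\<in>UNIV. (sg e s / sqrt (vol I)) *\<^sub>R (LINT x:child I s|lebesgue. f x))"
  proof -
    have "hcoef f I e = (\<Sum>s\<in>UNIV. \<integral>x. (sg e s / sqrt (vol I)) *\<^sub>R (indicator (child I s) x *\<^sub>R f x) \<partial>lebesgue)"
      unfolding hcoef_def eq by (intro Bochner_Integration.integral_sum integrable_scaleR_right i)
    also have "\<dots> = (\<Sum>s\<in>UNIV. (sg e s / sqrt (vol I)) *\<^sub>R (LINT x:child I s|lebesgue. f x))"
      unfolding set_lebesgue_integral_def by (intro sum.cong refl integral_scaleR_right i)
    finally show ?thesis .
  qed
qed

lemma mean_mult: "I \<in> D \<Longrightarrow> (LINT x:I|lebesgue. f x) = vol I *\<^sub>R mean f I"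
  by (simp add: mean_def)

lemma mean_children:
  fixes f :: "_ \<Rightarrow> 'b::{banach, second_countable_topology}"
  assumes I: "I \<in> D" and f: "set_integrable lebesgue I f"
  shows "(\<Sum>s\<in>UNIV. mean f (child I s)) = 2 ^ CARD('d) *\<^sub>R mean f I"
proof -
  have "mean f (child I s) = (2 ^ CARD('d) / vol I) *\<^sub>R (LINT x:child I s|lebesgue. f x)" for s
    by (simp add: mean_def vol_child[OF I])
  then have "(\<Sum>s\<in>UNIV. mean f (child I s)) = (2 ^ CARD('d) / vol I) *\<^sub>R (LINT x:I|lebesgue. f x)"
    unfolding integral_children[OF I f] by (simp add: scaleR_sum_right)
  then show ?thesis by (simp add: mean_def divide_inverse)
qed

text \<open>The signs sum to zero, so the coefficient only sees the deviations \<open>b\<close> of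
  the means over the children from the mean over \<open>I\<close>. Cauchy-Schwarz and the variance
  identity give a difference of energies \<open>vol I * (norm (mean f I))^2\<close>, a form that
  telescopes down the tree.\<close>

lemma hcoef_bound:
  fixes f :: "_ \<Rightarrow> 'b::euclidean_space"
  assumes I: "I \<in> D" and f: "set_integrable lebesgue I f" and e: "e \<in> sigS"
  shows "(norm (hcoef f I e))\<^sup>2 \<le> (\<Sum>s\<in>UNIV. vol (child I s) * (norm (mean f (child I s)))\<^sup>2) - vol I * (norm (mean f I))\<^sup>2"
proof -
  define b where "b s = mean f (child I s) - mean f I" for s
  define N :: real where "N = 2 ^ CARD('d)"
  define Q where "Q = vol I / N"
  have N: "N > 0" "real (CARD('d \<Rightarrow> bool)) = N" using card_signs by (simp_all add: N_def)
  have v: "vol I > 0" using D_vol_pos[OF I] .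
  have vc: "vol (child I s) = Q" for s by (simp add: vol_child[OF I] Q_def N_def)
  have Q: "Q > 0" using v N by (simp add: Q_def)
  have sb: "(\<Sum>s\<in>UNIV. b s) = 0"
    unfolding b_def sum_subtractf mean_children[OF I f] using N by (simp add: N_def scaleR_conv_of_real sum_constant_scaleR)
  have "hcoef f I e = (\<Sum>s\<in>UNIV. (sg e s / sqrt (vol I)) *\<^sub>R (Q *\<^sub>R (b s + mean f I)))"
    unfolding hcoef_eq(2)[OF I f] using child_in_D(1)[OF I] by (simp add: mean_mult vc b_def)
  also have "\<dots> = (Q / sqrt (vol I)) *\<^sub>R ((\<Sum>s\<in>UNIV. sg e s *\<^sub>R b s) + (\<Sum>s\<in>UNIV. sg e s) *\<^sub>R mean f I)"
    by (simp add: scaleR_sum_right scaleR_sum_left scaleR_add_right sum.distrib mult.commute)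
  also have "\<dots> = (Q / sqrt (vol I)) *\<^sub>R (\<Sum>s\<in>UNIV. sg e s *\<^sub>R b s)" using sum_sg[OF e] by simp
  finally have h: "hcoef f I e = (Q / sqrt (vol I)) *\<^sub>R (\<Sum>s\<in>UNIV. sg e s *\<^sub>R b s)" .
  have "(norm (\<Sum>s\<in>UNIV. sg e s *\<^sub>R b s))\<^sup>2 \<le> (\<Sum>s\<in>UNIV. norm (b s))\<^sup>2"
    by (intro power_mono order.trans[OF norm_sum]) auto
  also have "\<dots> \<le> N * (\<Sum>s\<in>UNIV. (norm (b s))\<^sup>2)"
    using Cauchy_Schwarz_ineq_sum[of "\<lambda>_. 1" "\<lambda>s. norm (b s)" "UNIV :: ('d \<Rightarrow> bool) set"] N by simp
  finally have le: "(norm (\<Sum>s\<in>UNIV. sg e s *\<^sub>R b s))\<^sup>2 \<le> N * (\<Sum>s\<in>UNIV. (norm (b s))\<^sup>2)" .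
  have "(norm (hcoef f I e))\<^sup>2 = (Q / sqrt (vol I))\<^sup>2 * (norm (\<Sum>s\<in>UNIV. sg e s *\<^sub>R b s))\<^sup>2"
    by (simp add: h power_mult_distrib power_divide)
  also have "\<dots> \<le> (Q / sqrt (vol I))\<^sup>2 * (N * (\<Sum>s\<in>UNIV. (norm (b s))\<^sup>2))"
    by (intro mult_left_mono le) auto
  also have "\<dots> = Q * (\<Sum>s\<in>UNIV. (norm (b s))\<^sup>2)"
  proof -
    have "(Q / sqrt (vol I))\<^sup>2 = Q * Q / vol I" using v by (simp add: power_divide power2_eq_square)
    then have "(Q / sqrt (vol I))\<^sup>2 * N = Q" using v N by (simp add: Q_def)
    then show ?thesis by (simp add: mult.assoc[symmetric])
  qed
  also have "(\<Sum>s\<in>UNIV. (norm (b s))\<^sup>2) = (\<Sum>s\<in>UNIV. (norm (mean f (child I s)))\<^sup>2) - N * (norm (mean f I))\<^sup>2"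
  proof -
    have "(norm (mean f (child I s)))\<^sup>2 = (norm (b s))\<^sup>2 + 2 * (b s \<bullet> mean f I) + (norm (mean f I))\<^sup>2" for s
      unfolding power2_norm_eq_inner b_def by (simp add: inner_diff_left inner_diff_right inner_commute)
    then have "(\<Sum>s\<in>UNIV. (norm (mean f (child I s)))\<^sup>2) = (\<Sum>s\<in>UNIV. (norm (b s))\<^sup>2) + 2 * ((\<Sum>s\<in>UNIV. b s) \<bullet> mean f I) + N * (norm (mean f I))\<^sup>2"
      using N by (simp add: sum.distrib sum_distrib_left inner_sum_left)
    then show ?thesis using sb by simp
  qed
  also have "Q * \<dots> = (\<Sum>s\<in>UNIV. vol (child I s) * (norm (mean f (child I s)))\<^sup>2) - vol I * (norm (mean f I))\<^sup>2"
  proof -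
    have "vol I = Q * N" using N by (simp add: Q_def)
    then show ?thesis by (simp add: vc sum_distrib_left right_diff_distrib)
  qed
  finally show ?thesis .
qed

lemma sum_children:
  fixes c :: "_ \<Rightarrow> real"
  assumes U: "finite U" "U \<subseteq> D" and J: "J \<in> D"
  shows "(\<Sum>I | I \<in> U \<and> I \<subseteq> J. c I) = (if J \<in> U then c J else 0) + (\<Sum>s\<in>UNIV. \<Sum>I | I \<in> U \<and> I \<subseteq> child J s. c I)"
proof -
  let ?V = "\<Union>s. {I. I \<in> U \<and> I \<subseteq> child J s}"
  have Jn: "\<not> J \<subseteq> child J s" for s
    using subset_lev[OF J child_in_D(1)[OF J, of s]] child_in_D(2)[OF J, of s] by auto
  have eq: "{I. I \<in> U \<and> I \<subseteq> J} = (if J \<in> U then {J} else {}) \<union> ?V"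
  proof
    show "{I. I \<in> U \<and> I \<subseteq> J} \<subseteq> (if J \<in> U then {J} else {}) \<union> ?V"
    proof
      fix I assume I: "I \<in> {I. I \<in> U \<and> I \<subseteq> J}"
      show "I \<in> (if J \<in> U then {J} else {}) \<union> ?V"
      proof (cases "I = J")
        case False
        then obtain s where "I \<subseteq> child J s" using subset_child[of I J] I U(2) J by auto
        then show ?thesis using I by auto
      qed (use I in simp)
    qed
    show "(if J \<in> U then {J} else {}) \<union> ?V \<subseteq> {I. I \<in> U \<and> I \<subseteq> J}"
      using child_subset[OF J] by auto
  qed
  have "sum c ?V = (\<Sum>s\<in>UNIV. \<Sum>I | I \<in> U \<and> I \<subseteq> child J s. c I)"
  proof (rule sum.UNION_disjoint)
    show "\<forall>i\<in>UNIV. \<forall>j\<in>UNIV. i \<noteq> j \<longrightarrow> {I \<in> U. I \<subseteq> child J i} \<inter> {I \<in> U. I \<subseteq> child J j} = {}"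
    proof (intro ballI impI)
      fix i j :: "'d \<Rightarrow> bool" assume "i \<noteq> j"
      then have dis: "child J i \<inter> child J j = {}" by (rule child_disjoint[OF J])
      have "\<not> (I \<subseteq> child J i \<and> I \<subseteq> child J j)" if "I \<in> U" for I
        using D_nonempty[of I] that U(2) dis by auto
      then show "{I \<in> U. I \<subseteq> child J i} \<inter> {I \<in> U. I \<subseteq> child J j} = {}" by auto
    qed
  qed (use U in auto)
  moreover have "sum c ((if J \<in> U then {J} else {}) \<union> ?V) = sum c (if J \<in> U then {J} else {}) + sum c ?V"
    using Jn U by (intro sum.union_disjoint) auto
  ultimately show ?thesis by (simp add: eq)
qed

text \<open>\<open>hcoef_bound\<close> telescopes: the energy at the bottom is at most
  \<open>L^2\<close> times the volume, since the means over children of cubes of \<open>U\<close>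
  are bounded by \<open>L\<close>. The energy subtracted at the top is what closes the induction.
  \<open>U\<close> must contain all cubes between its members and \<open>J\<close>, so that nothing
  is left below a cube outside \<open>U\<close>. The factor \<open>card sigS\<close> appears because
  \<open>hcoef_bound\<close> treats each signature separately.\<close>

lemma square_sum_bound:
  fixes f :: "_ \<Rightarrow> 'b::euclidean_space"
  assumes U: "finite U" "U \<subseteq> D" and f: "\<And>I. I \<in> D \<Longrightarrow> set_integrable lebesgue I f"
    and L: "0 \<le> L" "\<And>I s. I \<in> U \<Longrightarrow> norm (mean f (child I s)) \<le> L"
    and J: "J \<in> D"
  shows "norm (mean f J) \<le> L \<Longrightarrow> (\<And>I K. I \<in> U \<Longrightarrow> K \<in> D \<Longrightarrow> I \<subseteq> K \<Longrightarrow> K \<subseteq> J \<Longrightarrow> K \<in> U) \<Longrightarrow>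
    (\<Sum>I | I \<in> U \<and> I \<subseteq> J. \<Sum>e\<in>sigS. (norm (hcoef f I e))\<^sup>2) \<le> card (sigS :: ('d \<Rightarrow> bool) set) * (L\<^sup>2 * vol J - vol J * (norm (mean f J))\<^sup>2)"
  using J U
proof (induction J rule: level_induct)
  case (base J)
  have "(norm (mean f J))\<^sup>2 \<le> L\<^sup>2" using base by (intro power_mono) auto
  then have "0 \<le> L\<^sup>2 * vol J - vol J * (norm (mean f J))\<^sup>2"
    using D_vol_pos[OF base(1)] by (simp add: mult.commute mult_le_cancel_left)
  then have "0 \<le> real (card (sigS :: ('d \<Rightarrow> bool) set)) * (L\<^sup>2 * vol J - vol J * (norm (mean f J))\<^sup>2)"
    by (intro mult_nonneg_nonneg) auto
  moreover have "{I. I \<in> U \<and> I \<subseteq> J} = {}" using base(2) by auto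
  ultimately show ?case by (simp only: sum.empty)
next
  case (step J)
  have n: "0 \<le> L\<^sup>2 * vol J - vol J * (norm (mean f J))\<^sup>2"
  proof -
    have "(norm (mean f J))\<^sup>2 \<le> L\<^sup>2" using step by (intro power_mono) auto
    then show ?thesis using D_vol_pos[OF step(1)] by (simp add: mult.commute mult_le_cancel_left)
  qed
  show ?case
  proof (cases "J \<in> U")
    case False
    then have "{I. I \<in> U \<and> I \<subseteq> J} = {}" using step(4)[of _ J] step(1) by auto
    moreover have "0 \<le> real (card (sigS :: ('d \<Rightarrow> bool) set)) * (L\<^sup>2 * vol J - vol J * (norm (mean f J))\<^sup>2)"
      using n by (intro mult_nonneg_nonneg) auto
    ultimately show ?thesis by (simp only: sum.empty)
  next
    case True
    let ?S = "real (card (sigS :: ('d \<Rightarrow> bool) set))"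
    let ?c = "\<lambda>I. \<Sum>e\<in>sigS. (norm (hcoef f I e))\<^sup>2"
    let ?e = "\<lambda>I. vol I * (norm (mean f I))\<^sup>2"
    have c1: "(\<Sum>I | I \<in> U \<and> I \<subseteq> child J s. ?c I) \<le> ?S * (L\<^sup>2 * vol (child J s) - ?e (child J s))" for s
    proof (rule step(2))
      show "child J s \<in> D" by (rule child_in_D(1)[OF step(1)])
      show "child J s \<subset> J"
        using child_subset[OF step(1), of s] child_in_D(2)[OF step(1), of s] by auto
      show "norm (mean f (child J s)) \<le> L" by (rule L(2)[OF True])
      fix I K assume "I \<in> U" "K \<in> D" "I \<subseteq> K" "K \<subseteq> child J s"
      then show "K \<in> U" using step(4)[of I K] child_subset[OF step(1), of s] by auto
    qed
    have c2: "?c J \<le> ?S * ((\<Sum>s\<in>UNIV. ?e (child J s)) - ?e J)"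
    proof -
      have "?c J \<le> (\<Sum>e\<in>(sigS :: ('d \<Rightarrow> bool) set). (\<Sum>s\<in>UNIV. ?e (child J s)) - ?e J)"
        by (intro sum_mono hcoef_bound step f)
      then show ?thesis by simp
    qed
    have "(\<Sum>I | I \<in> U \<and> I \<subseteq> J. ?c I) = ?c J + (\<Sum>s\<in>UNIV. \<Sum>I | I \<in> U \<and> I \<subseteq> child J s. ?c I)"
      unfolding sum_children[OF U step(1)] using True by simp
    also have "\<dots> \<le> ?S * ((\<Sum>s\<in>UNIV. ?e (child J s)) - ?e J) + (\<Sum>s\<in>UNIV. ?S * (L\<^sup>2 * vol (child J s) - ?e (child J s)))"
      by (intro add_mono c2 sum_mono c1)
    also have "\<dots> = ?S * (L\<^sup>2 * (\<Sum>s\<in>UNIV. vol (child J s)) - ?e J)"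
    proof -
      have "(\<Sum>s\<in>UNIV. ?S * (L\<^sup>2 * vol (child J s) - ?e (child J s))) =
          ?S * (L\<^sup>2 * (\<Sum>s\<in>UNIV. vol (child J s)) - (\<Sum>s\<in>UNIV. ?e (child J s)))"
        unfolding sum_distrib_left[symmetric] sum_subtractf ..
      then show ?thesis by (simp add: algebra_simps)
    qed
    finally show ?thesis unfolding vol_children[OF step(1)] .
  qed
qed

lemma norm_mean_le:
  fixes f :: "_ \<Rightarrow> 'b::euclidean_space"
  assumes "I \<in> D" shows "norm (mean f I) \<le> mean (\<lambda>x. norm (f x)) I"
proof -
  have "norm (LINT x:I|lebesgue. f x) \<le> (LINT x:I|lebesgue. norm (f x))"
    unfolding set_lebesgue_integral_def
    by (rule order.trans[OF integral_norm_bound]) (auto simp: abs_mult)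
  then show ?thesis using D_vol_pos[OF assms] by (simp add: mean_def divide_inverse[symmetric] divide_right_mono mult.commute)
qed

lemma mean_nonneg:
  fixes f :: "_ \<Rightarrow> real"
  assumes "I \<in> D" "\<And>x. 0 \<le> f x" shows "0 \<le> mean f I"
  using assms less_imp_le[OF D_vol_pos[OF assms(1)]]
  by (auto simp: mean_def set_lebesgue_integral_def intro!: mult_nonneg_nonneg integral_nonneg_AE)

lemma mean_child_le:
  fixes f :: "_ \<Rightarrow> real"
  assumes I: "I \<in> D" and f: "set_integrable lebesgue I f" "\<And>x. 0 \<le> f x"
  shows "mean f (child I s) \<le> 2 ^ CARD('d) * mean f I"
proof -
  have "mean f (child I s) \<le> (\<Sum>s\<in>UNIV. mean f (child I s))"
    by (rule member_le_sum)
      (auto intro!: mean_nonneg f(2) child_in_D(1)[OF I])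
  then show ?thesis unfolding mean_children[OF I f(1)] by simp
qed

text \<open>The weak-type estimate for maximal averages: disjoint cubes of large mean share the
  integral of \<open>w\<close> over \<open>J\<close>.\<close>

lemma stopping_vol:
  fixes w :: "_ \<Rightarrow> real"
  assumes J: "J \<in> D" and w: "\<And>I. I \<in> D \<Longrightarrow> set_integrable lebesgue I w" "\<And>x. 0 \<le> w x" and l: "0 < l"
    and X: "finite X" "X \<subseteq> D" "disjoint X" and XJ: "\<And>K. K \<in> X \<Longrightarrow> K \<subseteq> J"
    and big: "\<And>K. K \<in> X \<Longrightarrow> l * mean w J < mean w K"
  shows "(\<Sum>K\<in>X. vol K) \<le> vol J / l"
proof -
  have le: "(\<Sum>K\<in>X. vol K * mean w K) \<le> vol J * mean w J"
  proof -
    have "(\<Sum>K\<in>X. vol K * mean w K) = (\<Sum>K\<in>X. LINT x:K|lebesgue. w x)"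
      using X mean_mult[of _ w] by (intro sum.cong) auto
    also have "\<dots> \<le> (LINT x:J|lebesgue. w x)"
      by (rule integral_disjoint_le[OF X XJ]) (use J w in auto)
    finally show ?thesis using mean_mult[OF J, of w] by simp
  qed
  have m0: "0 \<le> mean w I" if "I \<in> D" for I by (rule mean_nonneg[OF that w(2)])
  show ?thesis
  proof (cases "mean w J = 0")
    case True
    \<comment> \<open>For vanishing mean one cannot divide by it, but the strict inequality in
      \<open>big\<close> then leaves no stopped cube.\<close>
    have "X = {}"
    proof (rule ccontr)
      assume "X \<noteq> {}"
      then obtain K where K: "K \<in> X" by auto
      have "vol K * mean w K \<le> (\<Sum>K\<in>X. vol K * mean w K)"
        by (rule member_le_sum[OF K _ X(1)]) (use X m0 less_imp_le[OF D_vol_pos] in \<open>auto intro!: mult_nonneg_nonneg\<close>)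
      then have "vol K * mean w K \<le> 0" using le True by simp
      moreover have "0 < vol K" using K X by (intro D_vol_pos) auto
      ultimately have "mean w K \<le> 0" by (auto simp: mult_le_0_iff)
      then show False using big[OF K] True by simp
    qed
    then show ?thesis using l less_imp_le[OF D_vol_pos[OF J]] by simp
  next
    case False
    then have mJ: "mean w J > 0" using m0[OF J] by simp
    have "l * mean w J * (\<Sum>K\<in>X. vol K) = (\<Sum>K\<in>X. vol K * (l * mean w J))"
      by (simp add: sum_distrib_right mult.commute)
    also have "\<dots> \<le> (\<Sum>K\<in>X. vol K * mean w K)"
      using X big less_imp_le[OF D_vol_pos] by (intro sum_mono mult_left_mono) (auto intro: less_imp_le)
    also note le
    finally show ?thesis using mJ l by (simp add: field_simps)
  qed
qed

text \<open>The power of 2 arises in passing from an unstopped cube to its children, the root in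
  \<open>square_sum_bound\<close>. A factor 4 comes from the stopping threshold; it is raised to 6
  since the comparison function is only known to be large on three quarters of the cube, and
  \<open>4 <= 6 * 3 / 4\<close>.\<close>

definition loc_const :: real where
  "loc_const = 6 * 2 ^ CARD('d) * sqrt (card (sigS :: ('d \<Rightarrow> bool) set))"

text \<open>A Calderon-Zygmund stopping time on the averages of \<open>norm \<circ> f\<close>: on the unstopped cubes these averages
  are comparable to the one over \<open>J\<close>, so Cauchy-Schwarz suffices there.\<close>

lemma carleson_haar_local:
  fixes f :: "_ \<Rightarrow> 'b::euclidean_space" and M :: "real^'d \<Rightarrow> real"
  assumes F: "finite F" "F \<subseteq> D" and f: "\<And>I. I \<in> D \<Longrightarrow> set_integrable lebesgue I f"
    and B: "0 \<le> B" "\<And>J. J \<in> D \<Longrightarrow> (\<Sum>I | I \<in> F \<and> I \<subseteq> J. \<Sum>e\<in>sigS. (a I e)\<^sup>2) \<le> B * vol J"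
    and M: "\<And>x. 0 \<le> M x" "\<And>I. I \<in> D \<Longrightarrow> set_integrable lebesgue I M"
      "\<And>K x. K \<in> D \<Longrightarrow> \<exists>I\<in>F. I \<subseteq> K \<Longrightarrow> \<exists>T\<in>F. K \<subseteq> T \<Longrightarrow> x \<in> K \<Longrightarrow> mean (\<lambda>x. norm (f x)) K \<le> M x"
    and J: "J \<in> D"
  shows "\<exists>T\<in>F. J \<subseteq> T \<Longrightarrow> (\<Sum>I | I \<in> F \<and> I \<subseteq> J. \<Sum>e\<in>sigS. a I e * norm (hcoef f I e)) \<le> loc_const * sqrt B * (LINT x:J|lebesgue. M x)"
  using J F
proof (induction J rule: level_induct)
  case (base J)
  have "{I. I \<in> F \<and> I \<subseteq> J} = {}" using base by auto
  moreover have "0 \<le> loc_const * sqrt B * (LINT x:J|lebesgue. M x)"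
    using B(1) M(1) by (auto simp: set_lebesgue_integral_def loc_const_def intro!: mult_nonneg_nonneg integral_nonneg_AE)
  ultimately show ?case by (simp only: sum.empty)
next
  case (step J)
  note J = step(1)
  let ?m = "mean (\<lambda>x. norm (f x))"
  let ?c = "\<lambda>I. \<Sum>e\<in>sigS. a I e * norm (hcoef f I e)"
  have nf: "set_integrable lebesgue I (\<lambda>x. norm (f x))" if "I \<in> D" for I
    using f[OF that] integrable_norm[of lebesgue "\<lambda>x. indicator I x *\<^sub>R f x"] by (simp add: set_integrable_def)
  have m0: "0 \<le> ?m I" if "I \<in> D" for I by (rule mean_nonneg[OF that]) simp
  have rhs0: "0 \<le> loc_const * sqrt B * (LINT x:J|lebesgue. M x)"
    using B(1) M(1) by (auto simp: set_lebesgue_integral_def loc_const_def intro!: mult_nonneg_nonneg integral_nonneg_AE)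
  show ?case
  proof (cases "\<exists>I\<in>F. I \<subseteq> J")
    case False
    then have "{I. I \<in> F \<and> I \<subseteq> J} = {}" by auto
    then show ?thesis using rhs0 by (simp only: sum.empty)
  next
    case True
    \<comment> \<open>The threshold 4 makes the stopped cubes occupy at most a quarter of
      \<open>J\<close>.\<close>
    define S where "S K \<longleftrightarrow> 4 * ?m J < ?m K" for K
    obtain X where X: "finite X" "X \<subseteq> D" "disjoint X"
      and XS: "\<forall>K\<in>X. S K \<and> K \<subset> J \<and> (\<forall>K'\<in>D. K \<subset> K' \<longrightarrow> K' \<subset> J \<longrightarrow> \<not> S K')"
      and Xsum: "\<forall>c :: _ \<Rightarrow> real. (\<Sum>I | I \<in> F \<and> I \<subseteq> J. c I) =
         (\<Sum>I | I \<in> F \<and> I \<subseteq> J \<and> (\<forall>K\<in>D. I \<subseteq> K \<longrightarrow> K \<subset> J \<longrightarrow> \<not> S K). c I) + (\<Sum>K\<in>X. \<Sum>I | I \<in> F \<and> I \<subseteq> K. c I)"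
      using stopping_family[OF J F, of S] by (elim exE conjE) (rule that)
    note XS = bspec[OF XS] and Xsum = spec[OF Xsum]
    have XJ: "K \<subseteq> J" if "K \<in> X" for K using XS[OF that] by auto
    define V where "V = (\<Sum>K\<in>X. vol K)"
    have V: "V \<le> vol J / 4"
      unfolding V_def
      by (rule stopping_vol[OF J nf _ _ X XJ]) (use XS in \<open>auto simp: S_def\<close>)
    define N :: real where "N = 2 ^ CARD('d)"
    define L where "L = N * (4 * ?m J)"
    define s where "s = real (card (sigS :: ('d \<Rightarrow> bool) set))"
    have N: "N \<ge> 1" by (simp add: N_def)
    have L0: "0 \<le> L" using m0[OF J] N by (simp add: L_def)
    \<comment> \<open>More than the unstopped part of \<open>F\<close>: all intermediate cubes up to
      \<open>J\<close> are included, because \<open>square_sum_bound\<close> telescopes through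
      them.\<close>
    define U where "U = {K\<in>D. K \<subseteq> J \<and> (\<exists>I\<in>F. I \<subseteq> K) \<and> (\<forall>K'\<in>D. K \<subseteq> K' \<longrightarrow> K' \<subset> J \<longrightarrow> \<not> S K')}"
    have U: "finite U" "U \<subseteq> D"
    proof -
      show "finite U" by (rule finite_subset[OF _ finite_between[OF F J]]) (auto simp: U_def)
    qed (auto simp: U_def)
    have mU: "?m I \<le> 4 * ?m J" if I: "I \<in> U" for I
    proof (cases "I = J")
      case True then show ?thesis using m0[OF J] by simp
    next
      case False
      then have "\<not> S I" using I unfolding U_def by auto
      then show ?thesis by (simp add: S_def)
    qed
    have sq: "(\<Sum>I | I \<in> U \<and> I \<subseteq> J. \<Sum>e\<in>sigS. (norm (hcoef f I e))\<^sup>2) \<le> s * (L\<^sup>2 * vol J)"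
    proof -
      have "(\<Sum>I | I \<in> U \<and> I \<subseteq> J. \<Sum>e\<in>sigS. (norm (hcoef f I e))\<^sup>2) \<le> s * (L\<^sup>2 * vol J - vol J * (norm (mean f J))\<^sup>2)"
        unfolding s_def
      proof (rule square_sum_bound[OF U f L0 _ J])
        fix I t assume I: "I \<in> U"
        then have ID: "I \<in> D" using U by auto
        have "norm (mean f (child I t)) \<le> ?m (child I t)" by (rule norm_mean_le[OF child_in_D(1)[OF ID]])
        also have "\<dots> \<le> N * ?m I" unfolding N_def by (rule mean_child_le[OF ID nf[OF ID]]) simp
        also have "\<dots> \<le> L" unfolding L_def using N mU[OF I] by (intro mult_left_mono) auto
        finally show "norm (mean f (child I t)) \<le> L" .
      next
        have "norm (mean f J) \<le> ?m J" by (rule norm_mean_le[OF J])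
        also have "\<dots> \<le> N * (4 * ?m J)" using mult_mono[of 1 N "?m J" "4 * ?m J"] N m0[OF J] by auto
        finally show "norm (mean f J) \<le> L" by (simp add: L_def)
      next
        fix I K assume IK: "I \<in> U" "K \<in> D" "I \<subseteq> K" "K \<subseteq> J"
        obtain I' where I': "I' \<in> F" "I' \<subseteq> I" using IK(1) by (auto simp: U_def)
        have "\<not> S K'" if "K' \<in> D" "K \<subseteq> K'" "K' \<subset> J" for K'
          using IK(1,3) that unfolding U_def by auto
        then show "K \<in> U" using IK I' unfolding U_def by auto
      qed
      also have "\<dots> \<le> s * (L\<^sup>2 * vol J)"
        using D_vol_pos[OF J] by (intro mult_left_mono) (auto simp: s_def)
      finally show ?thesis .
    qed
    let ?W = "{I. I \<in> F \<and> I \<subseteq> J \<and> (\<forall>K\<in>D. I \<subseteq> K \<longrightarrow> K \<subset> J \<longrightarrow> \<not> S K)}"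
    have W: "?W \<subseteq> {I. I \<in> U \<and> I \<subseteq> J}" "finite ?W" using F by (auto simp: U_def)
    have unst: "sum ?c ?W \<le> sqrt (B * vol J) * sqrt (s * (L\<^sup>2 * vol J))"
    proof -
      let ?P = "?W \<times> (sigS :: ('d \<Rightarrow> bool) set)"
      have "sum ?c ?W = (\<Sum>z\<in>?P. a (fst z) (snd z) * norm (hcoef f (fst z) (snd z)))"
        by (simp add: sum.cartesian_product case_prod_beta)
      also have "\<dots> \<le> (\<Sum>z\<in>?P. \<bar>a (fst z) (snd z)\<bar> * \<bar>norm (hcoef f (fst z) (snd z))\<bar>)"
        by (intro sum_mono) (auto intro!: mult_right_mono)
      also have "\<dots> \<le> L2_set (\<lambda>z. a (fst z) (snd z)) ?P * L2_set (\<lambda>z. norm (hcoef f (fst z) (snd z))) ?P"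
        by (rule L2_set_mult_ineq)
      also have "\<dots> = sqrt (\<Sum>I\<in>?W. \<Sum>e\<in>sigS. (a I e)\<^sup>2) * sqrt (\<Sum>I\<in>?W. \<Sum>e\<in>sigS. (norm (hcoef f I e))\<^sup>2)"
        by (simp add: L2_set_def sum.cartesian_product case_prod_beta)
      also have "\<dots> \<le> sqrt (B * vol J) * sqrt (s * (L\<^sup>2 * vol J))"
      proof (intro mult_mono real_sqrt_le_mono)
        have "(\<Sum>I\<in>?W. \<Sum>e\<in>sigS. (a I e)\<^sup>2) \<le> (\<Sum>I | I \<in> F \<and> I \<subseteq> J. \<Sum>e\<in>sigS. (a I e)\<^sup>2)"
          using F by (intro sum_mono2) (auto intro!: sum_nonneg)
        then show "(\<Sum>I\<in>?W. \<Sum>e\<in>sigS. (a I e)\<^sup>2) \<le> B * vol J" using B(2)[OF J] by linarith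
        have "(\<Sum>I\<in>?W. \<Sum>e\<in>sigS. (norm (hcoef f I e))\<^sup>2) \<le> (\<Sum>I | I \<in> U \<and> I \<subseteq> J. \<Sum>e\<in>sigS. (norm (hcoef f I e))\<^sup>2)"
          using W U by (intro sum_mono2) (auto intro!: sum_nonneg)
        then show "(\<Sum>I\<in>?W. \<Sum>e\<in>sigS. (norm (hcoef f I e))\<^sup>2) \<le> s * (L\<^sup>2 * vol J)" using sq by linarith
      qed (use B D_vol_pos[OF J] in \<open>auto intro!: sum_nonneg mult_nonneg_nonneg\<close>)
      finally show ?thesis .
    qed
    have unst': "sum ?c ?W \<le> loc_const * sqrt B * (3 / 4 * ?m J * vol J)"
    proof -
      have "sqrt (B * vol J) * sqrt (s * (L\<^sup>2 * vol J)) = (sqrt B * sqrt s * L) * vol J"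
        using L0 D_vol_pos[OF J] by (simp add: real_sqrt_mult)
      also have "\<dots> = 4 * N * sqrt s * sqrt B * (?m J * vol J)"
        by (simp add: L_def ac_simps)
      also have "\<dots> \<le> 6 * N * sqrt s * sqrt B * (3 / 4 * (?m J * vol J))"
      proof -
        have "0 \<le> N * sqrt s * sqrt B * (?m J * vol J)"
          using N B m0[OF J] D_vol_pos[OF J] by (auto simp: s_def intro!: mult_nonneg_nonneg)
        then show ?thesis by (simp add: algebra_simps)
      qed
      finally show ?thesis using unst by (simp add: loc_const_def N_def s_def mult.assoc)
    qed
    have st: "(\<Sum>I | I \<in> F \<and> I \<subseteq> K. ?c I) \<le> loc_const * sqrt B * (LINT x:K|lebesgue. M x)" if K: "K \<in> X" for K
    proof -
      have KD: "K \<in> D" using K X by auto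
      have "\<exists>T\<in>F. K \<subseteq> T" using XJ[OF K] step(3) by blast
      then show ?thesis using step(2)[OF KD] XS[OF K] KD by blast
    qed
    \<comment> \<open>Outside the stopped cubes \<open>M\<close> is at least the mean over
      \<open>J\<close>, on a set of at least three quarters of the volume. The integrals of
      \<open>M\<close> over the stopped cubes are kept for the induction.\<close>
    have int: "3 / 4 * ?m J * vol J + (\<Sum>K\<in>X. LINT x:K|lebesgue. M x) \<le> (LINT x:J|lebesgue. M x)"
    proof -
      let ?Y = "\<Union>X"
      have Ym: "?Y \<in> sets lebesgue" "?Y \<subseteq> J" using X XJ by (auto intro!: sets.finite_Union)
      have Jeq: "(J - ?Y) \<union> ?Y = J" by (subst Un_commute) (rule Diff_partition[OF Ym(2)])
      have iY: "set_integrable lebesgue ?Y M" by (rule set_integrable_subset[OF M(2)[OF J] Ym])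
      have iZ: "set_integrable lebesgue (J - ?Y) M"
        by (rule set_integrable_subset[OF M(2)[OF J]]) (use Ym J in auto)
      have "(LINT x:J|lebesgue. M x) = (LINT x:(J - ?Y) \<union> ?Y|lebesgue. M x)"
        unfolding Jeq ..
      also have "\<dots> = (LINT x:J - ?Y|lebesgue. M x) + (LINT x:?Y|lebesgue. M x)"
        by (rule set_integral_Un) (use iY iZ in auto)
      also have "(LINT x:?Y|lebesgue. M x) = (\<Sum>K\<in>X. LINT x:K|lebesgue. M x)"
        by (rule integral_disjoint_eq[OF X M(2)]) (use X in auto)
      finally have e1: "(LINT x:J|lebesgue. M x) = (LINT x:J - ?Y|lebesgue. M x) + (\<Sum>K\<in>X. LINT x:K|lebesgue. M x)" .
      have one: "set_integrable lebesgue J (\<lambda>_. ?m J)" using J by simp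
      have "vol J * ?m J = (LINT x:(J - ?Y) \<union> ?Y|lebesgue. ?m J)"
        unfolding Jeq using J by simp
      also have "\<dots> = (LINT x:J - ?Y|lebesgue. ?m J) + (LINT x:?Y|lebesgue. ?m J)"
        by (rule set_integral_Un) (use Ym J in \<open>auto intro!: set_integrable_subset[OF one]\<close>)
      also have "(LINT x:?Y|lebesgue. ?m J) = (\<Sum>K\<in>X. LINT x:K|lebesgue. ?m J)"
        by (rule integral_disjoint_eq[OF X]) (use X in auto)
      also have "\<dots> = ?m J * V" using X unfolding V_def sum_distrib_left by (intro sum.cong) auto
      finally have "vol J * ?m J - ?m J * V = (LINT x:J - ?Y|lebesgue. ?m J)" by simp
      also have "\<dots> \<le> (LINT x:J - ?Y|lebesgue. M x)"
      proof (rule set_integral_mono)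
        show "set_integrable lebesgue (J - ?Y) (\<lambda>_. ?m J)"
          by (rule set_integrable_subset[OF one]) (use Ym J in auto)
        show "?m J \<le> M x" if "x \<in> J - ?Y" for x
          by (rule M(3)[OF J True step(3)]) (use that in auto)
      qed (rule iZ)
      finally have e2: "vol J * ?m J - ?m J * V \<le> (LINT x:J - ?Y|lebesgue. M x)" .
      have "?m J * V \<le> ?m J * (vol J / 4)" using V m0[OF J] by (rule mult_left_mono)
      then show ?thesis using e1 e2 by (simp add: algebra_simps)
    qed
    have "(\<Sum>I | I \<in> F \<and> I \<subseteq> J. ?c I) \<le> loc_const * sqrt B * (3 / 4 * ?m J * vol J) + (\<Sum>K\<in>X. loc_const * sqrt B * (LINT x:K|lebesgue. M x))"
      unfolding Xsum using unst' st by (intro add_mono sum_mono) auto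
    also have "\<dots> = loc_const * sqrt B * (3 / 4 * ?m J * vol J + (\<Sum>K\<in>X. LINT x:K|lebesgue. M x))"
      by (simp add: sum_distrib_left algebra_simps)
    also have "\<dots> \<le> loc_const * sqrt B * (LINT x:J|lebesgue. M x)"
      using int B(1) by (intro mult_left_mono) (auto simp: loc_const_def)
    finally show ?thesis .
  qed
qed

section \<open>Finite Haar sums and their L^p estimate\<close>

definition hsum :: "(real^'d) set set \<Rightarrow> ((real^'d) set \<Rightarrow> ('d \<Rightarrow> bool) \<Rightarrow> 'b::euclidean_space) \<Rightarrow> real^'d \<Rightarrow> 'b" where
  "hsum F v x = (\<Sum>I\<in>F. \<Sum>e\<in>sigS. haar I e x *\<^sub>R v I e)"

lemma hsum_bound:
  assumes F: "finite F" "F \<subseteq> D"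
  shows "norm (hsum F v x) \<le> (\<Sum>I\<in>F. \<Sum>e\<in>sigS. norm (v I e) / sqrt (vol I)) * indicator (\<Union>F) x"
proof (cases "x \<in> \<Union>F")
  case True
  have "norm (hsum F v x) \<le> (\<Sum>I\<in>F. \<Sum>e\<in>sigS. norm (v I e) / sqrt (vol I))"
    unfolding hsum_def
  proof (intro order.trans[OF norm_sum] sum_mono)
    fix I e assume I: "I \<in> F"
    then have ID: "I \<in> D" using F by auto
    have "\<bar>haar I e x\<bar> \<le> 1 / sqrt (vol I)"
      unfolding abs_haar[OF ID] using D_vol_pos[OF ID] by (auto simp: indicator_def)
    from mult_right_mono[OF this norm_ge_zero[of "v I e"]]
    show "norm (haar I e x *\<^sub>R v I e) \<le> norm (v I e) / sqrt (vol I)" by simp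
  qed
  then show ?thesis using True by simp
next
  case False
  have "haar I e x = 0" if "I \<in> F" for I e using haar_outside[of I x e] that False F(2) by auto
  then show ?thesis using False by (simp add: hsum_def)
qed

lemma hsum_borel:
  assumes F: "F \<subseteq> D" shows "hsum F v \<in> borel_measurable lebesgue"
proof -
  have "haar I e \<in> borel_measurable lebesgue" if "I \<in> F" for I e
    using haar_borel[of I e] that F by (auto simp: measurable_completion)
  then show ?thesis unfolding hsum_def[abs_def]
    by (intro borel_measurable_sum borel_measurable_scaleR) auto
qed

lemma hsum_powr_integrable:
  assumes F: "finite F" "F \<subseteq> D" and q: "0 < q"
  shows "integrable lebesgue (\<lambda>x. norm (hsum F v x) powr q)"
proof (rule integrable_bdd[OF F])
  note [measurable] = hsum_borel[OF F(2), of v]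
  show "(\<lambda>x. norm (hsum F v x) powr q) \<in> borel_measurable lebesgue" by measurable
  let ?C = "\<Sum>I\<in>F. \<Sum>e\<in>sigS. norm (v I e) / sqrt (vol I)"
  show "norm (norm (hsum F v x) powr q) \<le> ?C powr q * indicator (\<Union>F) x" for x
  proof (cases "x \<in> \<Union>F")
    case True
    then show ?thesis using hsum_bound[OF F, of v x] q by (auto intro!: powr_mono2)
  next
    case False
    then have "hsum F v x = 0" using hsum_bound[OF F, of v x] by simp
    then show ?thesis using False by simp
  qed
qed

text \<open>The dual test function is the explicit extremal \<open>norm (T x) powr (p - 2)\<close>
  times \<open>T x\<close>, so its L^q norm is known in terms of \<open>T\<close>. The local Haar
  estimate and the Carleson embedding reduce the pairing to an integral of \<open>gmax F g\<close>
  times the maximal function of \<open>f\<close>; Hoelder, Doob at exponent \<open>q\<close> (whose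
  constant is \<open>p\<close>) and absorption finish.\<close>

lemma paraproduct_bound:
  fixes v :: "_ \<Rightarrow> _ \<Rightarrow> 'b::euclidean_space"
  assumes p: "1 < p" and F: "finite F" "F \<subseteq> D"
    and B: "0 \<le> B" "\<And>J. J \<in> D \<Longrightarrow> (\<Sum>I | I \<in> F \<and> I \<subseteq> J. \<Sum>e\<in>sigS. (a I e)\<^sup>2) \<le> B * vol J"
    and v: "\<And>I e. I \<in> F \<Longrightarrow> e \<in> sigS \<Longrightarrow> norm (v I e) \<le> a I e * g I"
    and a: "\<And>I e. I \<in> F \<Longrightarrow> e \<in> sigS \<Longrightarrow> 0 \<le> a I e" and g: "\<And>I. I \<in> F \<Longrightarrow> 0 \<le> g I"
  shows "(\<integral>x. norm (hsum F v x) powr p \<partial>lebesgue)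
    \<le> (loc_const * sqrt B * p) powr p * (\<integral>x. gmax F g x powr p \<partial>lebesgue)"
proof -
  define q where "q = p / (p - 1)"
  have q: "1 < q" "1 / p + 1 / q = 1" "q / (q - 1) = p" using p by (auto simp: q_def field_simps)
  define T where "T = hsum F v"
  define f where "f x = norm (T x) powr (p - 2) *\<^sub>R T x" for x
  note [measurable] = hsum_borel[OF F(2), of v, folded T_def]
  have nf: "norm (f x) = norm (T x) powr (p - 1)" for x
    by (cases "T x = 0") (auto simp: f_def powr_diff power2_eq_square powr_numeral)
  have nfq: "norm (f x) powr q = norm (T x) powr p" for x
    using p by (simp add: nf powr_powr q_def)
  have [measurable]: "f \<in> borel_measurable lebesgue" unfolding f_def by measurable
  have fint: "set_integrable lebesgue I f" if "I \<in> D" for I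
  proof -
    have "integrable lebesgue f"
    proof (rule Bochner_Integration.integrable_bound)
      show "integrable lebesgue (\<lambda>x. norm (T x) powr (p - 1))"
        unfolding T_def by (rule hsum_powr_integrable[OF F]) (use p in simp)
    qed (auto simp: nf)
    then show ?thesis unfolding set_integrable_def using that by (intro integrable_mult_indicator) auto
  qed
  \<comment> \<open>Exactly the cubes whose averages \<open>carleson_haar_local\<close> refers to.
    They are finitely many, so \<open>gmax\<close> and Doob's inequality apply to them.\<close>
  define R where "R = {K\<in>D. (\<exists>I\<in>F. I \<subseteq> K) \<and> (\<exists>T\<in>F. K \<subseteq> T)}"
  have R: "finite R" "R \<subseteq> D"
  proof -
    have "R \<subseteq> (\<Union>T\<in>F. {K\<in>D. K \<subseteq> T \<and> (\<exists>I\<in>F. I \<subseteq> K)})" by (auto simp: R_def)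
    moreover have "finite (\<Union>T\<in>F. {K\<in>D. K \<subseteq> T \<and> (\<exists>I\<in>F. I \<subseteq> K)})"
      using F(1) finite_between[OF F] F(2) by auto
    ultimately show "finite R" by (rule finite_subset)
  qed (auto simp: R_def)
  define M where "M = gmax R (mean (\<lambda>x. norm (f x)))"
  have Mb [measurable]: "M \<in> borel_measurable lebesgue" unfolding M_def by (rule gmax_lebesgue[OF R])
  have M0: "0 \<le> M x" for x unfolding M_def by (rule gmax_nonneg[OF R(1)])
  have Mi: "set_integrable lebesgue I M" if "I \<in> D" for I
  proof -
    have "integrable lebesgue (\<lambda>x. M x powr 1)" unfolding M_def by (rule gmax_powr_integrable[OF R]) simp
    then have "integrable lebesgue M" using M0 by (simp add: powr_one_gt_zero_iff)
    then show ?thesis unfolding set_integrable_def using that by (intro integrable_mult_indicator) auto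
  qed
  let ?c = "\<lambda>I. \<Sum>e\<in>sigS. a I e * norm (hcoef f I e)"
  let ?K = "loc_const * sqrt B"
  have K0: "0 \<le> ?K" using B(1) by (simp add: loc_const_def)
  have hypo: "(\<Sum>I | I \<in> F \<and> I \<subseteq> J. ?c I) \<le> (LINT x:J|lebesgue. ?K * M x)" if J: "J \<in> F" for J
  proof -
    have "J \<in> D" using J F by auto
    have "(\<Sum>I | I \<in> F \<and> I \<subseteq> J. ?c I) \<le> ?K * (LINT x:J|lebesgue. M x)"
    proof (rule carleson_haar_local[OF F fint B M0 Mi])
      fix K x assume K: "K \<in> D" "\<exists>I\<in>F. I \<subseteq> K" "\<exists>T\<in>F. K \<subseteq> T" "x \<in> K"
      then show "mean (\<lambda>x. norm (f x)) K \<le> M x" unfolding M_def by (intro gmax_ge[OF R(1)]) (auto simp: R_def)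
    qed (use J \<open>J \<in> D\<close> in auto)
    then show ?thesis by simp
  qed
  have Tint: "integrable lebesgue (\<lambda>x. norm (T x) powr p)"
    unfolding T_def by (rule hsum_powr_integrable[OF F]) (use p in simp)
  define X where "X = (\<integral>x. norm (T x) powr p \<partial>lebesgue)"
  have X0: "0 \<le> X" unfolding X_def by (intro integral_nonneg_AE) auto
  have Tf: "norm (T x) powr p = T x \<bullet> f x" for x
    by (cases "T x = 0") (auto simp: f_def powr_diff powr_numeral power2_norm_eq_inner[symmetric])
  have "X = (\<integral>x. T x \<bullet> f x \<partial>lebesgue)" unfolding X_def Tf ..
  also have "\<dots> = (\<integral>x. (\<Sum>I\<in>F. \<Sum>e\<in>sigS. v I e \<bullet> (haar I e x *\<^sub>R f x)) \<partial>lebesgue)"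
    by (simp add: T_def hsum_def inner_sum_left)
  also have "\<dots> = (\<Sum>I\<in>F. \<Sum>e\<in>sigS. v I e \<bullet> hcoef f I e)"
  proof -
    have i: "integrable lebesgue (\<lambda>x. v I e \<bullet> (haar I e x *\<^sub>R f x))" if "I \<in> F" for I e
      using hcoef_eq(1)[of I f e] fint[of I] that F(2) by (intro integrable_inner_right) auto
    have "(\<integral>x. v I e \<bullet> (haar I e x *\<^sub>R f x) \<partial>lebesgue) = v I e \<bullet> hcoef f I e" if "I \<in> F" for I e
      unfolding hcoef_def using hcoef_eq(1)[of I f e] fint[of I] that F(2) by (intro integral_inner_right) auto
    with i show ?thesis
      by (subst Bochner_Integration.integral_sum) (auto simp: Bochner_Integration.integral_sum intro!: sum.cong)
  qed
  also have "\<dots> \<le> (\<Sum>I\<in>F. ?c I * g I)"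
    unfolding sum_distrib_right
  proof (intro sum_mono)
    fix I e assume I: "I \<in> F" and e: "e \<in> (sigS :: ('d \<Rightarrow> bool) set)"
    have "v I e \<bullet> hcoef f I e \<le> norm (v I e) * norm (hcoef f I e)" by (rule norm_cauchy_schwarz)
    also have "\<dots> \<le> (a I e * g I) * norm (hcoef f I e)" by (intro mult_right_mono v I e) auto
    finally show "v I e \<bullet> hcoef f I e \<le> a I e * norm (hcoef f I e) * g I" by (simp add: ac_simps)
  qed
  also have "\<dots> \<le> (\<integral>x. gmax F g x * (?K * M x) \<partial>lebesgue)"
  proof (rule carleson_embedding[OF F g _ _ _ _ hypo])
    show "set_integrable lebesgue I (\<lambda>x. ?K * M x)" if "I \<in> F" for I
      using Mi[of I] that F by auto
  qed (use a K0 M0 in \<open>auto intro!: sum_nonneg mult_nonneg_nonneg\<close>)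
  also have "\<dots> = ?K * (\<integral>x. gmax F g x * M x \<partial>lebesgue)"
    by (subst integral_mult_right_zero[symmetric]) (simp add: ac_simps)
  also have "\<dots> \<le> ?K * ((\<integral>x. gmax F g x powr p \<partial>lebesgue) powr (1/p) * (\<integral>x. M x powr q \<partial>lebesgue) powr (1/q))"
  proof (intro mult_left_mono Holder_integral(2)[OF p q(1,2)] K0 M0 gmax_nonneg F gmax_lebesgue Mb)
    show "integrable lebesgue (\<lambda>x. gmax F g x powr p)" by (rule gmax_powr_integrable[OF F]) (use p in simp)
    show "integrable lebesgue (\<lambda>x. M x powr q)" unfolding M_def by (rule gmax_powr_integrable[OF R]) (use q in simp)
  qed
  also have "\<dots> \<le> ?K * ((\<integral>x. gmax F g x powr p \<partial>lebesgue) powr (1/p) * (p powr q * X) powr (1/q))"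
  proof (intro mult_left_mono powr_mono2 K0)
    have "(\<integral>x. M x powr q \<partial>lebesgue) \<le> (q / (q - 1)) powr q * (\<integral>x. norm (f x) powr q \<partial>lebesgue)"
      unfolding M_def
    proof (rule doob[OF q(1) R])
      show "integrable lebesgue (\<lambda>x. norm (f x) powr q)" unfolding nfq by (rule Tint)
      show "0 \<le> mean (\<lambda>x. norm (f x)) I" if "I \<in> R" for I using that R by (intro mean_nonneg) auto
      show "mean (\<lambda>x. norm (f x)) I * vol I \<le> (LINT x:I|lebesgue. norm (f x))" if "I \<in> R" for I
        using mean_mult[of I "\<lambda>x. norm (f x)"] that R by auto
    qed auto
    then show "(\<integral>x. M x powr q \<partial>lebesgue) \<le> p powr q * X" by (simp add: nfq X_def q)
  qed (use q in \<open>auto intro!: integral_nonneg_AE\<close>)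
  also have "\<dots> = (?K * p) * ((\<integral>x. gmax F g x powr p \<partial>lebesgue) powr (1/p) * X powr (1/q))"
    using p q X0 by (simp add: powr_mult powr_powr)
  finally have "X \<le> (?K * p) powr p * (\<integral>x. gmax F g x powr p \<partial>lebesgue)"
    using K0 p X0 by (intro powr_absorb[OF p q(1,2)]) (auto intro!: integral_nonneg_AE)
  then show ?thesis by (simp add: X_def T_def)
qed

section \<open>Orthonormality of the Haar functions and Parseval for finite sums\<close>

lemma haar_integrable: "I \<in> D \<Longrightarrow> integrable lebesgue (haar I e)"
  using hcoef_eq(1)[of I "\<lambda>_. 1 :: real" e] by simp

lemma set_integrable_D:
  fixes f :: "_ \<Rightarrow> 'b::{banach, second_countable_topology}"
  assumes "integrable lebesgue f" "I \<in> D" shows "set_integrable lebesgue I f"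
  unfolding set_integrable_def by (intro integrable_mult_indicator) (use assms in auto)

text \<open>Of two nested cubes the smaller one lies in a single child of the larger, where the Haar
  function of the larger is constant, while that of the smaller has mean zero. On one and the same
  cube it is orthogonality of characters.\<close>

lemma haar_orthonormal:
  assumes I: "I \<in> D" and J: "J \<in> D" and e: "e \<in> sigS" and e': "e' \<in> sigS"
  shows "hcoef (haar J e') I e = (if I = J \<and> e = e' then 1 else 0)"
proof -
  have zero: "hcoef (haar J e') I e = 0" if I: "I \<in> D" and J: "J \<in> D" and sub: "I \<subset> J" and e: "e \<in> sigS" for I J e e'
  proof -
    obtain s where s: "I \<subseteq> child J s" using subset_child[OF I J sub] by blast
    have "hcoef (haar J e') I e = (\<Sum>t\<in>UNIV. (sg e t / sqrt (vol I)) *\<^sub>R (LINT x:child I t|lebesgue. haar J e' x))"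
      by (rule hcoef_eq(2)[OF I]) (intro set_integrable_D haar_integrable I J)
    also have "\<dots> = (\<Sum>t\<in>UNIV. sg e t * (1 / sqrt (vol I) * (vol I / 2 ^ CARD('d)) * (sg e' s / sqrt (vol J))))"
    proof (rule sum.cong[OF refl])
      fix t
      have cD: "child I t \<in> D" by (rule child_in_D(1)[OF I])
      have "(LINT x:child I t|lebesgue. haar J e' x) = (LINT x:child I t|lebesgue. sg e' s / sqrt (vol J))"
      proof (rule set_lebesgue_integral_cong)
        show "\<forall>x. x \<in> child I t \<longrightarrow> haar J e' x = sg e' s / sqrt (vol J)"
          using haar_child[OF J, of _ s e'] s child_subset[OF I, of t] by (auto simp: subset_eq)
      qed (use cD in simp)
      also have "\<dots> = vol I / 2 ^ CARD('d) * (sg e' s / sqrt (vol J))"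
        by (subst D_integral_const[OF cD]) (simp add: vol_child[OF I])
      finally show "(sg e t / sqrt (vol I)) *\<^sub>R (LINT x:child I t|lebesgue. haar J e' x) =
        sg e t * (1 / sqrt (vol I) * (vol I / 2 ^ CARD('d)) * (sg e' s / sqrt (vol J)))" by simp
    qed
    also have "\<dots> = 0" unfolding sum_distrib_right[symmetric] sum_sg[OF e] by simp
    finally show ?thesis .
  qed
  have comm: "hcoef (haar J e') I e = hcoef (haar I e) J e'" by (simp add: hcoef_def mult.commute)
  consider "I \<subset> J" | "J \<subset> I" | "I \<inter> J = {}" | "I = J" using D_trichotomy[OF I J] by auto
  then show ?thesis
  proof cases
    case 1 then show ?thesis using zero[OF I J _ e] by auto
  next
    case 2 then show ?thesis using zero[OF J I _ e'] comm by auto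
  next
    case 3
    have z: "haar I e x *\<^sub>R haar J e' x = 0" for x
      using haar_outside[OF I, of x e] haar_outside[OF J, of x e'] 3 by auto
    have "I \<noteq> J" using 3 D_nonempty[OF I] by auto
    then show ?thesis unfolding hcoef_def z by simp
  next
    case 4
    have "hcoef (haar J e') I e = (\<Sum>t\<in>UNIV. (sg e t / sqrt (vol I)) *\<^sub>R (LINT x:child I t|lebesgue. haar J e' x))"
      by (rule hcoef_eq(2)[OF I]) (intro set_integrable_D haar_integrable I J)
    also have "\<dots> = (\<Sum>t\<in>UNIV. sg e t * sg e' t / 2 ^ CARD('d))"
    proof (rule sum.cong[OF refl])
      fix t
      have cD: "child I t \<in> D" by (rule child_in_D(1)[OF I])
      have "(LINT x:child I t|lebesgue. haar J e' x) = (LINT x:child I t|lebesgue. sg e' t / sqrt (vol I))"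
      proof (rule set_lebesgue_integral_cong)
        show "\<forall>x. x \<in> child I t \<longrightarrow> haar J e' x = sg e' t / sqrt (vol I)"
          using haar_child[OF J, of _ t e'] 4 by auto
      qed (use cD in simp)
      also have "\<dots> = vol I / 2 ^ CARD('d) * (sg e' t / sqrt (vol I))"
        by (subst D_integral_const[OF cD]) (simp add: vol_child[OF I])
      finally have "(LINT x:child I t|lebesgue. haar J e' x) = vol I / 2 ^ CARD('d) * (sg e' t / sqrt (vol I))" .
      then show "(sg e t / sqrt (vol I)) *\<^sub>R (LINT x:child I t|lebesgue. haar J e' x) = sg e t * sg e' t / 2 ^ CARD('d)"
      proof -
        have "sg e t / sqrt (vol I) * (vol I / 2 ^ CARD('d) * (sg e' t / sqrt (vol I))) =
            sg e t * sg e' t / 2 ^ CARD('d) * (vol I / (sqrt (vol I) * sqrt (vol I)))" by (simp add: ac_simps)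
        then show ?thesis using D_vol_pos[OF I] \<open>(LINT x:child I t|lebesgue. haar J e' x) = vol I / 2 ^ CARD('d) * (sg e' t / sqrt (vol I))\<close> by simp
      qed
    qed
    also have "\<dots> = (if e = e' then 1 else 0)"
      unfolding sum_divide_distrib[symmetric] sum_sg_mult by simp
    finally show ?thesis using 4 by simp
  qed
qed

lemma hsum_integrable:
  assumes F: "finite F" "F \<subseteq> D" shows "integrable lebesgue (hsum F v)"
  by (rule integrable_bdd[OF F hsum_borel[OF F(2)] hsum_bound[OF F]])

lemma hcoef_hsum:
  assumes F: "finite F" "F \<subseteq> D" and I: "I \<in> F" and e: "e \<in> sigS"
  shows "hcoef (hsum F v) I e = v I e"
proof -
  have ID: "I \<in> D" using I F by auto
  have i: "integrable lebesgue (\<lambda>x. haar I e x *\<^sub>R haar J e' x)" if "J \<in> F" for J e'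
    by (rule hcoef_eq(1)[OF ID]) (use that F(2) in \<open>auto intro!: set_integrable_D haar_integrable ID\<close>)
  have "hcoef (hsum F v) I e = (\<integral>x. (\<Sum>J\<in>F. \<Sum>e'\<in>sigS. (haar I e x *\<^sub>R haar J e' x) *\<^sub>R v J e') \<partial>lebesgue)"
    by (simp add: hcoef_def hsum_def scaleR_sum_right)
  also have "\<dots> = (\<Sum>J\<in>F. \<integral>x. (\<Sum>e'\<in>sigS. (haar I e x *\<^sub>R haar J e' x) *\<^sub>R v J e') \<partial>lebesgue)"
    using i by (intro Bochner_Integration.integral_sum Bochner_Integration.integrable_sum integrable_scaleR_left) auto
  also have "\<dots> = (\<Sum>J\<in>F. \<Sum>e'\<in>sigS. hcoef (haar J e') I e *\<^sub>R v J e')"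
  proof (rule sum.cong[OF refl])
    fix J assume J: "J \<in> F"
    have "(\<integral>x. (\<Sum>e'\<in>sigS. (haar I e x *\<^sub>R haar J e' x) *\<^sub>R v J e') \<partial>lebesgue) =
      (\<Sum>e'\<in>sigS. \<integral>x. (haar I e x *\<^sub>R haar J e' x) *\<^sub>R v J e' \<partial>lebesgue)"
      using i[OF J] by (intro Bochner_Integration.integral_sum integrable_scaleR_left) auto
    also have "\<dots> = (\<Sum>e'\<in>sigS. hcoef (haar J e') I e *\<^sub>R v J e')"
      using i[OF J] unfolding hcoef_def by (intro sum.cong refl integral_scaleR_left) auto
    finally show "(\<integral>x. (\<Sum>e'\<in>sigS. (haar I e x *\<^sub>R haar J e' x) *\<^sub>R v J e') \<partial>lebesgue) = (\<Sum>e'\<in>sigS. hcoef (haar J e') I e *\<^sub>R v J e')" .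
  qed
  also have "\<dots> = (\<Sum>J\<in>F. if J = I then v I e else 0)"
  proof (rule sum.cong[OF refl])
    fix J assume J: "J \<in> F"
    have "(\<Sum>e'\<in>sigS. hcoef (haar J e') I e *\<^sub>R v J e') = (\<Sum>e'\<in>sigS. if e' = e then (if J = I then v I e else 0) else 0)"
    proof (rule sum.cong[OF refl])
      fix e' :: "'d \<Rightarrow> bool" assume e': "e' \<in> sigS"
      have "J \<in> D" using J F by auto
      from haar_orthonormal[OF ID this e e']
      show "hcoef (haar J e') I e *\<^sub>R v J e' = (if e' = e then (if J = I then v I e else 0) else 0)" by auto
    qed
    then show "(\<Sum>e'\<in>sigS. hcoef (haar J e') I e *\<^sub>R v J e') = (if J = I then v I e else 0)"
      using e by simp
  qed
  finally show ?thesis using I F by simp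
qed

lemma hsum_parseval:
  assumes F: "finite F" "F \<subseteq> D"
  shows "(\<integral>x. (norm (hsum F v x))\<^sup>2 \<partial>lebesgue) = (\<Sum>I\<in>F. \<Sum>e\<in>sigS. (norm (v I e))\<^sup>2)"
proof -
  let ?T = "hsum F v"
  have i: "integrable lebesgue (\<lambda>x. haar I e x *\<^sub>R ?T x)" if "I \<in> F" for I e
    by (rule hcoef_eq(1)) (use that F(2) in \<open>auto intro!: set_integrable_D hsum_integrable F\<close>)
  have "(\<integral>x. (norm (?T x))\<^sup>2 \<partial>lebesgue) = (\<integral>x. (\<Sum>I\<in>F. \<Sum>e\<in>sigS. v I e \<bullet> (haar I e x *\<^sub>R ?T x)) \<partial>lebesgue)"
  proof (rule Bochner_Integration.integral_cong[OF refl])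
    fix x
    have "(norm (?T x))\<^sup>2 = hsum F v x \<bullet> ?T x" by (simp add: power2_norm_eq_inner)
    also have "\<dots> = (\<Sum>I\<in>F. \<Sum>e\<in>sigS. v I e \<bullet> (haar I e x *\<^sub>R ?T x))"
      by (subst (1) hsum_def) (simp add: inner_sum_left)
    finally show "(norm (?T x))\<^sup>2 = (\<Sum>I\<in>F. \<Sum>e\<in>sigS. v I e \<bullet> (haar I e x *\<^sub>R ?T x))" .
  qed
  also have "\<dots> = (\<Sum>I\<in>F. \<integral>x. (\<Sum>e\<in>sigS. v I e \<bullet> (haar I e x *\<^sub>R ?T x)) \<partial>lebesgue)"
    using i by (intro Bochner_Integration.integral_sum Bochner_Integration.integrable_sum integrable_inner_right) auto
  also have "\<dots> = (\<Sum>I\<in>F. \<Sum>e\<in>sigS. (norm (v I e))\<^sup>2)"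
  proof (rule sum.cong[OF refl])
    fix I assume I: "I \<in> F"
    have "(\<integral>x. (\<Sum>e\<in>sigS. v I e \<bullet> (haar I e x *\<^sub>R ?T x)) \<partial>lebesgue) = (\<Sum>e\<in>sigS. \<integral>x. v I e \<bullet> (haar I e x *\<^sub>R ?T x) \<partial>lebesgue)"
      using i[OF I] by (intro Bochner_Integration.integral_sum integrable_inner_right) auto
    also have "\<dots> = (\<Sum>e\<in>sigS. v I e \<bullet> hcoef ?T I e)"
      unfolding hcoef_def using i[OF I] by (intro sum.cong refl integral_inner_right) auto
    also have "\<dots> = (\<Sum>e\<in>sigS. (norm (v I e))\<^sup>2)"
      using hcoef_hsum[OF F I, of _ v] by (intro sum.cong) (auto simp: power2_norm_eq_inner)
    finally show "(\<integral>x. (\<Sum>e\<in>sigS. v I e \<bullet> (haar I e x *\<^sub>R ?T x)) \<partial>lebesgue) = (\<Sum>e\<in>sigS. (norm (v I e))\<^sup>2)" .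
  qed
  finally show ?thesis .
qed

end

section \<open>Approximation by averages\<close>

text \<open>Two applications of dominated convergence: \<open>f\<close> is first truncated at height
  \<open>m\<close>, then the truncation is approximated by continuous functions converging almost
  everywhere.\<close>

lemma L1_continuous_approx:
  fixes f :: "'a::euclidean_space \<Rightarrow> real"
  assumes S: "S \<in> lmeasurable" and f: "f \<in> borel_measurable lebesgue" "\<And>x. 0 \<le> f x" "set_integrable lebesgue S f"
    and e: "0 < e"
  shows "\<exists>g. continuous_on UNIV g \<and> set_integrable lebesgue S g \<and> (LINT x:S|lebesgue. \<bar>f x - g x\<bar>) < e"
proof -
  have Sm: "S \<in> sets lebesgue" using S by auto
  have iS: "integrable lebesgue (\<lambda>x. indicat_real S x * c)" for c
    using S by (intro integrable_mult_left) (auto simp: fmeasurable_def)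
  note [measurable] = f(1) Sm
  define h where "h m x = min (f x) (real m)" for m x
  have h0: "0 \<le> h m x" "h m x \<le> f x" "h m x \<le> real m" for m x using f(2) by (auto simp: h_def)
  have hm [measurable]: "h m \<in> borel_measurable lebesgue" for m unfolding h_def by measurable
  have "(\<lambda>m. LINT x|lebesgue. indicator S x *\<^sub>R \<bar>f x - h m x\<bar>) \<longlonglongrightarrow> (LINT x::'a|lebesgue. 0)"
  proof (rule integral_dominated_convergence[where w="\<lambda>x. indicator S x *\<^sub>R f x"])
    show "AE x in lebesgue. (\<lambda>m. indicat_real S x *\<^sub>R \<bar>f x - h m x\<bar>) \<longlonglongrightarrow> 0"
    proof (rule AE_I2)
      fix x
      obtain n :: nat where n: "f x \<le> real n" using real_arch_simple by blast
      have "\<forall>\<^sub>F m in sequentially. indicat_real S x *\<^sub>R \<bar>f x - h m x\<bar> = 0"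
        using eventually_ge_at_top[of n] by eventually_elim (use n in \<open>auto simp: h_def\<close>)
      then show "(\<lambda>m. indicat_real S x *\<^sub>R \<bar>f x - h m x\<bar>) \<longlonglongrightarrow> 0" by (rule tendsto_eventually)
    qed
    show "AE x in lebesgue. norm (indicat_real S x *\<^sub>R \<bar>f x - h m x\<bar>) \<le> indicat_real S x *\<^sub>R f x" for m
      using h0 by (auto simp: indicator_def)
  qed (use f(3) in \<open>auto simp: set_integrable_def\<close>)
  then have "\<forall>\<^sub>F m in sequentially. (LINT x|lebesgue. indicator S x *\<^sub>R \<bar>f x - h m x\<bar>) < e / 2"
    using e by (intro order_tendstoD(2)) auto
  then obtain m where m: "(LINT x|lebesgue. indicator S x *\<^sub>R \<bar>f x - h m x\<bar>) < e / 2"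
    using eventually_happens'[OF sequentially_bot] by blast
  have "h m measurable_on UNIV" by (rule lebesgue_measurable_imp_measurable_on) (simp_all add: hm)
  then obtain N g where N: "negligible N" and g: "\<And>n. continuous_on UNIV (g n)"
    and lim: "\<And>x. x \<notin> N \<Longrightarrow> (\<lambda>n. g n x) \<longlonglongrightarrow> h m x"
    unfolding measurable_on_def by auto
  \<comment> \<open>Clipping preserves continuity and the limit, which lies between 0 and
    \<open>m\<close>, and supplies the dominating constant.\<close>
  define G where "G n x = max 0 (min (g n x) (real m))" for n x
  have Gc: "continuous_on UNIV (G n)" for n unfolding G_def by (intro continuous_intros g)
  have Gb: "0 \<le> G n x" "G n x \<le> real m" for n x by (auto simp: G_def)
  have Gm [measurable]: "G n \<in> borel_measurable lebesgue" for n
    using borel_measurable_continuous_onI[OF Gc] by (simp add: measurable_completion)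
  have Gi: "set_integrable lebesgue S (G n)" for n
    unfolding set_integrable_def
    by (rule Bochner_Integration.integrable_bound[OF iS[of "real m"]]) (use Gb in \<open>auto simp: indicator_def\<close>)
  have "(\<lambda>n. LINT x|lebesgue. indicator S x *\<^sub>R \<bar>h m x - G n x\<bar>) \<longlonglongrightarrow> (LINT x::'a|lebesgue. 0)"
  proof (rule integral_dominated_convergence[where w="\<lambda>x. indicator S x * real m"])
    have "AE x in lebesgue. x \<notin> N" using N by (simp add: negligible_iff_null_sets AE_not_in)
    then show "AE x in lebesgue. (\<lambda>n. indicat_real S x *\<^sub>R \<bar>h m x - G n x\<bar>) \<longlonglongrightarrow> 0"
    proof eventually_elim
      case (elim x)
      have "(\<lambda>n. G n x) \<longlonglongrightarrow> max 0 (min (h m x) (real m))"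
        unfolding G_def by (intro tendsto_intros lim elim)
      then have "(\<lambda>n. G n x) \<longlonglongrightarrow> h m x" using h0 by (simp add: max_def min_def)
      then have "(\<lambda>n. indicat_real S x *\<^sub>R \<bar>h m x - G n x\<bar>) \<longlonglongrightarrow> indicat_real S x *\<^sub>R \<bar>h m x - h m x\<bar>"
        by (intro tendsto_intros)
      then show ?case by simp
    qed
    have "\<bar>h m x - G n x\<bar> \<le> real m" for n x using h0[of m x] Gb[of n x] by auto
    then show "AE x in lebesgue. norm (indicat_real S x *\<^sub>R \<bar>h m x - G n x\<bar>) \<le> indicat_real S x * real m" for n
      by (auto simp: indicator_def)
  qed (use iS in auto)
  then have "\<forall>\<^sub>F n in sequentially. (LINT x|lebesgue. indicator S x *\<^sub>R \<bar>h m x - G n x\<bar>) < e / 2"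
    using e by (intro order_tendstoD(2)) auto
  then obtain n where n: "(LINT x|lebesgue. indicator S x *\<^sub>R \<bar>h m x - G n x\<bar>) < e / 2"
    using eventually_happens'[OF sequentially_bot] by blast
  have hi: "set_integrable lebesgue S (h m)"
    by (rule set_integrable_bound[OF f(3)]) (use h0 f(2) in \<open>auto simp: set_borel_measurable_def\<close>)
  have i1: "set_integrable lebesgue S (\<lambda>x. \<bar>f x - h m x\<bar>)" "set_integrable lebesgue S (\<lambda>x. \<bar>h m x - G n x\<bar>)"
    "set_integrable lebesgue S (\<lambda>x. \<bar>f x - G n x\<bar>)"
    by (intro set_integrable_abs set_integral_diff f(3) hi Gi)+
  have "(LINT x:S|lebesgue. \<bar>f x - G n x\<bar>) \<le> (LINT x:S|lebesgue. \<bar>f x - h m x\<bar> + \<bar>h m x - G n x\<bar>)"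
    by (rule set_integral_mono[OF i1(3) set_integral_add(1)[OF i1(1,2)]]) auto
  also have "\<dots> = (LINT x:S|lebesgue. \<bar>f x - h m x\<bar>) + (LINT x:S|lebesgue. \<bar>h m x - G n x\<bar>)"
    by (rule set_integral_add(2)[OF i1(1,2)])
  also have "\<dots> < e" using m n by (simp add: set_lebesgue_integral_def)
  finally show ?thesis using Gc Gi by blast
qed

context grid
begin

definition slice :: "(real^'d) set \<Rightarrow> nat \<Rightarrow> (real^'d) set set" where
  "slice J n = {Q\<in>D. Q \<subseteq> J \<and> lev Q = lev J + int n}"

text \<open>The conditional expectation of \<open>f\<close> on \<open>J\<close> given the dyadic
  cubes \<open>n\<close> generations below \<open>J\<close>.\<close>

definition cexp :: "(real^'d) set \<Rightarrow> nat \<Rightarrow> (real^'d \<Rightarrow> real) \<Rightarrow> real^'d \<Rightarrow> real" where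
  "cexp J n f x = (\<Sum>Q\<in>slice J n. mean f Q * indicator Q x)"

lemma slice_props:
  assumes "J \<in> D"
  shows "finite (slice J n)" "slice J n \<subseteq> D" "disjoint (slice J n)" "\<Union>(slice J n) = J"
proof -
  show "finite (slice J n)"
    by (rule finite_subset[OF _ finite_desc[OF assms, of "lev J + int n"]]) (auto simp: slice_def)
  show "slice J n \<subseteq> D" by (auto simp: slice_def)
  show "disjoint (slice J n)"
    unfolding disjoint_def
  proof (intro ballI impI)
    fix A B assume AB: "A \<in> slice J n" "B \<in> slice J n" "A \<noteq> B"
    show "A \<inter> B = {}"
    proof (rule ccontr)
      assume "A \<inter> B \<noteq> {}"
      then obtain x where "x \<in> A" "x \<in> B" by auto
      then show False using D_unique[of A B x] AB by (auto simp: slice_def)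
    qed
  qed
  show "\<Union>(slice J n) = J"
  proof
    show "J \<subseteq> \<Union>(slice J n)"
    proof
      fix x assume x: "x \<in> J"
      obtain Q where Q: "Q \<in> D" "lev Q = lev J + int n" "x \<in> Q" using D_exists by blast
      have "Q \<subseteq> J" by (rule D_nested[OF Q(1) assms Q(3) x]) (simp add: Q)
      then show "x \<in> \<Union>(slice J n)" using Q by (auto simp: slice_def)
    qed
  qed (auto simp: slice_def)
qed

lemma cexp_eq:
  assumes J: "J \<in> D" and Q: "Q \<in> slice J n" "x \<in> Q"
  shows "cexp J n f x = mean f Q"
proof -
  have "(\<Sum>Q'\<in>slice J n. mean f Q' * indicator Q' x) = (\<Sum>Q'\<in>slice J n. if Q' = Q then mean f Q else 0)"
  proof (rule sum.cong[OF refl])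
    fix Q' assume Q': "Q' \<in> slice J n"
    have "x \<notin> Q'" if "Q' \<noteq> Q" using slice_props(3)[OF J, of n] Q Q' that by (auto simp: disjoint_def)
    then show "mean f Q' * indicator Q' x = (if Q' = Q then mean f Q else 0)" using Q(2) by auto
  qed
  then show ?thesis using slice_props(1)[OF J] Q(1) by (simp add: cexp_def)
qed

lemma cexp_measurable: "J \<in> D \<Longrightarrow> cexp J n f \<in> borel_measurable lebesgue"
  unfolding cexp_def[abs_def] using slice_props(2)[of J n] D_sets
  by (intro borel_measurable_sum borel_measurable_times borel_measurable_indicator) auto

lemma integral_slice:
  fixes f :: "_ \<Rightarrow> real"
  assumes J: "J \<in> D" and f: "set_integrable lebesgue J f"
  shows "(LINT x:J|lebesgue. f x) = (\<Sum>Q\<in>slice J n. LINT x:Q|lebesgue. f x)"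
proof -
  have "(LINT x:\<Union>(slice J n)|lebesgue. f x) = (\<Sum>Q\<in>slice J n. LINT x:Q|lebesgue. f x)"
  proof (rule integral_disjoint_eq[OF slice_props(1-3)[OF J]])
    fix K assume K: "K \<in> slice J n"
    then show "set_integrable lebesgue K f"
      by (intro set_integrable_subset[OF f]) (auto simp: slice_def)
  qed
  then show ?thesis unfolding slice_props(4)[OF J] .
qed

lemma cexp_integrable: "J \<in> D \<Longrightarrow> set_integrable lebesgue J (\<lambda>x. G (cexp J n f x) :: real)"
proof -
  assume J: "J \<in> D"
  have "set_integrable lebesgue (\<Union>(slice J n)) (\<lambda>x. G (cexp J n f x))"
  proof (rule set_integrable_Union_D[OF slice_props(1,2)[OF J]])
    fix I assume I: "I \<in> slice J n"
    then have "I \<in> D" by (auto simp: slice_def)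
    then have "set_integrable lebesgue I (\<lambda>x. G (mean f I))" by simp
    then show "set_integrable lebesgue I (\<lambda>x. G (cexp J n f x))"
      by (rule set_integrable_cong[THEN iffD1, rotated -1]) (use cexp_eq[OF J I] in auto)
  qed
  then show ?thesis unfolding slice_props(4)[OF J] .
qed

lemma cexp_integral:
  assumes J: "J \<in> D"
  shows "(LINT x:J|lebesgue. G (cexp J n f x)) = (\<Sum>Q\<in>slice J n. vol Q * (G (mean f Q) :: real))"
  unfolding integral_slice[OF J cexp_integrable[OF J, of G n f], of n]
proof (rule sum.cong[OF refl])
  fix Q assume Q: "Q \<in> slice J n"
  then have QD: "Q \<in> D" by (auto simp: slice_def)
  have "(LINT x:Q|lebesgue. G (cexp J n f x)) = (LINT x:Q|lebesgue. G (mean f Q))"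
    by (rule set_lebesgue_integral_cong) (use QD cexp_eq[OF J Q] in auto)
  then show "(LINT x:Q|lebesgue. G (cexp J n f x)) = vol Q * G (mean f Q)" using QD by simp
qed

lemma cexp_contract:
  assumes J: "J \<in> D" and f: "set_integrable lebesgue J f"
  shows "(LINT x:J|lebesgue. \<bar>cexp J n f x\<bar>) \<le> (LINT x:J|lebesgue. \<bar>f x\<bar>)"
proof -
  have "(LINT x:J|lebesgue. \<bar>cexp J n f x\<bar>) = (\<Sum>Q\<in>slice J n. vol Q * \<bar>mean f Q\<bar>)"
    by (rule cexp_integral[OF J, of abs])
  also have "\<dots> \<le> (\<Sum>Q\<in>slice J n. LINT x:Q|lebesgue. \<bar>f x\<bar>)"
  proof (rule sum_mono)
    fix Q assume "Q \<in> slice J n"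
    then have Q: "Q \<in> D" by (auto simp: slice_def)
    have "vol Q * \<bar>mean f Q\<bar> \<le> vol Q * mean (\<lambda>x. \<bar>f x\<bar>) Q"
      using norm_mean_le[OF Q, of f] D_vol_pos[OF Q] by (intro mult_left_mono) auto
    then show "vol Q * \<bar>mean f Q\<bar> \<le> (LINT x:Q|lebesgue. \<bar>f x\<bar>)"
      using mean_mult[OF Q, of "\<lambda>x. \<bar>f x\<bar>"] by simp
  qed
  also have "\<dots> = (LINT x:J|lebesgue. \<bar>f x\<bar>)"
    by (rule integral_slice[symmetric, OF J set_integrable_abs[OF f]])
  finally show ?thesis .
qed

lemma D_dist:
  assumes "Q \<in> D" "x \<in> Q" "y \<in> Q"
  shows "dist x y \<le> CARD('d) * 2 powr (- real_of_int (lev Q))"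
proof -
  have "\<bar>(x - y) $ i\<bar> \<le> cube_side Q" for i
    using assms(2,3)[unfolded mem_D_iff[OF assms(1)]] by (auto simp: abs_le_iff dest!: spec[of _ i])
  then have "(\<Sum>i\<in>UNIV. \<bar>(x - y) $ i\<bar>) \<le> (\<Sum>i\<in>(UNIV :: 'd set). cube_side Q)" by (intro sum_mono) auto
  then show ?thesis using norm_le_l1_cart[of "x - y"] D_dcube(2)[OF assms(1)] by (simp add: dist_norm)
qed

lemma D_bounded: "J \<in> D \<Longrightarrow> bounded J"
  using D_dist[of J] unfolding bounded_def by (metis D_nonempty)

lemma cexp_continuous:
  assumes J: "J \<in> D" and g: "continuous_on UNIV g" "set_integrable lebesgue J g" and e: "0 < e"
  shows "\<exists>N. \<forall>n\<ge>N. (LINT x:J|lebesgue. \<bar>cexp J n g x - g x\<bar>) \<le> e"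
proof -
  define h where "h = e / vol J"
  have h: "h > 0" using e D_vol_pos[OF J] by (simp add: h_def)
  have "uniformly_continuous_on (closure J) g"
    using D_bounded[OF J] g(1) by (intro compact_uniformly_continuous continuous_on_subset[OF g(1)]) auto
  then obtain d where d: "d > 0" "\<And>x y. x \<in> closure J \<Longrightarrow> y \<in> closure J \<Longrightarrow> dist y x < d \<Longrightarrow> dist (g y) (g x) < h"
    unfolding uniformly_continuous_on_def using h by metis
  \<comment> \<open>From generation \<open>N\<close> below \<open>J\<close> on, the diameter bound
    of \<open>D_dist\<close> is smaller than the modulus \<open>d\<close>.\<close>
  obtain N :: nat where N: "CARD('d) * 2 powr (- real_of_int (lev J)) / d < 2 ^ N"
    using real_arch_pow[of 2] by auto
  show ?thesis
  proof (intro exI[of _ N] allI impI)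
    fix n assume n: "n \<ge> N"
    have pt: "\<bar>cexp J n g x - g x\<bar> \<le> h" if x: "x \<in> J" for x
    proof -
      obtain Q where Q: "Q \<in> slice J n" "x \<in> Q" using slice_props(4)[OF J, of n] x by auto
      then have QD: "Q \<in> D" "Q \<subseteq> J" "lev Q = lev J + int n" by (auto simp: slice_def)
      have gQ: "set_integrable lebesgue Q g" by (rule set_integrable_subset[OF g(2)]) (use QD in auto)
      have osc: "\<bar>g y - g x\<bar> \<le> h" if y: "y \<in> Q" for y
      proof -
        have "dist y x \<le> CARD('d) * 2 powr (- real_of_int (lev Q))" by (rule D_dist[OF QD(1) y Q(2)])
        also have "\<dots> = CARD('d) * 2 powr (- real_of_int (lev J)) / 2 ^ n"
          by (simp add: QD(3) powr_diff powr_realpow)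
        also have "\<dots> \<le> CARD('d) * 2 powr (- real_of_int (lev J)) / 2 ^ N"
          using n by (intro divide_left_mono) (auto intro!: power_increasing)
        also have "\<dots> < d" using N d(1) by (simp add: field_simps)
        finally have "dist (g y) (g x) < h"
          using y Q(2) QD(2) by (intro d(2)) (auto intro: closure_subset[THEN subsetD])
        then show ?thesis by (simp add: dist_real_def)
      qed
      have "cexp J n g x - g x = mean (\<lambda>y. g y - g x) Q"
        unfolding cexp_eq[OF J Q] mean_def using gQ QD(1) by (simp add: set_integral_diff field_simps)
      also have "\<bar>\<dots>\<bar> \<le> mean (\<lambda>y. \<bar>g y - g x\<bar>) Q"
        using norm_mean_le[OF QD(1), of "\<lambda>y. g y - g x"] by simp
      also have "\<dots> \<le> h"
      proof -
        have "(LINT y:Q|lebesgue. \<bar>g y - g x\<bar>) \<le> (LINT y:Q|lebesgue. h)"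
          by (rule set_integral_mono) (use gQ QD osc in \<open>auto intro!: set_integrable_abs set_integral_diff\<close>)
        then show ?thesis using D_vol_pos[OF QD(1)] QD(1) by (simp add: mean_def field_simps)
      qed
      finally show ?thesis .
    qed
    have "(LINT x:J|lebesgue. \<bar>cexp J n g x - g x\<bar>) \<le> (LINT x:J|lebesgue. h)"
      by (rule set_integral_mono) (use pt J cexp_integrable[OF J, of "\<lambda>t. t"] g(2) in \<open>auto intro!: set_integrable_abs set_integral_diff\<close>)
    then show "(LINT x:J|lebesgue. \<bar>cexp J n g x - g x\<bar>) \<le> e"
      using J D_vol_pos[OF J] by (simp add: h_def)
  qed
qed

lemma cexp_diff:
  assumes J: "J \<in> D" and f: "set_integrable lebesgue J f" and g: "set_integrable lebesgue J g" and x: "x \<in> J"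
  shows "cexp J n (\<lambda>x. f x - g x) x = cexp J n f x - cexp J n g x"
proof -
  obtain Q where Q: "Q \<in> slice J n" "x \<in> Q" using slice_props(4)[OF J, of n] x by auto
  then have "set_integrable lebesgue Q f" "set_integrable lebesgue Q g"
    by (auto simp: slice_def intro!: set_integrable_subset[OF f] set_integrable_subset[OF g])
  then show ?thesis unfolding cexp_eq[OF J Q] mean_def by (simp add: set_integral_diff right_diff_distrib)
qed

text \<open>Density: for continuous functions convergence is uniform, and conditional expectation
  contracts the L^1 error of the approximation.\<close>

lemma cexp_L1:
  assumes J: "J \<in> D" and f: "f \<in> borel_measurable lebesgue" "\<And>x. 0 \<le> f x" "set_integrable lebesgue J f"
  shows "(\<lambda>n. LINT x:J|lebesgue. \<bar>cexp J n f x - f x\<bar>) \<longlonglongrightarrow> 0"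
proof (rule LIMSEQ_I)
  fix r :: real assume r: "0 < r"
  obtain g where g: "continuous_on UNIV g" "set_integrable lebesgue J g" "(LINT x:J|lebesgue. \<bar>f x - g x\<bar>) < r / 3"
    using L1_continuous_approx[OF D_lmeasurable[OF J] f, of "r / 3"] r by auto
  obtain N where N: "\<And>n. n \<ge> N \<Longrightarrow> (LINT x:J|lebesgue. \<bar>cexp J n g x - g x\<bar>) \<le> r / 3"
    using cexp_continuous[OF J g(1,2), of "r / 3"] r by auto
  have ci: "set_integrable lebesgue J (cexp J n h)" for n h using cexp_integrable[OF J, of "\<lambda>t. t"] .
  have fg: "set_integrable lebesgue J (\<lambda>x. f x - g x)" by (rule set_integral_diff(1)[OF f(3) g(2)])
  show "\<exists>no. \<forall>n\<ge>no. norm ((LINT x:J|lebesgue. \<bar>cexp J n f x - f x\<bar>) - 0) < r"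
  proof (intro exI[of _ N] allI impI)
    fix n assume n: "n \<ge> N"
    have i: "set_integrable lebesgue J (\<lambda>x. \<bar>cexp J n (\<lambda>x. f x - g x) x\<bar>)"
      "set_integrable lebesgue J (\<lambda>x. \<bar>cexp J n g x - g x\<bar>)" "set_integrable lebesgue J (\<lambda>x. \<bar>f x - g x\<bar>)"
      "set_integrable lebesgue J (\<lambda>x. \<bar>cexp J n f x - f x\<bar>)"
      by (intro set_integrable_abs set_integral_diff ci f(3) g(2))+
    have i2: "set_integrable lebesgue J (\<lambda>x. \<bar>cexp J n g x - g x\<bar> + \<bar>f x - g x\<bar>)"
      by (rule set_integral_add(1)[OF i(2,3)])
    have "(LINT x:J|lebesgue. \<bar>cexp J n f x - f x\<bar>) \<le>
       (LINT x:J|lebesgue. \<bar>cexp J n (\<lambda>x. f x - g x) x\<bar> + (\<bar>cexp J n g x - g x\<bar> + \<bar>f x - g x\<bar>))"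
    proof (rule set_integral_mono[OF i(4) set_integral_add(1)[OF i(1) i2]])
      fix x assume "x \<in> J"
      from cexp_diff[OF J f(3) g(2) this, of n]
      show "\<bar>cexp J n f x - f x\<bar> \<le> \<bar>cexp J n (\<lambda>x. f x - g x) x\<bar> + (\<bar>cexp J n g x - g x\<bar> + \<bar>f x - g x\<bar>)" by linarith
    qed
    also have "\<dots> = (LINT x:J|lebesgue. \<bar>cexp J n (\<lambda>x. f x - g x) x\<bar>) + ((LINT x:J|lebesgue. \<bar>cexp J n g x - g x\<bar>) + (LINT x:J|lebesgue. \<bar>f x - g x\<bar>))"
      by (simp add: set_integral_add(2)[OF i(1) i2] set_integral_add(2)[OF i(2,3)])
    also have "\<dots> < r" using cexp_contract[OF J fg, of n] N[OF n] g(3) by linarith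
    finally have "(LINT x:J|lebesgue. \<bar>cexp J n f x - f x\<bar>) < r" .
    moreover have "0 \<le> (LINT x:J|lebesgue. \<bar>cexp J n f x - f x\<bar>)"
      unfolding set_lebesgue_integral_def by (intro integral_nonneg_AE) auto
    ultimately show "norm ((LINT x:J|lebesgue. \<bar>cexp J n f x - f x\<bar>) - 0) < r" by simp
  qed
qed

text \<open>Transfers bounds on averages to the function itself: L^1 convergence yields an almost
  everywhere convergent subsequence, and Fatou's lemma does the rest.\<close>

lemma nn_integral_le_cexp:
  assumes J: "J \<in> D" and f: "f \<in> borel_measurable lebesgue" "\<And>x. 0 \<le> f x" "set_integrable lebesgue J f"
    and r: "0 < r" and B: "\<And>n. (LINT x:J|lebesgue. cexp J n f x powr r) \<le> B"
  shows "(\<integral>\<^sup>+x\<in>J. ennreal (f x powr r) \<partial>lebesgue) \<le> ennreal B"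
proof -
  note [measurable] = f(1) cexp_measurable[OF J] D_sets[OF J]
  define u where "u n x = indicator J x *\<^sub>R (cexp J n f x - f x)" for n x
  have ui: "integrable lebesgue (u n)" for n
    unfolding u_def using set_integral_diff(1)[OF cexp_integrable[OF J, of "\<lambda>t. t" n f] f(3)] by (simp add: set_integrable_def)
  have "(\<lambda>n. \<integral>x. norm (u n x) \<partial>lebesgue) \<longlonglongrightarrow> 0"
    using cexp_L1[OF J f] by (simp add: u_def set_lebesgue_integral_def abs_mult)
  from tendsto_L1_AE_subseq[OF ui this] obtain s :: "nat \<Rightarrow> nat" where s: "strict_mono s"
    and ae: "AE x in lebesgue. (\<lambda>n. u (s n) x) \<longlonglongrightarrow> 0" by blast
  let ?v = "\<lambda>n x. ennreal (indicator J x * cexp J (s n) f x powr r)"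
  have "(\<integral>\<^sup>+x\<in>J. ennreal (f x powr r) \<partial>lebesgue) \<le> (\<integral>\<^sup>+x. liminf (\<lambda>n. ?v n x) \<partial>lebesgue)"
  proof (rule nn_integral_mono_AE)
    show "AE x in lebesgue. ennreal (f x powr r) * indicator J x \<le> liminf (\<lambda>n. ?v n x)"
      using ae
    proof eventually_elim
      case (elim x)
      show ?case
      proof (cases "x \<in> J")
        case True
        have "(\<lambda>n. cexp J (s n) f x - f x) \<longlonglongrightarrow> 0" using elim True by (simp add: u_def)
        then have l: "(\<lambda>n. cexp J (s n) f x) \<longlonglongrightarrow> f x" by (rule LIM_zero_cancel)
        have "(\<lambda>n. cexp J (s n) f x powr r) \<longlonglongrightarrow> f x powr r"
        proof (rule tendsto_powr'[OF l tendsto_const])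
          have "0 \<le> cexp J n f x" for n unfolding cexp_def
            using slice_props(2)[OF J, of n] f(2) by (intro sum_nonneg mult_nonneg_nonneg mean_nonneg) auto
          then show "f x \<noteq> 0 \<or> 0 < r \<and> (\<forall>\<^sub>F n in sequentially. 0 \<le> cexp J (s n) f x)" using r by simp
        qed
        then have "(\<lambda>n. ?v n x) \<longlonglongrightarrow> ennreal (f x powr r)" using True by (auto intro!: tendsto_ennrealI)
        then have "liminf (\<lambda>n. ?v n x) = ennreal (f x powr r)" by (intro lim_imp_Liminf) auto
        then show ?thesis using True by simp
      qed simp
    qed
  qed
  also have "\<dots> \<le> liminf (\<lambda>n. \<integral>\<^sup>+x. ?v n x \<partial>lebesgue)"
    by (rule nn_integral_liminf) measurable
  also have "\<dots> \<le> ennreal B"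
  proof (rule Liminf_le)
    have "(\<integral>\<^sup>+x. ?v n x \<partial>lebesgue) \<le> ennreal B" for n
    proof -
      have "(\<integral>\<^sup>+x. ?v n x \<partial>lebesgue) = ennreal (\<integral>x. indicator J x * cexp J (s n) f x powr r \<partial>lebesgue)"
        using cexp_integrable[OF J, of "\<lambda>t. t powr r"] by (intro nn_integral_eq_integral) (auto simp: set_integrable_def)
      also have "\<dots> \<le> ennreal B" using B[of "s n"] by (intro ennreal_leI) (simp add: set_lebesgue_integral_def)
      finally show ?thesis .
    qed
    then show "\<forall>\<^sub>F n in sequentially. (\<integral>\<^sup>+x. ?v n x \<partial>lebesgue) \<le> ennreal B" by simp
  qed simp
  finally show ?thesis .
qed

section \<open>The dyadic reverse Hoelder inequality\<close>

text \<open>Stop where the mean has doubled. Unstopped cubes contribute at most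
  \<open>2 powr e\<close> times the claimed expression without \<open>C\<close>. The stopped ones
  fill at most half of \<open>J\<close>, so by \<open>ainf\<close> they carry at most the fraction
  \<open>1 - dl\<close> of the weight, while their means exceed that over \<open>J\<close> only by a
  dimensional factor. For small \<open>e\<close> the gain \<open>1 - dl\<close> beats that factor
  and the recursion closes.\<close>

lemma reverse_Holder_discrete:
  assumes w: "\<And>I. I \<in> D \<Longrightarrow> set_integrable lebesgue I w" "\<And>x. 0 \<le> w x"
    and dl: "0 < dl" "dl < 1"
    and ainf: "\<And>J E. J \<in> D \<Longrightarrow> E \<in> sets lebesgue \<Longrightarrow> E \<subseteq> J \<Longrightarrow> measure lebesgue E \<le> vol J / 2 \<Longrightarrow>
       (LINT x:E|lebesgue. w x) \<le> (1 - dl) * (LINT x:J|lebesgue. w x)"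
    and e: "0 < e" "(2 * 2 ^ CARD('d)) powr e * (1 - dl) \<le> 1 - dl / 2"
    and J0: "J0 \<in> D"
  shows "(\<Sum>Q\<in>slice J0 n. vol Q * mean w Q powr (1 + e)) \<le> 2 * 2 powr e / dl * (mean w J0 powr e * (vol J0 * mean w J0))"
proof -
  define F where "F = slice J0 n"
  have F: "finite F" "F \<subseteq> D" "disjoint F" and UF: "\<Union>F = J0"
    using slice_props[OF J0, of n] by (auto simp: F_def)
  define C where "C = 2 * 2 powr e / dl"
  have C: "C > 0" using dl by (simp add: C_def)
  let ?c = "\<lambda>Q. vol Q * mean w Q powr (1 + e)"
  let ?m = "mean w"
  have m0: "0 \<le> ?m I" if "I \<in> D" for I by (rule mean_nonneg[OF that w(2)])
  have v0: "0 \<le> vol I" if "I \<in> D" for I using D_vol_pos[OF that] by simp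
  have wI: "(LINT x:I|lebesgue. w x) = vol I * ?m I" if "I \<in> D" for I using mean_mult[OF that, of w] by simp
  have key: "J \<subseteq> J0 \<Longrightarrow> (\<Sum>Q | Q \<in> F \<and> Q \<subseteq> J. ?c Q) \<le> C * (?m J powr e * (vol J * ?m J))" if "J \<in> D" for J
    using that F(1,2)
  proof (induction J rule: level_induct)
    case (base J)
    have "{Q. Q \<in> F \<and> Q \<subseteq> J} = {}" using base(2) by auto
    moreover have "0 \<le> C * (?m J powr e * (vol J * ?m J))"
      using C m0[OF base(1)] v0[OF base(1)] by auto
    ultimately show ?case by (simp only: sum.empty)
  next
    case (step J)
    note J = step(1)
    define W where "W = vol J * ?m J"
    define S where "S K \<longleftrightarrow> 2 * ?m J < ?m K" for K
    obtain X where X: "finite X" "X \<subseteq> D" "disjoint X"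
      and XS: "\<forall>K\<in>X. S K \<and> K \<subset> J \<and> (\<forall>K'\<in>D. K \<subset> K' \<longrightarrow> K' \<subset> J \<longrightarrow> \<not> S K')"
      and Xsum: "\<forall>c :: _ \<Rightarrow> real. (\<Sum>I | I \<in> F \<and> I \<subseteq> J. c I) =
         (\<Sum>I | I \<in> F \<and> I \<subseteq> J \<and> (\<forall>K\<in>D. I \<subseteq> K \<longrightarrow> K \<subset> J \<longrightarrow> \<not> S K). c I) + (\<Sum>K\<in>X. \<Sum>I | I \<in> F \<and> I \<subseteq> K. c I)"
      using stopping_family[OF J F(1,2), of S] by (elim exE conjE) (rule that)
    note XS = bspec[OF XS] and Xsum = spec[OF Xsum]
    have XJ: "K \<subseteq> J" if "K \<in> X" for K using XS[OF that] by auto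
    have V: "(\<Sum>K\<in>X. vol K) \<le> vol J / 2"
      by (rule stopping_vol[OF J w _ X XJ]) (use XS in \<open>auto simp: S_def\<close>)
    have XW: "(\<Sum>K\<in>X. vol K * ?m K) \<le> (1 - dl) * W"
    proof -
      have m: "\<Union>X \<in> sets lebesgue" using X by (auto intro!: sets.finite_Union)
      have "measure lebesgue (\<Union>X) = (LINT x:\<Union>X|lebesgue. 1)"
        using Union_lmeasurable[OF X(1,2)] by (simp add: set_lebesgue_integral_def fmeasurable_def)
      also have "\<dots> = (\<Sum>K\<in>X. LINT x:K|lebesgue. 1)" by (rule integral_disjoint_eq[OF X]) (use X in auto)
      also have "\<dots> = (\<Sum>K\<in>X. vol K)" using X by (intro sum.cong) auto
      finally have "measure lebesgue (\<Union>X) \<le> vol J / 2" using V by simp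
      then have "(LINT x:\<Union>X|lebesgue. w x) \<le> (1 - dl) * (LINT x:J|lebesgue. w x)"
        using XJ by (intro ainf[OF J m]) auto
      also have "(LINT x:\<Union>X|lebesgue. w x) = (\<Sum>K\<in>X. LINT x:K|lebesgue. w x)"
        by (rule integral_disjoint_eq[OF X]) (use X w in auto)
      also have "\<dots> = (\<Sum>K\<in>X. vol K * ?m K)" using X wI by (intro sum.cong) auto
      finally show ?thesis by (simp add: wI[OF J] W_def)
    qed
    let ?U = "{I. I \<in> F \<and> I \<subseteq> J \<and> (\<forall>K\<in>D. I \<subseteq> K \<longrightarrow> K \<subset> J \<longrightarrow> \<not> S K)}"
    have fU: "finite ?U" using F(1) by auto
    have unst: "sum ?c ?U \<le> (2 * ?m J) powr e * W"
    proof -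
      have "sum ?c ?U \<le> (\<Sum>I\<in>?U. (2 * ?m J) powr e * (vol I * ?m I))"
      proof (rule sum_mono)
        fix I assume I: "I \<in> ?U"
        then have ID: "I \<in> D" using F by auto
        have "?m I \<le> 2 * ?m J"
        proof (cases "I = J")
          case True then show ?thesis using m0[OF J] by simp
        next
          case False
          then have "\<not> S I" using I ID by auto
          then show ?thesis by (simp add: S_def)
        qed
        then have "?m I powr e \<le> (2 * ?m J) powr e" using e m0[OF ID] by (intro powr_mono2) auto
        then have "vol I * ?m I * ?m I powr e \<le> vol I * ?m I * (2 * ?m J) powr e"
          using m0[OF ID] v0[OF ID] by (intro mult_left_mono) auto
        then show "?c I \<le> (2 * ?m J) powr e * (vol I * ?m I)"
          using m0[OF ID] by (cases "?m I = 0") (auto simp: powr_add ac_simps)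
      qed
      also have "\<dots> = (2 * ?m J) powr e * (\<Sum>I\<in>?U. LINT x:I|lebesgue. w x)"
        using F wI by (simp add: sum_distrib_left subset_eq)
      also have "\<dots> \<le> (2 * ?m J) powr e * (LINT x:J|lebesgue. w x)"
      proof (intro mult_left_mono integral_disjoint_le[OF fU])
        show "disjoint ?U" using F(3) by (auto simp: disjoint_def)
      qed (use F J w in auto)
      finally show ?thesis by (simp add: wI[OF J] W_def)
    qed
    let ?N = "2 * 2 ^ CARD('d) :: real"
    have st: "(\<Sum>Q | Q \<in> F \<and> Q \<subseteq> K. ?c Q) \<le> C * ((?N * ?m J) powr e * (vol K * ?m K))" if K: "K \<in> X" for K
    proof -
      have KD: "K \<in> D" using K X by auto
      have KJ: "K \<subset> J" using XS[OF K] by simp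
      \<comment> \<open>The parent of a maximal stopped cube is \<open>J\<close> or unstopped; this
        limits how far the mean can jump.\<close>
      obtain K' s where K': "K' \<in> D" "K = child K' s" using parent[OF KD] by blast
      have KK': "K \<subset> K'" using child_subset[OF K'(1), of s] child_in_D(2)[OF K'(1), of s] K'(2) by auto
      have "?m K' \<le> 2 * ?m J"
      proof (cases "K' = J")
        case True then show ?thesis using m0[OF J] by simp
      next
        case False
        obtain x where "x \<in> K" using D_nonempty[OF KD] by blast
        then have "K' \<inter> J \<noteq> {}" using KK' KJ by auto
        moreover have "\<not> J \<subset> K'"
          using psubset_lev[OF J K'(1)] psubset_lev[OF KD J KJ] child_in_D(2)[OF K'(1), of s] K'(2) by auto
        ultimately have "K' \<subset> J" using D_trichotomy[OF K'(1) J] False by auto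
        then have "\<not> S K'" using XS[OF K] KK' K'(1) by auto
        then show ?thesis by (simp add: S_def)
      qed
      then have a: "2 ^ CARD('d) * ?m K' \<le> 2 ^ CARD('d) * (2 * ?m J)" by (intro mult_left_mono) auto
      have b: "?m K \<le> 2 ^ CARD('d) * ?m K'"
        unfolding K'(2) by (rule mean_child_le[OF K'(1) w(1)[OF K'(1)] w(2)])
      from order.trans[OF b a] have "?m K \<le> ?N * ?m J" by (simp add: ac_simps)
      then have "?m K powr e \<le> (?N * ?m J) powr e" using e m0[OF KD] by (intro powr_mono2) auto
      then have "C * (?m K powr e * (vol K * ?m K)) \<le> C * ((?N * ?m J) powr e * (vol K * ?m K))"
        using C m0[OF KD] v0[OF KD] by (intro mult_left_mono mult_right_mono) auto
      moreover have "(\<Sum>Q | Q \<in> F \<and> Q \<subseteq> K. ?c Q) \<le> C * (?m K powr e * (vol K * ?m K))"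
        by (rule step(2)[OF KD KJ]) (use KJ step(3) in auto)
      ultimately show ?thesis by linarith
    qed
    have W0: "0 \<le> W" using m0[OF J] v0[OF J] by (simp add: W_def)
    have "(\<Sum>Q | Q \<in> F \<and> Q \<subseteq> J. ?c Q) \<le> (2 * ?m J) powr e * W + (\<Sum>K\<in>X. C * ((?N * ?m J) powr e * (vol K * ?m K)))"
      unfolding Xsum by (intro add_mono unst sum_mono st)
    also have "\<dots> = (2 * ?m J) powr e * W + C * (?N * ?m J) powr e * (\<Sum>K\<in>X. vol K * ?m K)"
      by (simp add: sum_distrib_left mult.assoc)
    also have "\<dots> \<le> (2 * ?m J) powr e * W + C * (?N * ?m J) powr e * ((1 - dl) * W)"
      using C XW by (intro add_left_mono mult_left_mono) auto
    also have "\<dots> = (2 powr e + C * (?N powr e * (1 - dl))) * (?m J powr e * W)"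
      using m0[OF J] by (simp add: powr_mult algebra_simps)
    also have "\<dots> \<le> (2 powr e + C * (1 - dl / 2)) * (?m J powr e * W)"
      using C e(2) W0 by (intro mult_right_mono add_left_mono mult_left_mono) auto
    \<comment> \<open>\<open>C\<close> is the fixed point of the recursion: the fraction
      \<open>dl / 2\<close> of it that is lost pays for the unstopped cubes.\<close>
    also have "2 powr e + C * (1 - dl / 2) = C" using dl by (simp add: C_def field_simps)
    finally show ?case by (simp add: W_def)
  qed
  have "{Q. Q \<in> F \<and> Q \<subseteq> J0} = F" using UF by auto
  then show ?thesis using key[OF J0] by (simp add: F_def C_def)
qed

text \<open>The order of the quantifiers matters: \<open>e\<close> and \<open>C\<close> depend on
  \<open>dl\<close> and the dimension only, so one exponent will serve a whole family of
  weights.\<close>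

lemma reverse_Holder:
  assumes dl: "0 < dl" "dl < 1"
  shows "\<exists>e C. 0 < e \<and> 0 < C \<and> (\<forall>w J. w \<in> borel_measurable lebesgue \<longrightarrow> (\<forall>x. 0 \<le> w x) \<longrightarrow>
     (\<forall>I\<in>D. set_integrable lebesgue I w) \<longrightarrow>
     (\<forall>J\<in>D. \<forall>E\<in>sets lebesgue. E \<subseteq> J \<longrightarrow> measure lebesgue E \<le> vol J / 2 \<longrightarrow>
       (LINT x:E|lebesgue. w x) \<le> (1 - dl) * (LINT x:J|lebesgue. w x)) \<longrightarrow> J \<in> D \<longrightarrow>
     (\<integral>\<^sup>+x\<in>J. ennreal (w x powr (1 + e)) \<partial>lebesgue) \<le> ennreal (C * (mean w J powr e * (vol J * mean w J))))"
proof -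
  define N :: real where "N = 2 * 2 ^ CARD('d)"
  have "(1::real) \<le> 2 ^ CARD('d)" by simp
  then have N: "N > 1" unfolding N_def by linarith
  \<comment> \<open>\<open>e\<close> solves \<open>N powr e = k\<close>, which is equality in the
    smallness condition of \<open>reverse_Holder_discrete\<close>.\<close>
  define k where "k = (1 - dl / 2) / (1 - dl)"
  have k: "k > 1" using dl by (simp add: k_def field_simps)
  define e where "e = ln k / ln N"
  have e: "e > 0" using k N by (simp add: e_def)
  have "N powr e = k" using N k by (simp add: e_def powr_def)
  then have e2: "N powr e * (1 - dl) \<le> 1 - dl / 2" using dl by (simp add: k_def)
  show ?thesis
  proof (rule exI[of _ e], rule exI[of _ "2 * 2 powr e / dl"], intro conjI allI impI)
    fix w :: "real^'d \<Rightarrow> real" and J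
    assume w: "w \<in> borel_measurable lebesgue" "\<forall>x. 0 \<le> w x" "\<forall>I\<in>D. set_integrable lebesgue I w"
      and ainf: "\<forall>J\<in>D. \<forall>E\<in>sets lebesgue. E \<subseteq> J \<longrightarrow> measure lebesgue E \<le> vol J / 2 \<longrightarrow>
       (LINT x:E|lebesgue. w x) \<le> (1 - dl) * (LINT x:J|lebesgue. w x)" and J: "J \<in> D"
    show "(\<integral>\<^sup>+x\<in>J. ennreal (w x powr (1 + e)) \<partial>lebesgue) \<le> ennreal (2 * 2 powr e / dl * (mean w J powr e * (vol J * mean w J)))"
    proof (rule nn_integral_le_cexp[OF J w(1)])
      fix n
      have "(LINT x:J|lebesgue. cexp J n w x powr (1 + e)) = (\<Sum>Q\<in>slice J n. vol Q * mean w Q powr (1 + e))"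
        by (rule cexp_integral[OF J, of "\<lambda>t. t powr (1 + e)"])
      also have "\<dots> \<le> 2 * 2 powr e / dl * (mean w J powr e * (vol J * mean w J))"
        by (rule reverse_Holder_discrete[OF _ _ dl _ e e2[unfolded N_def] J]) (use w ainf in auto)
      finally show "(LINT x:J|lebesgue. cexp J n w x powr (1 + e)) \<le> 2 * 2 powr e / dl * (mean w J powr e * (vol J * mean w J))" .
    qed (use w J e in auto)
  qed (use e dl in auto)
qed

end

section \<open>Dual pairs of matrix weights\<close>

text \<open>In the application \<open>P = W\<^bsup>1/p\<^esup>\<close>, \<open>Q = W\<^bsup>-1/p\<^esup>\<close>, and \<open>V\<close>, \<open>Vd\<close> are the reducing operators of
  \<open>W\<close> and of the dual weight. The matrix \<open>A\<^sub>p\<close> condition enters only through the bound on \<open>V I ** Vd I\<close>,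
  which makes the whole situation symmetric.\<close>

locale weight_pair = grid D for D :: "(real^'d) set set" +
  fixes p q :: real and P Q :: "real^'d \<Rightarrow> complex^'n^'n" and V Vd :: "(real^'d) set \<Rightarrow> complex^'n^'n" and c :: real
  assumes p: "1 < p" and q: "1 < q" and pq: "1 / p + 1 / q = 1" and c: "1 \<le> c"
    and Pm: "P \<in> borel_measurable lebesgue" and Qm: "Q \<in> borel_measurable lebesgue"
    and Ps: "\<And>x. mat_adj (P x) = P x" and Qs: "\<And>x. mat_adj (Q x) = Q x"
    and PQ: "\<And>x. P x ** Q x = mat 1" and QP: "\<And>x. Q x ** P x = mat 1"
    and Vp: "\<And>I. I \<in> D \<Longrightarrow> posdef (V I)" and Vdp: "\<And>I. I \<in> D \<Longrightarrow> posdef (Vd I)"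
    and Pi: "\<And>I e. I \<in> D \<Longrightarrow> set_integrable lebesgue I (\<lambda>x. norm (P x *v e) powr p)"
    and Qi: "\<And>I e. I \<in> D \<Longrightarrow> set_integrable lebesgue I (\<lambda>x. norm (Q x *v e) powr q)"
    and P_le: "\<And>I e. I \<in> D \<Longrightarrow> (LINT x:I|lebesgue. norm (P x *v e) powr p) \<le> c * (vol I * norm (V I *v e) powr p)"
    and P_ge: "\<And>I e. I \<in> D \<Longrightarrow> vol I * norm (V I *v e) powr p \<le> c * (LINT x:I|lebesgue. norm (P x *v e) powr p)"
    and Q_le: "\<And>I e. I \<in> D \<Longrightarrow> (LINT x:I|lebesgue. norm (Q x *v e) powr q) \<le> c * (vol I * norm (Vd I *v e) powr q)"
    and Q_ge: "\<And>I e. I \<in> D \<Longrightarrow> vol I * norm (Vd I *v e) powr q \<le> c * (LINT x:I|lebesgue. norm (Q x *v e) powr q)"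
    and VV: "\<And>I. I \<in> D \<Longrightarrow> mnorm (V I ** Vd I) \<le> c"
begin

lemma VdV: "I \<in> D \<Longrightarrow> mnorm (Vd I ** V I) \<le> c"
  using VV[of I] mnorm_mat_adj[of "V I ** Vd I"] posdef_adj[OF Vp, of I] posdef_adj[OF Vdp, of I]
  by (simp add: mat_adj_mult)

lemma dual: "weight_pair D q p Q P Vd V c"
  by unfold_locales (use p q pq c Pm Qm Ps Qs PQ QP Vp Vdp Pi Qi P_le P_ge Q_le Q_ge VdV in \<open>auto simp: add.commute\<close>)

lemma matvec_measurable:
  fixes M :: "real^'d \<Rightarrow> complex^'n^'n" and f :: "real^'d \<Rightarrow> complex^'n"
  assumes "M \<in> borel_measurable lebesgue" "f \<in> borel_measurable lebesgue"
  shows "(\<lambda>x. M x *v f x) \<in> borel_measurable lebesgue"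
proof -
  have "continuous_on UNIV (\<lambda>z :: (complex^'n^'n) \<times> (complex^'n). fst z *v snd z)"
    unfolding matrix_vector_mult_def
    by (intro continuous_on_vec_lambda continuous_intros continuous_on_component)
  then have "(\<lambda>z :: (complex^'n^'n) \<times> (complex^'n). fst z *v snd z) \<in> borel_measurable borel"
    by (rule borel_measurable_continuous_onI)
  from measurable_compose[OF borel_measurable_Pair[OF assms] this] show ?thesis by simp
qed

lemma Pe_measurable [measurable]: "(\<lambda>x. P x *v e) \<in> borel_measurable lebesgue"
  by (rule matvec_measurable[OF Pm]) simp

lemma Qe_measurable [measurable]: "(\<lambda>x. Q x *v e) \<in> borel_measurable lebesgue"
  by (rule matvec_measurable[OF Qm]) simp

abbreviation "Vi I \<equiv> matrix_inv (V I)"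

lemma inv_mult:
  assumes "I \<in> D" shows "V I *v (Vi I *v u) = u" "Vi I *v (V I *v u) = u"
  using posdef_mult_inv[OF Vp[OF assms]] by auto

lemma Vi_inner: "I \<in> D \<Longrightarrow> (Vi I *v u) \<bullet> v = u \<bullet> (Vi I *v v)"
  by (metis Vp inner_mat_adj posdef_inverse(3))

lemma pairing: "(Q x *v e) \<bullet> (P x *v y) = e \<bullet> y"
proof -
  have "(Q x *v e) \<bullet> (P x *v y) = e \<bullet> (Q x *v (P x *v y))"
    using inner_mat_adj[of "Q x" e "P x *v y"] by (simp add: Qs)
  then show ?thesis by (simp add: matrix_vector_mul_assoc QP)
qed

text \<open>A duality estimate: by \<open>pairing\<close> a fixed number is bounded pointwise by
  \<open>norm (Q x *v e) * norm (P x *v y)\<close>, and Hoelder's inequality separates the factors.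
  A general subset \<open>E\<close> is allowed because \<open>E\<close> will be half of a cube in
  the proof of the A-infinity property.\<close>

lemma inverse_lower:
  assumes J: "J \<in> D" and E: "E \<in> sets lebesgue" "E \<subseteq> J"
  shows "norm (Vi J *v e) * measure lebesgue E
    \<le> (c * vol J) powr (1 / p) * (LINT x:E|lebesgue. norm (Q x *v e) powr q) powr (1 / q)"
proof -
  define u where "u = Vi J *v e"
  have Elm: "E \<in> lmeasurable" by (rule fmeasurableI2[OF D_lmeasurable[OF J] E(2,1)])
  show ?thesis
  proof (cases "u = 0")
    case False
    \<comment> \<open>The unit vector \<open>z\<close> points along \<open>u\<close>; then
      \<open>y\<close> pairs with \<open>e\<close> to \<open>norm u\<close>, and
      \<open>V J *v y\<close> is the unit vector \<open>z\<close>, so \<open>P_le\<close> bounds the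
      integral of \<open>norm (P x *v y) powr p\<close> by \<open>c * vol J\<close>.\<close>
    define z where "z = u /\<^sub>R norm u"
    define y where "y = Vi J *v z"
    have z: "norm z = 1" using False by (simp add: z_def)
    have ey: "e \<bullet> y = norm u"
      using False unfolding y_def Vi_inner[OF J, symmetric] u_def[symmetric] z_def
      by (simp add: power2_norm_eq_inner[symmetric] power2_eq_square)
    define f where "f x = indicator E x * norm (P x *v y)" for x
    define g where "g x = indicator E x * norm (Q x *v e)" for x
    note [measurable] = E(1)
    have fp: "f x powr p = indicator E x *\<^sub>R norm (P x *v y) powr p" for x
      using p by (auto simp: f_def indicator_def)
    have gq: "g x powr q = indicator E x *\<^sub>R norm (Q x *v e) powr q" for x
      using q by (auto simp: g_def indicator_def)
    have ifp: "integrable lebesgue (\<lambda>x. f x powr p)" unfolding fp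
      using set_integrable_subset[OF Pi[OF J] E] by (simp add: set_integrable_def)
    have igq: "integrable lebesgue (\<lambda>x. g x powr q)" unfolding gq
      using set_integrable_subset[OF Qi[OF J] E] by (simp add: set_integrable_def)
    have fm: "f \<in> borel_measurable lebesgue" "g \<in> borel_measurable lebesgue"
      unfolding f_def g_def by measurable
    have nn: "0 \<le> f x" "0 \<le> g x" for x by (auto simp: f_def g_def)
    note H = Holder_integral[OF p q pq fm nn ifp igq]
    have "norm u * measure lebesgue E = (\<integral>x. indicator E x * norm u \<partial>lebesgue)"
      using Elm by (simp add: fmeasurable_def)
    also have "\<dots> \<le> (\<integral>x. f x * g x \<partial>lebesgue)"
    proof (rule integral_mono[OF _ H(1)])
      show "integrable lebesgue (\<lambda>x. indicator E x * norm u)"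
        using Elm by (intro integrable_mult_left) (auto simp: fmeasurable_def)
      fix x
      have "norm u \<le> norm (Q x *v e) * norm (P x *v y)"
        using norm_cauchy_schwarz[of "Q x *v e" "P x *v y"] by (simp add: pairing ey)
      then show "indicator E x * norm u \<le> f x * g x" by (auto simp: f_def g_def indicator_def mult.commute)
    qed
    also note H(2)
    also have "(\<integral>x. f x powr p \<partial>lebesgue) powr (1/p) * (\<integral>x. g x powr q \<partial>lebesgue) powr (1/q) \<le>
       (c * vol J) powr (1/p) * (\<integral>x. g x powr q \<partial>lebesgue) powr (1/q)"
    proof (intro mult_right_mono powr_mono2)
      have "(\<integral>x. f x powr p \<partial>lebesgue) \<le> (LINT x:J|lebesgue. norm (P x *v y) powr p)"
        unfolding set_lebesgue_integral_def
        by (rule integral_mono[OF ifp]) (use Pi[OF J, of y] E(2) in \<open>auto simp: set_integrable_def fp indicator_def\<close>)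
      also have "\<dots> \<le> c * (vol J * norm (V J *v y) powr p)" by (rule P_le[OF J])
      also have "\<dots> = c * vol J" unfolding y_def inv_mult(1)[OF J] z by simp
      finally show "(\<integral>x. f x powr p \<partial>lebesgue) \<le> c * vol J" .
    qed (use p in \<open>auto intro!: integral_nonneg_AE\<close>)
    finally show ?thesis by (simp add: gq set_lebesgue_integral_def u_def)
  next
    case True
    then show ?thesis by (simp add: u_def)
  qed
qed

lemma inverse_lower_powr:
  assumes J: "J \<in> D" and E: "E \<in> sets lebesgue" "E \<subseteq> J" "vol J \<le> 2 * measure lebesgue E"
  shows "vol J * norm (Vi J *v e) powr q \<le> 2 powr q * c powr (q / p) * (LINT x:E|lebesgue. norm (Q x *v e) powr q)"
proof -
  let ?X = "LINT x:E|lebesgue. norm (Q x *v e) powr q"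
  let ?u = "norm (Vi J *v e)"
  have v: "vol J > 0" by (rule D_vol_pos[OF J])
  have X: "0 \<le> ?X" unfolding set_lebesgue_integral_def by (intro integral_nonneg_AE) auto
  have e1: "1 - 1 / p = 1 / q" using pq by simp
  have "?u * vol J \<le> ?u * (2 * measure lebesgue E)" by (rule mult_left_mono[OF E(3)]) simp
  also have "\<dots> \<le> 2 * ((c * vol J) powr (1 / p) * ?X powr (1 / q))" using inverse_lower[OF J E(1,2), of e] by simp
  also have "\<dots> = vol J powr (1 / p) * (2 * c powr (1/p) * ?X powr (1/q))"
    using c v by (simp add: powr_mult)
  finally have "?u * (vol J / vol J powr (1 / p)) \<le> 2 * c powr (1/p) * ?X powr (1/q)"
    using v by (simp add: field_simps)
  also have "vol J / vol J powr (1 / p) = vol J powr (1 / q)"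
    unfolding e1[symmetric] using v by (simp add: powr_diff)
  finally have "(?u * vol J powr (1 / q)) powr q \<le> (2 * c powr (1/p) * ?X powr (1/q)) powr q"
    using q by (intro powr_mono2) auto
  then show ?thesis using q v X c by (simp add: powr_mult powr_powr mult.commute)
qed

lemma inverse_le_dual:
  assumes J: "J \<in> D"
  shows "norm (Vi J *v e) \<le> 2 * c powr (1/p) * c powr (1/q) * norm (Vd J *v e)"
proof -
  have v: "vol J > 0" by (rule D_vol_pos[OF J])
  have "vol J * norm (Vi J *v e) powr q \<le> 2 powr q * c powr (q / p) * (LINT x:J|lebesgue. norm (Q x *v e) powr q)"
    by (rule inverse_lower_powr[OF J]) (use J v in \<open>auto simp: vol_def\<close>)
  also have "\<dots> \<le> 2 powr q * c powr (q / p) * (c * (vol J * norm (Vd J *v e) powr q))"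
    by (intro mult_left_mono Q_le[OF J]) auto
  finally have "vol J * norm (Vi J *v e) powr q \<le> vol J * (2 powr q * c powr (q / p) * c * norm (Vd J *v e) powr q)"
    by (simp add: ac_simps)
  then have "norm (Vi J *v e) powr q \<le> 2 powr q * c powr (q / p) * c * norm (Vd J *v e) powr q" using v by simp
  then have "(norm (Vi J *v e) powr q) powr (1/q) \<le> (2 powr q * c powr (q / p) * c * norm (Vd J *v e) powr q) powr (1/q)"
    using q by (intro powr_mono2) auto
  then show ?thesis using q c by (simp add: powr_mult powr_powr)
qed

text \<open>The converse comparison to \<open>inverse_le_dual\<close>, and the half that uses the
  bound coming from the matrix A_p condition.\<close>

lemma dual_le_inverse:
  assumes J: "J \<in> D" shows "norm (Vd J *v e) \<le> c * norm (Vi J *v e)"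
proof -
  have "norm (Vd J *v e) = norm ((Vd J ** V J) *v (Vi J *v e))"
    by (simp add: matrix_vector_mul_assoc[symmetric] inv_mult[OF J])
  also have "\<dots> \<le> mnorm (Vd J ** V J) * norm (Vi J *v e)" by (rule mnorm_ge)
  also have "\<dots> \<le> c * norm (Vi J *v e)" by (intro mult_right_mono VdV J) auto
  finally show ?thesis .
qed

lemma Q_inverse_le:
  assumes J: "J \<in> D"
  shows "(LINT x:J|lebesgue. norm (Q x *v e) powr q) \<le> c * c powr q * (vol J * norm (Vi J *v e) powr q)"
proof -
  have "(LINT x:J|lebesgue. norm (Q x *v e) powr q) \<le> c * (vol J * norm (Vd J *v e) powr q)" by (rule Q_le[OF J])
  also have "\<dots> \<le> c * (vol J * (c * norm (Vi J *v e)) powr q)"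
    using dual_le_inverse[OF J] D_vol_pos[OF J] c q by (intro mult_left_mono powr_mono2) auto
  finally show ?thesis using c by (simp add: powr_mult ac_simps)
qed

text \<open>The integral over \<open>J\<close> is bounded by \<open>norm (Vi J *v e) powr q\<close>
  times the volume, and this in turn by the integral over any set of at least half the volume, such
  as \<open>J - E\<close>. So \<open>J - E\<close> carries a fixed fraction \<open>1 / K\<close> of
  the weight, the same for all \<open>e\<close>.\<close>

lemma A_infinity:
  "\<exists>dl. 0 < dl \<and> dl < 1 \<and> (\<forall>e. \<forall>J\<in>D. \<forall>E\<in>sets lebesgue. E \<subseteq> J \<longrightarrow> measure lebesgue E \<le> vol J / 2 \<longrightarrow>
     (LINT x:E|lebesgue. norm (Q x *v e) powr q) \<le> (1 - dl) * (LINT x:J|lebesgue. norm (Q x *v e) powr q))"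
proof -
  define K where "K = c * c powr q * (2 powr q * c powr (q / p))"
  have "1 \<le> c powr q" "1 \<le> c powr (q / p)" using c p q by (auto intro!: ge_one_powr_ge_zero)
  moreover have "1 < 2 powr q" using q by simp
  ultimately have "1 * 1 * (1 * 1) < K" unfolding K_def using c
    by (intro mult_le_less_imp_less mult_mono mult_less_le_imp_less) auto
  then have K: "1 < K" by simp
  show ?thesis
  proof (rule exI[of _ "1 / K"], intro conjI allI ballI impI)
    show "0 < 1 / K" "1 / K < 1" using K by auto
    fix e J E assume J: "J \<in> D" and E: "E \<in> sets lebesgue" "E \<subseteq> J" "measure lebesgue E \<le> vol J / 2"
    let ?w = "\<lambda>x. norm (Q x *v e) powr q"
    have JE: "J - E \<in> sets lebesgue" using J E by auto
    have "measure lebesgue (J - E) = measure lebesgue J - measure lebesgue E"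
      by (rule measurable_measure_Diff[OF D_lmeasurable[OF J] E(1,2)])
    then have m: "vol J \<le> 2 * measure lebesgue (J - E)" using E(3) by (simp add: vol_def)
    have "(LINT x:J|lebesgue. ?w x) \<le> c * c powr q * (vol J * norm (Vi J *v e) powr q)" by (rule Q_inverse_le[OF J])
    also have "\<dots> \<le> c * c powr q * (2 powr q * c powr (q / p) * (LINT x:J - E|lebesgue. ?w x))"
      using c by (intro mult_left_mono inverse_lower_powr[OF J JE _ m]) auto
    also have "\<dots> = K * (LINT x:J - E|lebesgue. ?w x)" by (simp add: K_def)
    finally have 1: "(LINT x:J|lebesgue. ?w x) / K \<le> (LINT x:J - E|lebesgue. ?w x)" using K by (simp add: field_simps)
    have Jeq: "(J - E) \<union> E = J" by (subst Un_commute) (rule Diff_partition[OF E(2)])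
    have "(LINT x:(J - E) \<union> E|lebesgue. ?w x) = (LINT x:J - E|lebesgue. ?w x) + (LINT x:E|lebesgue. ?w x)"
      by (rule set_integral_Un) (use Qi[OF J, of e] JE E in \<open>auto intro: set_integrable_subset\<close>)
    with 1 show "(LINT x:E|lebesgue. ?w x) \<le> (1 - 1 / K) * (LINT x:J|lebesgue. ?w x)"
      unfolding Jeq by (simp add: left_diff_distrib)
  qed
qed

text \<open>Applies reverse Hoelder to the scalar weights of the vectors
  \<open>V J *v axis k 1\<close>, for which the mean over \<open>J\<close> is bounded by an absolute
  constant. The weight changes with \<open>J\<close>, which is why the exponent had to be
  uniform.\<close>

lemma Q_higher_integrability:
  "\<exists>e C. 0 < e \<and> 0 < C \<and> (\<forall>J\<in>D. \<forall>k.
     (\<integral>\<^sup>+x\<in>J. ennreal (norm (Q x *v (V J *v axis k 1)) powr (q * (1 + e))) \<partial>lebesgue) \<le> ennreal (C * vol J))"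
proof -
  obtain dl where dl: "0 < dl" "dl < 1" and ai: "\<And>e J E. J \<in> D \<Longrightarrow> E \<in> sets lebesgue \<Longrightarrow> E \<subseteq> J \<Longrightarrow> measure lebesgue E \<le> vol J / 2 \<Longrightarrow>
     (LINT x:E|lebesgue. norm (Q x *v e) powr q) \<le> (1 - dl) * (LINT x:J|lebesgue. norm (Q x *v e) powr q)"
    using A_infinity by blast
  obtain e C where e: "0 < e" "0 < C" and R: "\<And>w J. w \<in> borel_measurable lebesgue \<Longrightarrow> (\<forall>x. 0 \<le> w x) \<Longrightarrow>
     (\<forall>I\<in>D. set_integrable lebesgue I w) \<Longrightarrow>
     (\<forall>J\<in>D. \<forall>E\<in>sets lebesgue. E \<subseteq> J \<longrightarrow> measure lebesgue E \<le> vol J / 2 \<longrightarrow>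
       (LINT x:E|lebesgue. w x) \<le> (1 - dl) * (LINT x:J|lebesgue. w x)) \<Longrightarrow> J \<in> D \<Longrightarrow>
     (\<integral>\<^sup>+x\<in>J. ennreal (w x powr (1 + e)) \<partial>lebesgue) \<le> ennreal (C * (mean w J powr e * (vol J * mean w J)))"
    using reverse_Holder[OF dl] by blast
  define K where "K = c * c powr q"
  have K: "K > 0" using c by (simp add: K_def)
  show ?thesis
  proof (rule exI[of _ e], rule exI[of _ "C * (K powr e * K)"], intro conjI ballI allI)
    fix J k assume J: "J \<in> D"
    define u :: "complex^'n" where "u = V J *v axis k 1"
    let ?w = "\<lambda>x. norm (Q x *v u) powr q"
    have v: "vol J > 0" by (rule D_vol_pos[OF J])
    have m0: "0 \<le> mean ?w J" by (rule mean_nonneg[OF J]) simp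
    have "(LINT x:J|lebesgue. ?w x) \<le> K * vol J"
      using Q_inverse_le[OF J, of u] by (simp add: u_def inv_mult[OF J] K_def)
    then have "mean ?w J \<le> K" using v by (simp add: mean_def field_simps)
    then have "mean ?w J powr e * (vol J * mean ?w J) \<le> K powr e * (vol J * K)"
      using m0 v e by (intro mult_mono powr_mono2) auto
    then have le: "C * (mean ?w J powr e * (vol J * mean ?w J)) \<le> C * (K powr e * K) * vol J"
      using e by (simp add: ac_simps)
    have "(\<integral>\<^sup>+x\<in>J. ennreal (?w x powr (1 + e)) \<partial>lebesgue) \<le> ennreal (C * (mean ?w J powr e * (vol J * mean ?w J)))"
      by (rule R) (use J Qi ai in auto)
    also have "\<dots> \<le> ennreal (C * (K powr e * K) * vol J)" by (rule ennreal_leI[OF le])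
    finally show "(\<integral>\<^sup>+x\<in>J. ennreal (norm (Q x *v (V J *v axis k 1)) powr (q * (1 + e))) \<partial>lebesgue) \<le> ennreal (C * (K powr e * K) * vol J)"
      by (simp add: powr_powr u_def)
  qed (use e K in auto)
qed

section \<open>The maximal function of the weighted averages\<close>

definition coef :: "(real^'d \<Rightarrow> complex^'n) \<Rightarrow> (real^'d) set \<Rightarrow> complex^'n" where
  "coef f I = avg I (\<lambda>x. Q x *v f x)"

text \<open>\<open>V I ** Q x\<close> has the norm of its adjoint \<open>Q x ** V I\<close>, whose
  columns are the vectors covered by \<open>Q_higher_integrability\<close>.\<close>

lemma coef_norm_le:
  fixes f :: "real^'d \<Rightarrow> complex^'n"
  assumes I: "I \<in> D" and i: "set_integrable lebesgue I (\<lambda>x. \<Sum>k\<in>UNIV. norm (Q x *v (V I *v axis k 1)) * norm (f x))"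
  shows "norm (V I *v coef f I) \<le> mean (\<lambda>x. \<Sum>k\<in>UNIV. norm (Q x *v (V I *v axis k 1)) * norm (f x)) I"
proof (cases "set_integrable lebesgue I (\<lambda>x. Q x *v f x)")
  case True
  have bl: "bounded_linear ((*v) (V I))" by simp
  have v: "vol I > 0" by (rule D_vol_pos[OF I])
  have ii: "integrable lebesgue (\<lambda>x. indicator I x *\<^sub>R (Q x *v f x))" using True by (simp add: set_integrable_def)
  have "V I *v coef f I = (1 / vol I) *\<^sub>R (V I *v (\<integral>x. indicator I x *\<^sub>R (Q x *v f x) \<partial>lebesgue))"
    by (simp add: coef_def avg_def set_lebesgue_integral_def linear_scale[OF matrix_vector_mul_linear])
  also have "V I *v (\<integral>x. indicator I x *\<^sub>R (Q x *v f x) \<partial>lebesgue) = (\<integral>x. V I *v (indicator I x *\<^sub>R (Q x *v f x)) \<partial>lebesgue)"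
    by (rule integral_bounded_linear[OF bl ii, symmetric])
  finally have eq: "norm (V I *v coef f I) = norm (\<integral>x. V I *v (indicator I x *\<^sub>R (Q x *v f x)) \<partial>lebesgue) / vol I"
    using v by simp
  have "norm (\<integral>x. V I *v (indicator I x *\<^sub>R (Q x *v f x)) \<partial>lebesgue) \<le> (\<integral>x. norm (V I *v (indicator I x *\<^sub>R (Q x *v f x))) \<partial>lebesgue)"
    by (rule integral_norm_bound)
  also have "\<dots> \<le> (\<integral>x. indicator I x *\<^sub>R (\<Sum>k\<in>UNIV. norm (Q x *v (V I *v axis k 1)) * norm (f x)) \<partial>lebesgue)"
  proof (rule integral_mono)
    show "integrable lebesgue (\<lambda>x. norm (V I *v (indicator I x *\<^sub>R (Q x *v f x))))"
      by (rule integrable_norm[OF integrable_bounded_linear[OF bl ii]])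
    show "integrable lebesgue (\<lambda>x. indicator I x *\<^sub>R (\<Sum>k\<in>UNIV. norm (Q x *v (V I *v axis k 1)) * norm (f x)))"
      using i by (simp add: set_integrable_def)
    fix x
    have "norm (V I *v (Q x *v f x)) \<le> mnorm (V I ** Q x) * norm (f x)"
      by (metis matrix_vector_mul_assoc mnorm_ge)
    also have "mnorm (V I ** Q x) = mnorm (Q x ** V I)"
      using mnorm_mat_adj[of "V I ** Q x"] posdef_adj[OF Vp[OF I]] Qs[of x] by (simp add: mat_adj_mult)
    also have "\<dots> * norm (f x) \<le> (\<Sum>k\<in>UNIV. norm ((Q x ** V I) *v axis k 1)) * norm (f x)"
      by (intro mult_right_mono mnorm_le_sum) auto
    also have "\<dots> = (\<Sum>k\<in>UNIV. norm (Q x *v (V I *v axis k 1)) * norm (f x))"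
      by (simp add: matrix_vector_mul_assoc sum_distrib_right)
    finally show "norm (V I *v (indicator I x *\<^sub>R (Q x *v f x))) \<le> indicator I x *\<^sub>R (\<Sum>k\<in>UNIV. norm (Q x *v (V I *v axis k 1)) * norm (f x))"
      by (auto simp: indicator_def)
  qed
  finally show ?thesis unfolding eq mean_def set_lebesgue_integral_def using v by (simp add: divide_inverse mult.commute)
next
  \<comment> \<open>The average is defined by a Bochner integral; without integrability its default
    value 0 makes the claim trivial.\<close>
  case False
  then have "coef f I = 0" unfolding coef_def avg_def set_lebesgue_integral_def set_integrable_def
    by (simp add: not_integrable_integral_eq)
  then show ?thesis using mean_nonneg[OF I, of "\<lambda>x. \<Sum>k\<in>UNIV. norm (Q x *v (V I *v axis k 1)) * norm (f x)"]
    by (simp add: sum_nonneg)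
qed

text \<open>On the weight the exponent is \<open>s > q\<close>, so its conjugate \<open>r\<close> is
  below \<open>p\<close>. The averages are then controlled by means of
  \<open>norm (f x) powr r\<close>, to which Doob's inequality applies at the exponent
  \<open>t = p / r > 1\<close>.\<close>

lemma maximal_bound:
  "\<exists>C\<ge>0. \<forall>f :: real^'d \<Rightarrow> complex^'n. f \<in> borel_measurable lebesgue \<longrightarrow> integrable lebesgue (\<lambda>x. norm (f x) powr p) \<longrightarrow>
     (\<forall>F. finite F \<longrightarrow> F \<subseteq> D \<longrightarrow>
       (\<integral>x. gmax F (\<lambda>I. norm (V I *v coef f I)) x powr p \<partial>lebesgue) \<le> C * (\<integral>x. norm (f x) powr p \<partial>lebesgue))"
proof -
  obtain e C where e: "0 < e" "0 < C" and hi: "\<And>J k. J \<in> D \<Longrightarrow>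
     (\<integral>\<^sup>+x\<in>J. ennreal (norm (Q x *v (V J *v axis k 1)) powr (q * (1 + e))) \<partial>lebesgue) \<le> ennreal (C * vol J)"
    using Q_higher_integrability by blast
  define s where "s = q * (1 + e)"
  have s: "q < s" "1 < s" using q e by (auto simp: s_def less_1_mult)
  define r where "r = s / (s - 1)"
  have r: "1 < r" "1 / s + 1 / r = 1" using s by (auto simp: r_def field_simps)
  have "1 / s < 1 / q" using s q by (intro divide_strict_left_mono) auto
  then have "1 / p < 1 / r" using r(2) pq by linarith
  then have rp: "r < p" using r p by (simp add: divide_less_cancel frac_less2 field_simps)
  define n where "n = real CARD('n)"
  define K where "K = n * C powr (1 / s)"
  have K: "0 \<le> K" by (simp add: K_def n_def)
  define t where "t = p / r"
  have t: "1 < t" using rp r by (simp add: t_def)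
  show ?thesis
  proof (rule exI[of _ "K powr p * (t / (t - 1)) powr t"], intro conjI allI impI)
    fix f :: "real^'d \<Rightarrow> complex^'n" and F
    assume fm [measurable]: "f \<in> borel_measurable lebesgue" and fp: "integrable lebesgue (\<lambda>x. norm (f x) powr p)"
      and F: "finite F" "F \<subseteq> D"
    define \<phi> where "\<phi> x = norm (f x) powr r" for x
    have \<phi>t: "\<phi> x powr t = norm (f x) powr p" for x using r by (simp add: \<phi>_def powr_powr t_def)
    have \<phi>m [measurable]: "\<phi> \<in> borel_measurable lebesgue" unfolding \<phi>_def by measurable
    have \<phi>i: "set_integrable lebesgue I \<phi>" if I: "I \<in> D" for I
    proof (rule set_integrable_bound)
      show "set_integrable lebesgue I (\<lambda>x. 1 + norm (f x) powr p)"
        using I fp by (intro set_integral_add(1)) (auto intro!: set_integrable_D)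
      show "set_borel_measurable lebesgue I \<phi>"
        using I by (auto simp: set_borel_measurable_def)
      have "\<phi> x \<le> 1 + norm (f x) powr p" for x
      proof (cases "norm (f x) \<le> 1")
        case True
        then have "\<phi> x \<le> 1 powr r" unfolding \<phi>_def using r by (intro powr_mono2) auto
        moreover have "0 \<le> norm (f x) powr p" by simp
        ultimately show ?thesis unfolding powr_one_eq_one by linarith
      next
        case False
        then have "\<phi> x \<le> norm (f x) powr p" unfolding \<phi>_def using rp by (intro powr_mono) auto
        then show ?thesis by simp
      qed
      then show "AE x in lebesgue. x \<in> I \<longrightarrow> norm (\<phi> x) \<le> norm (1 + norm (f x) powr p)"
        by (auto simp: \<phi>_def)
    qed
    have gI: "norm (V I *v coef f I) \<le> K * mean \<phi> I powr (1 / r)" if I: "I \<in> D" for I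
    proof -
      have v: "vol I > 0" by (rule D_vol_pos[OF I])
      have one: "set_integrable lebesgue I (\<lambda>x. norm (Q x *v (V I *v axis k 1)) * norm (f x)) \<and>
         (LINT x:I|lebesgue. norm (Q x *v (V I *v axis k 1)) * norm (f x)) \<le> (C * vol I) powr (1/s) * (vol I * mean \<phi> I) powr (1/r)" for k
      proof -
        define a where "a x = indicator I x * norm (Q x *v (V I *v axis k 1))" for x
        define b where "b x = indicator I x * norm (f x)" for x
        note [measurable] = D_sets[OF I]
        have am: "a \<in> borel_measurable lebesgue" "b \<in> borel_measurable lebesgue" unfolding a_def b_def by measurable
        have nn: "0 \<le> a x" "0 \<le> b x" for x by (auto simp: a_def b_def)
        have as: "a x powr s = norm (Q x *v (V I *v axis k 1)) powr s * indicator I x" for x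
          using s by (auto simp: a_def indicator_def)
        have br: "b x powr r = indicator I x *\<^sub>R \<phi> x" for x
          using r by (auto simp: b_def indicator_def \<phi>_def)
        have eas: "ennreal (a x powr s) = ennreal (norm (Q x *v (V I *v axis k 1)) powr (q * (1 + e))) * indicator I x" for x
          unfolding as unfolding s_def by (cases "x \<in> I") auto
        have nna: "(\<integral>\<^sup>+x. ennreal (a x powr s) \<partial>lebesgue) \<le> ennreal (C * vol I)"
          unfolding eas by (rule hi[OF I])
        have ia: "integrable lebesgue (\<lambda>x. a x powr s)"
          using am nna by (intro integrableI_nonneg) (auto intro: le_less_trans)
        have ib: "integrable lebesgue (\<lambda>x. b x powr r)"
          unfolding br using \<phi>i[OF I] by (simp add: set_integrable_def)
        have ea: "(\<integral>x. a x powr s \<partial>lebesgue) \<le> C * vol I"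
          using nna nn_integral_eq_integral[OF ia] e v by (simp add: ennreal_le_iff)
        have eb: "(\<integral>x. b x powr r \<partial>lebesgue) = vol I * mean \<phi> I"
          unfolding br using mean_mult[OF I, of \<phi>] by (simp add: set_lebesgue_integral_def)
        note H = Holder_integral[OF s(2) r am nn ia ib]
        have ab: "a x * b x = indicator I x *\<^sub>R (norm (Q x *v (V I *v axis k 1)) * norm (f x))" for x
          by (auto simp: a_def b_def indicator_def)
        have "(\<integral>x. a x * b x \<partial>lebesgue) \<le> (C * vol I) powr (1/s) * (vol I * mean \<phi> I) powr (1/r)"
          using H(2) unfolding eb
          by (rule order.trans) (use ea s in \<open>auto intro!: mult_right_mono powr_mono2 integral_nonneg_AE\<close>)
        with H(1) show ?thesis unfolding ab by (simp add: set_integrable_def set_lebesgue_integral_def)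
      qed
      have i: "set_integrable lebesgue I (\<lambda>x. \<Sum>k\<in>UNIV. norm (Q x *v (V I *v axis k 1)) * norm (f x))"
        using one unfolding set_integrable_def scaleR_sum_right by (intro Bochner_Integration.integrable_sum) auto
      have "norm (V I *v coef f I) \<le> mean (\<lambda>x. \<Sum>k\<in>UNIV. norm (Q x *v (V I *v axis k 1)) * norm (f x)) I"
        by (rule coef_norm_le[OF I i])
      also have "\<dots> = (\<Sum>k\<in>UNIV. LINT x:I|lebesgue. norm (Q x *v (V I *v axis k 1)) * norm (f x)) / vol I"
        using one unfolding mean_def set_lebesgue_integral_def set_integrable_def scaleR_sum_right
        by (subst Bochner_Integration.integral_sum) (auto simp: divide_inverse mult.commute)
      also have "\<dots> \<le> (\<Sum>k\<in>(UNIV :: 'n set). (C * vol I) powr (1/s) * (vol I * mean \<phi> I) powr (1/r)) / vol I"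
        using one v by (intro divide_right_mono sum_mono) auto
      also have "\<dots> = K * mean \<phi> I powr (1 / r) * (vol I powr (1/s) * vol I powr (1/r) / vol I)"
        using v e mean_nonneg[OF I, of \<phi>] by (simp add: K_def n_def powr_mult \<phi>_def)
      also have "vol I powr (1/s) * vol I powr (1/r) / vol I = 1"
        using v r by (simp add: powr_add[symmetric])
      finally show ?thesis by simp
    qed
    have pt: "gmax F (\<lambda>I. norm (V I *v coef f I)) x powr p \<le> K powr p * gmax F (mean \<phi>) x powr t" for x
    proof -
      have "gmax F (\<lambda>I. norm (V I *v coef f I)) x \<le> K * gmax F (mean \<phi>) x powr (1 / r)"
      proof (rule gmax_le[OF F(1)])
        fix I assume I: "I \<in> F" "x \<in> I"
        then have ID: "I \<in> D" using F by auto
        have "mean \<phi> I powr (1 / r) \<le> gmax F (mean \<phi>) x powr (1 / r)"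
          using gmax_ge[OF F(1) I, of "mean \<phi>"] mean_nonneg[OF ID, of \<phi>] r by (intro powr_mono2) (auto simp: \<phi>_def)
        then show "norm (V I *v coef f I) \<le> K * gmax F (mean \<phi>) x powr (1 / r)"
          using gI[OF ID] K by (meson mult_left_mono order.trans)
      qed (use K in auto)
      then have "gmax F (\<lambda>I. norm (V I *v coef f I)) x powr p \<le> (K * gmax F (mean \<phi>) x powr (1 / r)) powr p"
        using p gmax_nonneg[OF F(1)] by (intro powr_mono2) auto
      then show ?thesis using K by (simp add: powr_mult powr_powr t_def)
    qed
    have "(\<integral>x. gmax F (\<lambda>I. norm (V I *v coef f I)) x powr p \<partial>lebesgue) \<le> (\<integral>x. K powr p * gmax F (mean \<phi>) x powr t \<partial>lebesgue)"
      by (intro integral_mono pt integrable_mult_right gmax_powr_integrable[OF F]) (use p t in auto)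
    also have "\<dots> = K powr p * (\<integral>x. gmax F (mean \<phi>) x powr t \<partial>lebesgue)" by simp
    also have "\<dots> \<le> K powr p * ((t / (t - 1)) powr t * (\<integral>x. \<phi> x powr t \<partial>lebesgue))"
    proof (intro mult_left_mono doob[OF t F \<phi>m])
      show "integrable lebesgue (\<lambda>x. \<phi> x powr t)" unfolding \<phi>t by (rule fp)
      show "0 \<le> \<phi> x" for x by (simp add: \<phi>_def)
      then show "0 \<le> mean \<phi> I" if "I \<in> F" for I using that F(2) by (intro mean_nonneg) auto
      show "mean \<phi> I * vol I \<le> (LINT x:I|lebesgue. \<phi> x)" if "I \<in> F" for I
        using mean_mult[of I \<phi>] that F(2) by auto
    qed auto
    finally show "(\<integral>x. gmax F (\<lambda>I. norm (V I *v coef f I)) x powr p \<partial>lebesgue)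
       \<le> K powr p * (t / (t - 1)) powr t * (\<integral>x. norm (f x) powr p \<partial>lebesgue)"
      by (simp add: \<phi>t mult.assoc)
  qed simp
qed

section \<open>Stopping times for reducing operators\<close>

text \<open>Both directions are tested, so that on unstopped cubes \<open>V I\<close> and
  \<open>V J\<close> can be exchanged either way; \<open>bdd_imp_carl\<close> needs both.\<close>

definition stop :: "real \<Rightarrow> (real^'d) set \<Rightarrow> (real^'d) set \<Rightarrow> bool" where
  "stop l J K \<longleftrightarrow> l < mnorm (V J ** Vi K) \<or> l < mnorm (V K ** Vi J)"

lemma mnorm_large_basis:
  fixes M :: "complex^'n^'n"
  assumes "l < mnorm M" shows "\<exists>k. l / CARD('n) \<le> norm (M *v axis k 1)"
proof (rule ccontr)
  assume "\<not> ?thesis"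
  then have "(\<Sum>k\<in>UNIV. norm (M *v axis k 1)) \<le> (\<Sum>k\<in>(UNIV::'n set). l / CARD('n))"
    by (intro sum_mono) (auto simp: not_le intro: less_imp_le)
  also have "\<dots> = l" by simp
  finally show False using mnorm_le_sum[of M] assms by linarith
qed

text \<open>If \<open>K\<close> stops, one of finitely many vectors witnesses it, and then
  \<open>vol K\<close> is a small multiple of the integral over \<open>K\<close> of one of the
  scalar weights \<open>?a k\<close>, \<open>?b k\<close>, which depend on \<open>J\<close> only.
  These integrals add up over disjoint \<open>K\<close> to a multiple of
  \<open>vol J\<close>.\<close>

lemma stop_vol:
  "\<exists>l\<ge>1. \<forall>J\<in>D. \<forall>X. finite X \<longrightarrow> X \<subseteq> D \<longrightarrow> disjoint X \<longrightarrow> (\<forall>K\<in>X. K \<subseteq> J \<and> stop l J K) \<longrightarrow>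
     (\<Sum>K\<in>X. vol K) \<le> vol J / 2"
proof -
  define n where "n = real CARD('n)"
  have n: "1 \<le> n" by (simp add: n_def Suc_leI)
  define c1 where "c1 = 2 powr q * c powr (q / p)"
  define G where "G = c1 * (c * c powr q) + c * c"
  have c1: "0 \<le> c1" by (simp add: c1_def)
  have G: "1 \<le> G" using c c1 mult_mono[of 1 c 1 c] by (simp add: G_def add_increasing)
  \<comment> \<open>Each of the \<open>n\<close> basis vectors costs \<open>G * vol J\<close>, and a
    witness is only of size \<open>l / n\<close>; this \<open>l\<close> makes the total
    \<open>(n / l) * n * G\<close> equal to one half.\<close>
  define l where "l = 2 * n * n * G"
  have nl: "n \<le> l"
  proof -
    have "1 * 1 \<le> (2 * n) * G" using n G by (intro mult_mono) auto
    then have "n * 1 \<le> n * (2 * n * G)" using n by (intro mult_left_mono) auto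
    then show ?thesis by (simp add: l_def ac_simps)
  qed
  define h where "h = n / l"
  have h: "0 < h" "h \<le> 1" using n nl by (auto simp: h_def)
  have hln: "h * (l / n) = 1" using n nl by (simp add: h_def)
  show ?thesis
  proof (rule exI[of _ l], intro conjI ballI allI impI)
    show "1 \<le> l" using n nl by simp
    fix J X assume J: "J \<in> D" and X: "finite X" "X \<subseteq> D" "disjoint X" and XS: "\<forall>K\<in>X. K \<subseteq> J \<and> stop l J K"
    have v: "vol J > 0" by (rule D_vol_pos[OF J])
    let ?a = "\<lambda>k x. norm (Q x *v (V J *v axis k 1)) powr q"
    let ?b = "\<lambda>k x. norm (P x *v (Vi J *v axis k 1)) powr p"
    have a0: "0 \<le> (LINT x:K|lebesgue. ?a k x)" for K k
      unfolding set_lebesgue_integral_def by (intro integral_nonneg_AE) auto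
    have b0: "0 \<le> (LINT x:K|lebesgue. ?b k x)" for K k
      unfolding set_lebesgue_integral_def by (intro integral_nonneg_AE) auto
    \<comment> \<open>Since \<open>l / n >= 1\<close>, raising to a power above 1 only helps, so one
      bound serves the exponents \<open>p\<close> and \<open>q\<close>.\<close>
    have big: "vol K \<le> h * vol K * t powr y" if "K \<in> D" "l / n \<le> t" "1 < y" for K t y
    proof -
      have "h * (l / n) \<le> h * t" by (intro mult_left_mono) (use that h in auto)
      then have "1 \<le> h * t" by (simp only: hln)
      then have "1 \<le> h * t powr y"
      proof -
        have l1: "1 \<le> l / n" using n nl by simp
        then have "t powr 1 \<le> t powr y" using that by (intro powr_mono) auto
        then have "t \<le> t powr y" using that l1 by simp
        then have "h * t \<le> h * t powr y" using h by (intro mult_left_mono) auto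
        with \<open>1 \<le> h * t\<close> show ?thesis by linarith
      qed
      then have "vol K * 1 \<le> vol K * (h * t powr y)" using D_vol_pos[OF that(1)] by (intro mult_left_mono) auto
      then show ?thesis by (simp add: ac_simps)
    qed
    have each: "vol K \<le> h * (c1 * (\<Sum>k\<in>UNIV. LINT x:K|lebesgue. ?a k x) + c * (\<Sum>k\<in>UNIV. LINT x:K|lebesgue. ?b k x))" if KX: "K \<in> X" for K
    proof -
      have K: "K \<in> D" using KX X by auto
      have A0: "0 \<le> c1 * (\<Sum>k\<in>UNIV. LINT x:K|lebesgue. ?a k x)" using c1 a0 by (intro mult_nonneg_nonneg sum_nonneg) auto
      have B0: "0 \<le> c * (\<Sum>k\<in>UNIV. LINT x:K|lebesgue. ?b k x)" using c b0 by (intro mult_nonneg_nonneg sum_nonneg) auto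
      have "stop l J K" using XS KX by auto
      then consider "l < mnorm (V J ** Vi K)" | "l < mnorm (V K ** Vi J)" by (auto simp: stop_def)
      then show ?thesis
      proof cases
        case 1
        have "mnorm (V J ** Vi K) = mnorm (Vi K ** V J)"
          using mnorm_mat_adj[of "V J ** Vi K"] posdef_adj[OF Vp[OF J]] posdef_inverse(3)[OF Vp[OF K]] by (simp add: mat_adj_mult)
        then obtain k where k: "l / n \<le> norm (Vi K *v (V J *v axis k 1))"
          using mnorm_large_basis[of l "Vi K ** V J"] 1 by (auto simp: matrix_vector_mul_assoc n_def)
        have "vol K \<le> h * vol K * norm (Vi K *v (V J *v axis k 1)) powr q" by (rule big[OF K k q])
        also have "\<dots> \<le> h * (c1 * (LINT x:K|lebesgue. ?a k x))"
          using inverse_lower_powr[OF K D_sets[OF K] order.refl, of "V J *v axis k 1"] h D_vol_pos[OF K]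
          by (simp add: vol_def c1_def mult.assoc)
        also have "\<dots> \<le> h * (c1 * (\<Sum>k\<in>UNIV. LINT x:K|lebesgue. ?a k x))"
          using h c1 a0 by (intro mult_left_mono member_le_sum) auto
        also have "\<dots> \<le> h * (c1 * (\<Sum>k\<in>UNIV. LINT x:K|lebesgue. ?a k x) + c * (\<Sum>k\<in>UNIV. LINT x:K|lebesgue. ?b k x))"
          using B0 h by (intro mult_left_mono) auto
        finally show ?thesis .
      next
        case 2
        then obtain k where k: "l / n \<le> norm (V K *v (Vi J *v axis k 1))"
          using mnorm_large_basis[of l "V K ** Vi J"] by (auto simp: matrix_vector_mul_assoc n_def)
        have "vol K \<le> h * vol K * norm (V K *v (Vi J *v axis k 1)) powr p" by (rule big[OF K k p])
        also have "\<dots> \<le> h * (c * (LINT x:K|lebesgue. ?b k x))"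
          using P_ge[OF K, of "Vi J *v axis k 1"] h by (simp add: mult.assoc)
        also have "\<dots> \<le> h * (c * (\<Sum>k\<in>UNIV. LINT x:K|lebesgue. ?b k x))"
          using h c b0 by (intro mult_left_mono member_le_sum) auto
        also have "\<dots> \<le> h * (c1 * (\<Sum>k\<in>UNIV. LINT x:K|lebesgue. ?a k x) + c * (\<Sum>k\<in>UNIV. LINT x:K|lebesgue. ?b k x))"
          using A0 h by (intro mult_left_mono) auto
        finally show ?thesis .
      qed
    qed
    have suma: "(\<Sum>K\<in>X. LINT x:K|lebesgue. ?a k x) \<le> c * c powr q * vol J" for k
    proof -
      have "(\<Sum>K\<in>X. LINT x:K|lebesgue. ?a k x) \<le> (LINT x:J|lebesgue. ?a k x)"
        by (rule integral_disjoint_le[OF X]) (use XS J Qi in auto)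
      also have "\<dots> \<le> c * c powr q * (vol J * norm (Vi J *v (V J *v axis k 1)) powr q)" by (rule Q_inverse_le[OF J])
      finally show ?thesis by (simp add: inv_mult[OF J])
    qed
    have sumb: "(\<Sum>K\<in>X. LINT x:K|lebesgue. ?b k x) \<le> c * vol J" for k
    proof -
      have "(\<Sum>K\<in>X. LINT x:K|lebesgue. ?b k x) \<le> (LINT x:J|lebesgue. ?b k x)"
        by (rule integral_disjoint_le[OF X]) (use XS J Pi in auto)
      also have "\<dots> \<le> c * (vol J * norm (V J *v (Vi J *v axis k 1)) powr p)" by (rule P_le[OF J])
      finally show ?thesis by (simp add: inv_mult[OF J])
    qed
    have "(\<Sum>K\<in>X. vol K) \<le> (\<Sum>K\<in>X. h * (c1 * (\<Sum>k\<in>UNIV. LINT x:K|lebesgue. ?a k x) + c * (\<Sum>k\<in>UNIV. LINT x:K|lebesgue. ?b k x)))"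
      by (intro sum_mono each)
    also have "\<dots> = h * (c1 * (\<Sum>k\<in>UNIV. \<Sum>K\<in>X. LINT x:K|lebesgue. ?a k x) + c * (\<Sum>k\<in>UNIV. \<Sum>K\<in>X. LINT x:K|lebesgue. ?b k x))"
      unfolding sum_distrib_left[symmetric] sum.distrib by (subst (1 2) sum.swap) simp
    also have "\<dots> \<le> h * (c1 * (\<Sum>k\<in>(UNIV :: 'n set). c * c powr q * vol J) + c * (\<Sum>k\<in>(UNIV :: 'n set). c * vol J))"
      using h c1 c by (intro mult_left_mono add_mono sum_mono suma sumb) auto
    also have "\<dots> = h * (n * G * vol J)" by (simp add: n_def G_def algebra_simps)
    also have "\<dots> = vol J / 2" using n nl G by (simp add: h_def l_def)
    finally show "(\<Sum>K\<in>X. vol K) \<le> vol J / 2" .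
  qed
qed

text \<open>The stopped cubes fill at most half of \<open>J\<close>, so the constant
  \<open>2 * B\<close> reproduces itself: \<open>B + 2 * B / 2\<close>.\<close>

lemma absorb:
  assumes l: "1 \<le> l" and st: "\<forall>J\<in>D. \<forall>X. finite X \<longrightarrow> X \<subseteq> D \<longrightarrow> disjoint X \<longrightarrow> (\<forall>K\<in>X. K \<subseteq> J \<and> stop l J K) \<longrightarrow>
     (\<Sum>K\<in>X. vol K) \<le> vol J / 2"
    and F: "finite F" "F \<subseteq> D" and B: "0 \<le> B"
    and un: "\<And>J. J \<in> D \<Longrightarrow> (\<Sum>I | I \<in> F \<and> I \<subseteq> J \<and> (\<forall>K\<in>D. I \<subseteq> K \<longrightarrow> K \<subset> J \<longrightarrow> \<not> stop l J K). a I) \<le> B * vol J"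
    and J: "J \<in> D"
  shows "(\<Sum>I | I \<in> F \<and> I \<subseteq> J. a I) \<le> 2 * B * vol J"
  using J F
proof (induction J rule: level_induct)
  case (base J)
  have "{I. I \<in> F \<and> I \<subseteq> J} = {}" using base(2) by auto
  moreover have "0 \<le> 2 * B * vol J" using B D_vol_pos[OF base(1)] by simp
  ultimately show ?case by (simp only: sum.empty)
next
  case (step J)
  note J = step(1)
  obtain X where X: "finite X" "X \<subseteq> D" "disjoint X"
    and XS: "\<forall>K\<in>X. stop l J K \<and> K \<subset> J \<and> (\<forall>K'\<in>D. K \<subset> K' \<longrightarrow> K' \<subset> J \<longrightarrow> \<not> stop l J K')"
    and Xsum: "\<forall>c :: _ \<Rightarrow> real. (\<Sum>I | I \<in> F \<and> I \<subseteq> J. c I) =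
       (\<Sum>I | I \<in> F \<and> I \<subseteq> J \<and> (\<forall>K\<in>D. I \<subseteq> K \<longrightarrow> K \<subset> J \<longrightarrow> \<not> stop l J K). c I) + (\<Sum>K\<in>X. \<Sum>I | I \<in> F \<and> I \<subseteq> K. c I)"
    using stopping_family[OF J F, of "stop l J"] by (elim exE conjE) (rule that)
  have V: "(\<Sum>K\<in>X. vol K) \<le> vol J / 2"
    using st[rule_format, OF J X] XS by auto
  have "(\<Sum>I | I \<in> F \<and> I \<subseteq> J. a I) \<le> B * vol J + (\<Sum>K\<in>X. 2 * B * vol K)"
    unfolding Xsum[rule_format]
  proof (intro add_mono un[OF J] sum_mono)
    fix K assume "K \<in> X"
    then show "(\<Sum>I | I \<in> F \<and> I \<subseteq> K. a I) \<le> 2 * B * vol K"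
      using step(2)[of K] X XS by auto
  qed
  also have "\<dots> = B * vol J + 2 * B * (\<Sum>K\<in>X. vol K)" by (simp add: sum_distrib_left)
  also have "\<dots> \<le> B * vol J + 2 * B * (vol J / 2)" using B V by (intro add_left_mono mult_left_mono) auto
  finally show ?case by simp
qed

lemma unstopped_bound:
  assumes l: "1 \<le> l" and J: "J \<in> D" and I: "I \<in> D" "\<forall>K\<in>D. I \<subseteq> K \<longrightarrow> K \<subset> J \<longrightarrow> \<not> stop l J K" "I \<subseteq> J"
  shows "mnorm (V J ** Vi I) \<le> l" "mnorm (V I ** Vi J) \<le> l"
proof -
  have "mnorm (V J ** Vi I) \<le> l \<and> mnorm (V I ** Vi J) \<le> l"
  proof (cases "I = J")
    \<comment> \<open>Being unstopped concerns only cubes strictly inside \<open>J\<close>; for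
      \<open>J\<close> itself the product is the identity, whence \<open>1 <= l\<close>.\<close>
    case True
    have "mnorm (V J ** Vi J) \<le> 1"
      unfolding posdef_inverse(2)[OF Vp[OF J]] by (rule mnorm_le) simp
    then show ?thesis using True l by auto
  next
    case False
    then have "\<not> stop l J I" using I by auto
    then show ?thesis by (auto simp: stop_def)
  qed
  then show "mnorm (V J ** Vi I) \<le> l" "mnorm (V I ** Vi J) \<le> l" by auto
qed

lemma change_inverse:
  assumes "I \<in> D" "J \<in> D" shows "mnorm (N ** Vi I) \<le> mnorm (N ** Vi J) * mnorm (V J ** Vi I)"
proof -
  have "N ** Vi I = (N ** Vi J) ** (V J ** Vi I)"
    using posdef_inverse(1)[OF Vp[OF assms(2)]] by (metis matrix_mul_assoc matrix_mul_lid)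
  then show ?thesis by (metis mnorm_mult)
qed

section \<open>Carleson conditions and boundedness\<close>

text \<open>Condition (b) as a real inequality over finite families. \<open>N I e\<close> stands for
  the reducing operator of the outer weight times the coefficient, so that a single weight pair
  remains in view.\<close>

definition carl :: "((real^'d) set \<Rightarrow> ('d \<Rightarrow> bool) \<Rightarrow> complex^'n^'n) \<Rightarrow> real \<Rightarrow> bool" where
  "carl N B \<longleftrightarrow> (\<forall>J\<in>D. \<forall>F. finite F \<longrightarrow> F \<subseteq> D \<longrightarrow>
     (\<Sum>I | I \<in> F \<and> I \<subseteq> J. \<Sum>e\<in>sigS. (mnorm (N I e ** Vi I))\<^sup>2) \<le> B * vol J)"

text \<open>The quantity bounded in (c), in the same form: the inverse reducing operator is frozen
  at the top cube.\<close>

definition carlB :: "((real^'d) set \<Rightarrow> ('d \<Rightarrow> bool) \<Rightarrow> complex^'n^'n) \<Rightarrow> real \<Rightarrow> bool" where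
  "carlB N B \<longleftrightarrow> (\<forall>J\<in>D. \<forall>F. finite F \<longrightarrow> F \<subseteq> D \<longrightarrow>
     (\<Sum>I | I \<in> F \<and> I \<subseteq> J. \<Sum>e\<in>sigS. (mnorm (N I e ** Vi J))\<^sup>2) \<le> B * vol J)"

definition para :: "((real^'d) set \<Rightarrow> ('d \<Rightarrow> bool) \<Rightarrow> complex^'n^'n) \<Rightarrow> (real^'d) set set \<Rightarrow> (real^'d \<Rightarrow> complex^'n) \<Rightarrow> real^'d \<Rightarrow> complex^'n" where
  "para N F f = hsum F (\<lambda>I e. N I e *v coef f I)"

definition bdd :: "((real^'d) set \<Rightarrow> ('d \<Rightarrow> bool) \<Rightarrow> complex^'n^'n) \<Rightarrow> real \<Rightarrow> bool" where
  "bdd N C \<longleftrightarrow> (\<forall>f. f \<in> borel_measurable lebesgue \<longrightarrow> integrable lebesgue (\<lambda>x. norm (f x) powr p) \<longrightarrow>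
     (\<forall>F. finite F \<longrightarrow> F \<subseteq> D \<longrightarrow>
       (\<integral>x. norm (para N F f x) powr p \<partial>lebesgue) \<le> C * (\<integral>x. norm (f x) powr p \<partial>lebesgue)))"

lemma sq_sum_mono:
  fixes a b :: "_ \<Rightarrow> _ \<Rightarrow> real"
  assumes "\<And>I e. I \<in> U \<Longrightarrow> 0 \<le> a I e" "\<And>I e. I \<in> U \<Longrightarrow> a I e \<le> l * b I e"
  shows "(\<Sum>I\<in>U. \<Sum>e\<in>S. (a I e)\<^sup>2) \<le> l\<^sup>2 * (\<Sum>I\<in>U. \<Sum>e\<in>S. (b I e)\<^sup>2)"
  unfolding sum_distrib_left
proof (intro sum_mono)
  fix I e assume "I \<in> U"
  then have "(a I e)\<^sup>2 \<le> (l * b I e)\<^sup>2" using assms by (intro power_mono) auto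
  then show "(a I e)\<^sup>2 \<le> l\<^sup>2 * (b I e)\<^sup>2" by (simp add: power_mult_distrib)
qed

theorem carlB_imp_carl:
  assumes "carlB N B" "0 \<le> B" shows "\<exists>B'\<ge>0. carl N B'"
proof -
  obtain l where l: "1 \<le> l" and st: "\<forall>J\<in>D. \<forall>X. finite X \<longrightarrow> X \<subseteq> D \<longrightarrow> disjoint X \<longrightarrow> (\<forall>K\<in>X. K \<subseteq> J \<and> stop l J K) \<longrightarrow>
     (\<Sum>K\<in>X. vol K) \<le> vol J / 2"
    using stop_vol by blast
  have "carl N (2 * (l\<^sup>2 * B))"
    unfolding carl_def
  proof (intro ballI allI impI)
    fix J F assume J: "J \<in> D" and F: "finite F" "F \<subseteq> D"
    show "(\<Sum>I | I \<in> F \<and> I \<subseteq> J. \<Sum>e\<in>sigS. (mnorm (N I e ** Vi I))\<^sup>2) \<le> 2 * (l\<^sup>2 * B) * vol J"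
    proof (rule absorb[OF l st F _ _ J])
      fix J assume J: "J \<in> D"
      let ?U = "{I. I \<in> F \<and> I \<subseteq> J \<and> (\<forall>K\<in>D. I \<subseteq> K \<longrightarrow> K \<subset> J \<longrightarrow> \<not> stop l J K)}"
      have "(\<Sum>I\<in>?U. \<Sum>e\<in>sigS. (mnorm (N I e ** Vi I))\<^sup>2) \<le> l\<^sup>2 * (\<Sum>I\<in>?U. \<Sum>e\<in>sigS. (mnorm (N I e ** Vi J))\<^sup>2)"
      proof (intro sq_sum_mono mnorm_nonneg)
        fix I e assume I: "I \<in> ?U"
        then have ID: "I \<in> D" using F by auto
        have "mnorm (N I e ** Vi I) \<le> mnorm (N I e ** Vi J) * mnorm (V J ** Vi I)" by (rule change_inverse[OF ID J])
        also have "\<dots> \<le> mnorm (N I e ** Vi J) * l"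
          using unstopped_bound(1)[OF l J ID] I by (intro mult_left_mono mnorm_nonneg) auto
        finally show "mnorm (N I e ** Vi I) \<le> l * mnorm (N I e ** Vi J)" by (simp add: mult.commute)
      qed
      also have "\<dots> \<le> l\<^sup>2 * (\<Sum>I | I \<in> F \<and> I \<subseteq> J. \<Sum>e\<in>sigS. (mnorm (N I e ** Vi J))\<^sup>2)"
        using F by (intro mult_left_mono sum_mono2) (auto intro!: sum_nonneg)
      also have "\<dots> \<le> l\<^sup>2 * (B * vol J)"
        using assms(1)[unfolded carlB_def, rule_format, OF J F] by (intro mult_left_mono) auto
      finally show "(\<Sum>I\<in>?U. \<Sum>e\<in>sigS. (mnorm (N I e ** Vi I))\<^sup>2) \<le> (l\<^sup>2 * B) * vol J" by simp
    qed (use assms(2) in auto)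
  qed
  moreover have "0 \<le> 2 * (l\<^sup>2 * B)" using assms(2) by simp
  ultimately show ?thesis by blast
qed

text \<open>Inserting \<open>Vi I\<close> and \<open>V I\<close> between \<open>N I e\<close> and
  the average makes the problem scalar: a Carleson sequence \<open>mnorm (N I e ** Vi I)\<close>
  against the averages treated by \<open>maximal_bound\<close>.\<close>

theorem carl_imp_bdd:
  assumes N: "carl N B" "0 \<le> B" shows "\<exists>C\<ge>0. bdd N C"
proof -
  obtain C where C: "0 \<le> C" and mb: "\<And>f F. f \<in> borel_measurable lebesgue \<Longrightarrow> integrable lebesgue (\<lambda>x. norm (f x) powr p) \<Longrightarrow>
     finite F \<Longrightarrow> F \<subseteq> D \<Longrightarrow>
       (\<integral>x. gmax F (\<lambda>I. norm (V I *v coef f I)) x powr p \<partial>lebesgue) \<le> C * (\<integral>x. norm (f x) powr p \<partial>lebesgue)"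
    using maximal_bound by blast
  let ?K = "(loc_const * sqrt B * p) powr p"
  have "bdd N (?K * C)"
    unfolding bdd_def
  proof (intro allI impI)
    fix f :: "real^'d \<Rightarrow> complex^'n" and F
    assume f: "f \<in> borel_measurable lebesgue" "integrable lebesgue (\<lambda>x. norm (f x) powr p)" and F: "finite F" "F \<subseteq> D"
    have "(\<integral>x. norm (para N F f x) powr p \<partial>lebesgue) \<le> ?K * (\<integral>x. gmax F (\<lambda>I. norm (V I *v coef f I)) x powr p \<partial>lebesgue)"
      unfolding para_def
    proof (rule paraproduct_bound[OF p F N(2), where a="\<lambda>I e. mnorm (N I e ** Vi I)"])
      fix J assume "J \<in> D"
      then show "(\<Sum>I | I \<in> F \<and> I \<subseteq> J. \<Sum>e\<in>sigS. (mnorm (N I e ** Vi I))\<^sup>2) \<le> B * vol J"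
        using N(1) F unfolding carl_def by auto
    next
      fix I e assume I: "I \<in> F"
      then have ID: "I \<in> D" using F by auto
      have "N I e *v coef f I = (N I e ** Vi I) *v (V I *v coef f I)"
        by (simp add: matrix_vector_mul_assoc[symmetric] inv_mult[OF ID])
      then show "norm (N I e *v coef f I) \<le> mnorm (N I e ** Vi I) * norm (V I *v coef f I)"
        by (simp add: mnorm_ge)
    qed (auto simp: mnorm_nonneg)
    also have "\<dots> \<le> ?K * (C * (\<integral>x. norm (f x) powr p \<partial>lebesgue))"
      by (intro mult_left_mono mb f F) auto
    finally show "(\<integral>x. norm (para N F f x) powr p \<partial>lebesgue) \<le> ?K * C * (\<integral>x. norm (f x) powr p \<partial>lebesgue)"
      by simp
  qed
  moreover have "0 \<le> ?K * C" using C by simp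
  ultimately show ?thesis by blast
qed

section \<open>Necessity of the Carleson conditions\<close>

lemma bdd_test:
  assumes b: "bdd N C" "0 \<le> C" and J: "J \<in> D" and F: "finite F" "F \<subseteq> D" "\<And>I. I \<in> F \<Longrightarrow> I \<subseteq> J"
  shows "(\<integral>x. norm (hsum F (\<lambda>I e. N I e *v (Vi J *v axis k 1)) x) powr p \<partial>lebesgue) \<le> C * (c * vol J)"
proof -
  define u :: "complex^'n" where "u = Vi J *v axis k 1"
  \<comment> \<open>\<open>Q\<close> cancels \<open>P\<close> on \<open>J\<close>, so the average
    over every cube of \<open>F\<close> is exactly \<open>u\<close>; and \<open>V J *v u\<close> is
    a unit vector, so the p-th power of the norm of \<open>f\<close> integrates to at most
    \<open>c * vol J\<close>.\<close>
  define f where "f x = indicator J x *\<^sub>R (P x *v u)" for x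
  note [measurable] = D_sets[OF J]
  have fm: "f \<in> borel_measurable lebesgue" unfolding f_def by measurable
  have fp: "norm (f x) powr p = indicator J x *\<^sub>R norm (P x *v u) powr p" for x
    using p by (auto simp: f_def indicator_def)
  have fi: "integrable lebesgue (\<lambda>x. norm (f x) powr p)"
    unfolding fp using Pi[OF J, of u] by (simp add: set_integrable_def)
  have co: "coef f I = u" if I: "I \<in> F" for I
  proof -
    have ID: "I \<in> D" using I F by auto
    have "(LINT x:I|lebesgue. Q x *v f x) = (LINT x:I|lebesgue. u)"
    proof (rule set_lebesgue_integral_cong)
      show "\<forall>x. x \<in> I \<longrightarrow> Q x *v f x = u"
        using F(3)[OF I] by (auto simp: f_def matrix_vector_mul_assoc QP)
    qed (use ID in simp)
    then show ?thesis using ID by (simp add: coef_def avg_def)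
  qed
  have "hsum F (\<lambda>I e. N I e *v u) = para N F f"
    unfolding para_def hsum_def by (intro ext sum.cong refl) (simp add: co)
  then have "(\<integral>x. norm (hsum F (\<lambda>I e. N I e *v u) x) powr p \<partial>lebesgue) \<le> C * (\<integral>x. norm (f x) powr p \<partial>lebesgue)"
    using b(1) fm fi F(1,2) unfolding bdd_def by auto
  also have "\<dots> \<le> C * (c * vol J)"
    using P_le[OF J, of u] b(2) by (intro mult_left_mono) (auto simp: fp set_lebesgue_integral_def u_def inv_mult[OF J])
  finally show ?thesis by (simp add: u_def)
qed

lemma hsum_outside:
  assumes "F \<subseteq> D" "\<And>I. I \<in> F \<Longrightarrow> I \<subseteq> J" "x \<notin> J" shows "hsum F v x = 0"
  unfolding hsum_def using haar_outside assms by (intro sum.neutral ballI) (metis in_mono scaleR_zero_left)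

text \<open>Hilbert-Schmidt bound for each matrix, then Parseval for each basis vector.\<close>

lemma mnorm_sum_basis:
  assumes F: "finite F" "F \<subseteq> D"
  shows "(\<Sum>I\<in>F. \<Sum>e\<in>sigS. (mnorm (N I e ** Vi J))\<^sup>2)
    \<le> (\<Sum>k\<in>UNIV. \<integral>x. (norm (hsum F (\<lambda>I e. N I e *v (Vi J *v axis k 1)) x))\<^sup>2 \<partial>lebesgue)"
proof -
  have "(\<Sum>I\<in>F. \<Sum>e\<in>sigS. (mnorm (N I e ** Vi J))\<^sup>2)
     \<le> (\<Sum>I\<in>F. \<Sum>e\<in>sigS. \<Sum>k\<in>UNIV. (norm (N I e *v (Vi J *v axis k 1)))\<^sup>2)"
    by (intro sum_mono) (use mnorm_sq_le_sum in \<open>simp add: matrix_vector_mul_assoc\<close>)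
  also have "\<dots> = (\<Sum>k\<in>UNIV. \<Sum>I\<in>F. \<Sum>e\<in>sigS. (norm (N I e *v (Vi J *v axis k 1)))\<^sup>2)"
  proof -
    have "(\<Sum>I\<in>F. \<Sum>e\<in>sigS. \<Sum>k\<in>UNIV. (norm (N I e *v (Vi J *v axis k 1)))\<^sup>2)
        = (\<Sum>I\<in>F. \<Sum>k\<in>UNIV. \<Sum>e\<in>sigS. (norm (N I e *v (Vi J *v axis k 1)))\<^sup>2)"
      by (intro sum.cong refl sum.swap)
    also have "\<dots> = (\<Sum>k\<in>UNIV. \<Sum>I\<in>F. \<Sum>e\<in>sigS. (norm (N I e *v (Vi J *v axis k 1)))\<^sup>2)"
      by (rule sum.swap)
    finally show ?thesis .
  qed
  finally show ?thesis unfolding hsum_parseval[OF F] .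
qed

text \<open>The tested sum lives on \<open>J\<close>, where the square is at most 1 plus the
  \<open>p\<close>-th power when \<open>2 <= p\<close>. So \<open>bdd_test\<close> already bounds
  the L^2 norm.\<close>

theorem bdd_imp_carlB:
  assumes b: "bdd N C" "0 \<le> C" and p2: "2 \<le> p" shows "\<exists>B\<ge>0. carlB N B"
proof -
  define B where "B = CARD('n) * (1 + C * c)"
  have B: "0 \<le> B" using b c by (simp add: B_def)
  have "carlB N B"
    unfolding carlB_def
  proof (intro ballI allI impI)
    fix J F0 assume J: "J \<in> D" and F0: "finite F0" "F0 \<subseteq> D"
    define F where "F = {I. I \<in> F0 \<and> I \<subseteq> J}"
    have F: "finite F" "F \<subseteq> D" "\<And>I. I \<in> F \<Longrightarrow> I \<subseteq> J" using F0 by (auto simp: F_def)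
    have v: "vol J > 0" by (rule D_vol_pos[OF J])
    have each: "(\<integral>x. (norm (hsum F (\<lambda>I e. N I e *v (Vi J *v axis k 1)) x))\<^sup>2 \<partial>lebesgue) \<le> (1 + C * c) * vol J" for k
    proof -
      let ?T = "hsum F (\<lambda>I e. N I e *v (Vi J *v axis k 1))"
      have pt: "(norm (?T x))\<^sup>2 \<le> indicator J x * 1 + norm (?T x) powr p" for x
      proof (cases "x \<in> J")
        case True
        show ?thesis
        proof (cases "norm (?T x) \<le> 1")
          case True
          then have "(norm (?T x))\<^sup>2 \<le> 1" by (simp add: power_le_one)
          then show ?thesis using \<open>x \<in> J\<close> by (simp add: add_increasing2)
        next
          case False
          then have "norm (?T x) powr 2 \<le> norm (?T x) powr p" using p2 by (intro powr_mono) auto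
          then show ?thesis using \<open>x \<in> J\<close> False by (simp add: powr_numeral)
        qed
      next
        case False
        have "?T x = 0" by (rule hsum_outside[OF F(2,3) False])
        then show ?thesis using False by simp
      qed
      have iJ: "integrable lebesgue (\<lambda>x. indicat_real J x * 1)"
        using D_integrable_const[OF J, of "1::real"] by (simp add: set_integrable_def)
      have iT: "integrable lebesgue (\<lambda>x. norm (?T x) powr p)" by (rule hsum_powr_integrable[OF F(1,2)]) (use p in simp)
      have "(\<integral>x. (norm (?T x))\<^sup>2 \<partial>lebesgue) \<le> (\<integral>x. indicator J x * 1 + norm (?T x) powr p \<partial>lebesgue)"
      proof (rule integral_mono[OF _ Bochner_Integration.integrable_add[OF iJ iT] pt])
        show "integrable lebesgue (\<lambda>x. (norm (?T x))\<^sup>2)"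
          using hsum_powr_integrable[OF F(1,2), of 2] by (simp add: powr_numeral)
      qed
      also have "\<dots> = vol J + (\<integral>x. norm (?T x) powr p \<partial>lebesgue)"
        using Bochner_Integration.integral_add[OF iJ iT] D_integral_const[OF J, of "1::real"] by (simp add: set_lebesgue_integral_def)
      also have "\<dots> \<le> vol J + C * (c * vol J)" by (intro add_left_mono bdd_test[OF b J F])
      finally show ?thesis by (simp add: algebra_simps)
    qed
    have "(\<Sum>I\<in>F. \<Sum>e\<in>sigS. (mnorm (N I e ** Vi J))\<^sup>2) \<le> (\<Sum>k\<in>(UNIV::'n set). (1 + C * c) * vol J)"
      by (rule order.trans[OF mnorm_sum_basis[OF F(1,2)]]) (intro sum_mono each)
    then show "(\<Sum>I | I \<in> F0 \<and> I \<subseteq> J. \<Sum>e\<in>sigS. (mnorm (N I e ** Vi J))\<^sup>2) \<le> B * vol J"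
      by (simp add: F_def B_def mult.assoc)
  qed
  with B show ?thesis by blast
qed

text \<open>For a finite family the best Carleson constant \<open>m\<close> is finite, and on the cubes that are not stopped
  the estimate of the square integral by the product of the \<open>L\<^sup>p\<close> and \<open>L\<^sup>q\<close> norms yields \<open>m \<le> L * sqrt m\<close>.\<close>

theorem bdd_imp_carl:
  assumes b: "bdd N C" "0 \<le> C" shows "\<exists>B\<ge>0. carl N B"
proof -
  obtain l where l: "1 \<le> l" and st: "\<forall>J\<in>D. \<forall>X. finite X \<longrightarrow> X \<subseteq> D \<longrightarrow> disjoint X \<longrightarrow> (\<forall>K\<in>X. K \<subseteq> J \<and> stop l J K) \<longrightarrow>
     (\<Sum>K\<in>X. vol K) \<le> vol J / 2"
    using stop_vol by blast
  \<comment> \<open>In \<open>K\<close> the first factor comes from \<open>bdd_test\<close> and the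
    second from the L^q estimate without \<open>sqrt M\<close>. In \<open>L\<close> the 2 is the
    loss in \<open>absorb\<close>, \<open>l\<close> squared the return from \<open>V J\<close> to
    \<open>V I\<close>, and the cardinality counts the basis vectors.\<close>
  define K where "K = (C * c) powr (1/p) * (loc_const * q * l)"
  define L where "L = 2 * (l\<^sup>2 * (CARD('n) * K))"
  have lc: "0 \<le> loc_const" by (simp add: loc_const_def)
  have K: "0 \<le> K" using lc l q by (simp add: K_def)
  have L: "0 \<le> L" using K l by (simp add: L_def)
  have "carl N (L\<^sup>2)"
    unfolding carl_def
  proof (intro ballI allI impI)
    fix J0 F assume J0: "J0 \<in> D" and F: "finite F" "F \<subseteq> D"
    let ?c = "\<lambda>I. \<Sum>e\<in>sigS. (mnorm (N I e ** Vi I))\<^sup>2"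
    have c0: "0 \<le> ?c I" for I by (intro sum_nonneg) auto
    \<comment> \<open>All constants admissible for this particular \<open>F\<close>. Below, an
      admissible \<open>M\<close> is improved to \<open>L * sqrt M\<close>.\<close>
    define S where "S = {M. 0 \<le> M \<and> (\<forall>J\<in>D. (\<Sum>I | I \<in> F \<and> I \<subseteq> J. ?c I) \<le> M * vol J)}"
    have imp: "L * sqrt M \<in> S" if M: "M \<in> S" for M
    proof -
      have M0: "0 \<le> M" and MJ: "\<And>J. J \<in> D \<Longrightarrow> (\<Sum>I | I \<in> F \<and> I \<subseteq> J. ?c I) \<le> M * vol J"
        using M by (auto simp: S_def)
      have "(\<Sum>I | I \<in> F \<and> I \<subseteq> J. ?c I) \<le> 2 * (l\<^sup>2 * (CARD('n) * (K * sqrt M))) * vol J" if J: "J \<in> D" for J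
      proof (rule absorb[OF l st F _ _ J])
        fix J assume J: "J \<in> D"
        define U where "U = {I. I \<in> F \<and> I \<subseteq> J \<and> (\<forall>K\<in>D. I \<subseteq> K \<longrightarrow> K \<subset> J \<longrightarrow> \<not> stop l J K)}"
        have U: "finite U" "U \<subseteq> D" "\<And>I. I \<in> U \<Longrightarrow> I \<subseteq> J" "U \<subseteq> F" using F by (auto simp: U_def)
        have v: "vol J > 0" by (rule D_vol_pos[OF J])
        have Ub: "mnorm (V J ** Vi I) \<le> l" "mnorm (V I ** Vi J) \<le> l" if "I \<in> U" for I
          using unstopped_bound[OF l J, of I] that F by (auto simp: U_def)
        have each: "(\<integral>x. (norm (hsum U (\<lambda>I e. N I e *v (Vi J *v axis k 1)) x))\<^sup>2 \<partial>lebesgue) \<le> K * sqrt M * vol J" for k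
        proof -
          let ?T = "hsum U (\<lambda>I e. N I e *v (Vi J *v axis k 1))"
          have Tm [measurable]: "?T \<in> borel_measurable lebesgue" by (rule hsum_borel[OF U(2)])
          have iT: "integrable lebesgue (\<lambda>x. norm (?T x) powr y)" if "0 < y" for y
            by (rule hsum_powr_integrable[OF U(1,2) that])
          \<comment> \<open>The paraproduct estimate is free of weights, so it may be used at the
            exponent \<open>q\<close>: the coefficients are bounded by the Carleson sequence times
            the constant \<open>l\<close>, because the cubes are unstopped.\<close>
          have Tq: "(\<integral>x. norm (?T x) powr q \<partial>lebesgue) \<le> (loc_const * sqrt M * q) powr q * (l powr q * vol J)"
          proof -
            have "(\<integral>x. norm (?T x) powr q \<partial>lebesgue) \<le> (loc_const * sqrt M * q) powr q * (\<integral>x. gmax U (\<lambda>_. l) x powr q \<partial>lebesgue)"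
            proof (rule paraproduct_bound[OF q U(1,2) M0, where a="\<lambda>I e. mnorm (N I e ** Vi I)"])
              fix J' assume J': "J' \<in> D"
              have "(\<Sum>I | I \<in> U \<and> I \<subseteq> J'. ?c I) \<le> (\<Sum>I | I \<in> F \<and> I \<subseteq> J'. ?c I)"
                using F U c0 by (intro sum_mono2) auto
              then show "(\<Sum>I | I \<in> U \<and> I \<subseteq> J'. ?c I) \<le> M * vol J'" using MJ[OF J'] by linarith
            next
              fix I e assume I: "I \<in> U"
              then have ID: "I \<in> D" using U by auto
              have "norm (N I e *v (Vi J *v axis k 1)) \<le> mnorm (N I e ** Vi J) * norm (axis k (1::complex))"
                unfolding matrix_vector_mul_assoc by (rule mnorm_ge)
              also have "\<dots> = mnorm (N I e ** Vi J)" by simp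
              also have "\<dots> \<le> mnorm (N I e ** Vi I) * mnorm (V I ** Vi J)" by (rule change_inverse[OF J ID])
              also have "\<dots> \<le> mnorm (N I e ** Vi I) * l" by (intro mult_left_mono Ub I mnorm_nonneg)
              finally show "norm (N I e *v (Vi J *v axis k 1)) \<le> mnorm (N I e ** Vi I) * l" .
            qed (use l in \<open>auto simp: mnorm_nonneg\<close>)
            also have "(\<integral>x. gmax U (\<lambda>_. l) x powr q \<partial>lebesgue) \<le> (\<integral>x. indicator J x *\<^sub>R (l powr q) \<partial>lebesgue)"
            proof (rule integral_mono[OF gmax_powr_integrable[OF U(1,2)]])
              show "integrable lebesgue (\<lambda>x. indicat_real J x *\<^sub>R (l powr q))"
                using D_integrable_const[OF J, of "l powr q"] by (simp add: set_integrable_def)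
              fix x show "gmax U (\<lambda>_. l) x powr q \<le> indicat_real J x *\<^sub>R (l powr q)"
              proof (cases "x \<in> J")
                case True
                have "gmax U (\<lambda>_. l) x \<le> l" by (rule gmax_le[OF U(1)]) (use l in auto)
                then show ?thesis using True q gmax_nonneg[OF U(1)] by (auto intro!: powr_mono2)
              next
                case False
                then have "x \<notin> \<Union>U" using U(3) by auto
                then show ?thesis using gmax_outside[OF U(1)] by simp
              qed
            qed (use q in simp)
            also have "(\<integral>x. indicator J x *\<^sub>R (l powr q) \<partial>lebesgue) = l powr q * vol J"
              using D_integral_const[OF J, of "l powr q"] by (simp add: set_lebesgue_integral_def)
            finally show ?thesis by (simp add: mult_left_mono)
          qed
          have Tp: "(\<integral>x. norm (?T x) powr p \<partial>lebesgue) \<le> C * (c * vol J)" by (rule bdd_test[OF b J U(1-3)])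
          have "(\<integral>x. (norm (?T x))\<^sup>2 \<partial>lebesgue) = (\<integral>x. norm (?T x) * norm (?T x) \<partial>lebesgue)" by (simp add: power2_eq_square)
          also have "\<dots> \<le> (\<integral>x. norm (?T x) powr p \<partial>lebesgue) powr (1/p) * (\<integral>x. norm (?T x) powr q \<partial>lebesgue) powr (1/q)"
            by (rule Holder_integral(2)[OF p q pq]) (use iT p q in auto)
          also have "\<dots> \<le> (C * (c * vol J)) powr (1/p) * ((loc_const * sqrt M * q) powr q * (l powr q * vol J)) powr (1/q)"
            using Tp Tq p q by (intro mult_mono powr_mono2) (auto intro!: integral_nonneg_AE)
          also have "\<dots> = K * sqrt M * (vol J powr (1/p) * vol J powr (1/q))"
            using b c v lc M0 q l by (simp add: powr_mult powr_powr K_def)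
          also have "vol J powr (1/p) * vol J powr (1/q) = vol J"
            using v pq by (simp add: powr_add[symmetric])
          finally show ?thesis .
        qed
        have "(\<Sum>I\<in>U. ?c I) \<le> l\<^sup>2 * (\<Sum>I\<in>U. \<Sum>e\<in>sigS. (mnorm (N I e ** Vi J))\<^sup>2)"
        proof (intro sq_sum_mono mnorm_nonneg)
          fix I e assume I: "I \<in> U"
          then have ID: "I \<in> D" using U by auto
          have "mnorm (N I e ** Vi I) \<le> mnorm (N I e ** Vi J) * mnorm (V J ** Vi I)" by (rule change_inverse[OF ID J])
          also have "\<dots> \<le> mnorm (N I e ** Vi J) * l" by (intro mult_left_mono mnorm_nonneg Ub I)
          finally show "mnorm (N I e ** Vi I) \<le> l * mnorm (N I e ** Vi J)" by (simp add: mult.commute)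
        qed
        also have "\<dots> \<le> l\<^sup>2 * (\<Sum>k\<in>(UNIV::'n set). K * sqrt M * vol J)"
          by (intro mult_left_mono order.trans[OF mnorm_sum_basis[OF U(1,2)]] sum_mono each) auto
        finally show "(\<Sum>I | I \<in> F \<and> I \<subseteq> J \<and> (\<forall>K\<in>D. I \<subseteq> K \<longrightarrow> K \<subset> J \<longrightarrow> \<not> stop l J K). ?c I) \<le> (l\<^sup>2 * (CARD('n) * (K * sqrt M))) * vol J"
          by (simp add: U_def mult.assoc)
      qed (use K M0 in auto)
      moreover have "2 * (l\<^sup>2 * (CARD('n) * (K * sqrt M))) = L * sqrt M" by (simp add: L_def)
      moreover have "0 \<le> L * sqrt M" using L M0 by (intro mult_nonneg_nonneg) auto
      ultimately show ?thesis unfolding S_def by simp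
    qed
    \<comment> \<open>A crude admissible constant, available because \<open>F\<close> is finite: a
      cube inside \<open>J\<close> has volume at most \<open>vol J\<close>. It makes
      \<open>S\<close> nonempty.\<close>
    define M0 where "M0 = (\<Sum>I\<in>F. ?c I / vol I)"
    have M0: "M0 \<in> S"
      unfolding S_def
    proof (intro CollectI conjI ballI)
      have t0: "0 \<le> ?c I / vol I" if "I \<in> F" for I
        using that F(2) by (intro divide_nonneg_nonneg c0 less_imp_le[OF D_vol_pos]) auto
      then show "0 \<le> M0" unfolding M0_def by (intro sum_nonneg)
      fix J assume J: "J \<in> D"
      have "(\<Sum>I | I \<in> F \<and> I \<subseteq> J. ?c I) \<le> (\<Sum>I | I \<in> F \<and> I \<subseteq> J. ?c I / vol I * vol J)"
      proof (rule sum_mono)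
        fix I assume "I \<in> {I. I \<in> F \<and> I \<subseteq> J}"
        then have I: "I \<in> F" "I \<in> D" "I \<subseteq> J" using F by auto
        have "vol I \<le> vol J" unfolding vol_def
          by (rule measure_mono_fmeasurable[OF I(3) D_sets[OF I(2)] D_lmeasurable[OF J]])
        then have "?c I / vol I * vol I \<le> ?c I / vol I * vol J" using t0[OF I(1)] by (rule mult_left_mono)
        then show "?c I \<le> ?c I / vol I * vol J" using D_vol_pos[OF I(2)] by simp
      qed
      also have "\<dots> \<le> (\<Sum>I\<in>F. ?c I / vol I * vol J)"
      proof (rule sum_mono2[OF F(1)])
        fix I assume "I \<in> F - {I. I \<in> F \<and> I \<subseteq> J}"
        then have "I \<in> F" by simp
        then show "0 \<le> ?c I / vol I * vol J"
          by (intro mult_nonneg_nonneg t0 less_imp_le[OF D_vol_pos[OF J]])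
      qed simp
      finally show "(\<Sum>I | I \<in> F \<and> I \<subseteq> J. ?c I) \<le> M0 * vol J" by (simp add: M0_def sum_distrib_right)
    qed
    define m where "m = Inf S"
    have bb: "bdd_below S" by (rule bdd_belowI[of _ 0]) (auto simp: S_def)
    have mS: "m \<in> S"
      unfolding S_def
    proof (intro CollectI conjI ballI)
      show "0 \<le> m" unfolding m_def by (rule cInf_greatest) (use M0 in \<open>auto simp: S_def\<close>)
      fix J assume J: "J \<in> D"
      have v: "vol J > 0" by (rule D_vol_pos[OF J])
      have "(\<Sum>I | I \<in> F \<and> I \<subseteq> J. ?c I) / vol J \<le> m"
        unfolding m_def
      proof (rule cInf_greatest)
        fix M assume "M \<in> S"
        then have "(\<Sum>I | I \<in> F \<and> I \<subseteq> J. ?c I) \<le> M * vol J" using J unfolding S_def by blast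
        then show "(\<Sum>I | I \<in> F \<and> I \<subseteq> J. ?c I) / vol J \<le> M" using v by (simp only: pos_divide_le_eq)
      qed (use M0 in auto)
      then show "(\<Sum>I | I \<in> F \<and> I \<subseteq> J. ?c I) \<le> m * vol J" using v by (simp only: pos_divide_le_eq)
    qed
    have m0: "0 \<le> m" using mS by (simp add: S_def)
    \<comment> \<open>The infimum is itself admissible, so its improvement is admissible too and
      cannot be smaller.\<close>
    have "m \<le> L * sqrt m" unfolding m_def[symmetric] using cInf_lower[OF imp[OF mS] bb] by (simp add: m_def)
    then have "m \<le> L\<^sup>2"
    proof (cases "m = 0")
      case False
      then have sm: "sqrt m > 0" using m0 by simp
      have "sqrt m * sqrt m \<le> L * sqrt m" using \<open>m \<le> L * sqrt m\<close> m0 by simp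
      then have "sqrt m \<le> L" using sm by (simp only: mult_le_cancel_right_pos)
      then have "(sqrt m)\<^sup>2 \<le> L\<^sup>2" using m0 by (intro power_mono) auto
      then show ?thesis using m0 by simp
    qed simp
    then have "m * vol J0 \<le> L\<^sup>2 * vol J0" using D_vol_pos[OF J0] by (intro mult_right_mono) auto
    moreover have "(\<Sum>I | I \<in> F \<and> I \<subseteq> J0. ?c I) \<le> m * vol J0" using mS J0 unfolding S_def by blast
    ultimately show "(\<Sum>I | I \<in> F \<and> I \<subseteq> J0. ?c I) \<le> L\<^sup>2 * vol J0" by linarith
  qed
  then show ?thesis by (intro exI[of _ "L\<^sup>2"]) auto
qed

end

section \<open>Matrix weights give dual pairs\<close>

lemma locally_integrable_measurable:
  fixes W :: "real^'d \<Rightarrow> complex^'n^'n"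
  assumes "locally_integrable_mat W" shows "W \<in> borel_measurable lebesgue"
proof -
  have ij: "(\<lambda>x. W x $ i $ j) \<in> borel_measurable lebesgue" for i j
  proof (rule borel_measurable_LIMSEQ_metric)
    fix n
    show "(\<lambda>x. indicat_real (cball 0 (real n)) x *\<^sub>R (W x $ i $ j)) \<in> borel_measurable lebesgue"
      using assms unfolding locally_integrable_mat_def set_integrable_def by (intro borel_measurable_integrable) auto
  next
    fix x :: "real^'d"
    obtain n :: nat where n: "norm x \<le> real n" using real_arch_simple by blast
    have "\<forall>\<^sub>F m in sequentially. indicat_real (cball 0 (real m)) x *\<^sub>R (W x $ i $ j) = W x $ i $ j"
      using eventually_ge_at_top[of n] by eventually_elim (use n in auto)
    then show "(\<lambda>m. indicat_real (cball 0 (real m)) x *\<^sub>R (W x $ i $ j)) \<longlonglongrightarrow> W x $ i $ j"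
      by (rule tendsto_eventually)
  qed
  show ?thesis
    unfolding borel_measurable_euclidean_space[of W]
  proof
    fix b :: "complex^'n^'n" assume "b \<in> Basis"
    then obtain i j u where "b = axis i (axis j u)" by (auto simp: Basis_vec_def)
    then have "(\<lambda>x. W x \<bullet> b) = (\<lambda>x. W x $ i $ j \<bullet> u)" by (simp add: inner_axis)
    then show "(\<lambda>x. W x \<bullet> b) \<in> borel_measurable lebesgue" using ij[of i j] by simp
  qed
qed

lemma posdef_mat_1: "posdef (mat 1 :: complex^'n^'n)"
proof -
  have "mat_adj (mat 1 :: complex^'n^'n) = mat 1" by (auto simp: mat_adj_def mat_def vec_eq_iff)
  then show ?thesis unfolding posdef_alt by simp
qed

lemma mnorm_le_unit:
  fixes M :: "complex^'n^'m"
  assumes "\<And>e. norm e \<le> 1 \<Longrightarrow> norm (M *v e) \<le> s" shows "mnorm M \<le> s"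
proof (rule mnorm_le)
  fix v :: "complex^'n"
  show "norm (M *v v) \<le> s * norm v"
  proof (cases "v = 0")
    case False
    have "M *v (v /\<^sub>R norm v) = (M *v v) /\<^sub>R norm v" by (simp add: linear_scale[OF matrix_vector_mul_linear])
    then have "norm (M *v v) / norm v \<le> s" using assms[of "v /\<^sub>R norm v"] False by (simp add: divide_inverse mult.commute)
    then show ?thesis using False by (simp add: divide_le_eq)
  qed simp
qed

lemma enn_powr_ennreal: "0 \<le> b \<Longrightarrow> enn_powr (ennreal b) r = ennreal (b powr r)"
  by (simp add: enn_powr_def)

context grid
begin

lemma set_nn_integral_eq:
  fixes f :: "_ \<Rightarrow> real"
  assumes "set_integrable lebesgue I f" "\<And>x. 0 \<le> f x"
  shows "(\<integral>\<^sup>+x\<in>I. ennreal (f x) \<partial>lebesgue) = ennreal (LINT x:I|lebesgue. f x)"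
proof -
  have "(\<integral>\<^sup>+x\<in>I. ennreal (f x) \<partial>lebesgue) = (\<integral>\<^sup>+x. ennreal (indicator I x *\<^sub>R f x) \<partial>lebesgue)"
    by (intro nn_integral_cong) (auto simp: indicator_def)
  also have "\<dots> = ennreal (LINT x:I|lebesgue. f x)"
    unfolding set_lebesgue_integral_def
    by (rule nn_integral_eq_integral) (use assms in \<open>auto simp: set_integrable_def\<close>)
  finally show ?thesis .
qed

text \<open>\<open>R\<close> is a measurable representative of the power of the weight that is
  defined everywhere. Integrability of its vector norms is part of the conclusion: the reducing
  property bounds the integral by a finite number.\<close>

lemma reducing_ops_bounds:
  fixes X :: "real^'d \<Rightarrow> complex^'n^'n"
  assumes red: "reducing_ops X s Vx" and s: "1 < s"
    and R: "R \<in> borel_measurable lebesgue" and ae: "AE x in lebesgue. mpow (X x) (1/s) = R x"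
  shows "\<exists>c\<ge>1. \<forall>I\<in>D. posdef (Vx I) \<and> (\<forall>e. set_integrable lebesgue I (\<lambda>x. norm (R x *v e) powr s) \<and>
     (LINT x:I|lebesgue. norm (R x *v e) powr s) \<le> c * (vol I * norm (Vx I *v e) powr s) \<and>
     vol I * norm (Vx I *v e) powr s \<le> c * (LINT x:I|lebesgue. norm (R x *v e) powr s))"
proof -
  obtain c0 C0 where c0: "c0 > 0" "C0 > 0" and rd: "\<And>I. is_cube I \<Longrightarrow> posdef (Vx I) \<and>
     (\<forall>e. let Z = enn_powr (ennreal (1 / vol I) *
                     (\<integral>\<^sup>+ x\<in>I. ennreal (norm (mpow (X x) (1/s) *v e) powr s) \<partial>lebesgue)) (1/s)
          in ennreal c0 * Z \<le> ennreal (norm (Vx I *v e)) \<and> ennreal (norm (Vx I *v e)) \<le> ennreal C0 * Z)"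
    using red unfolding reducing_ops_def by blast
  define c where "c = max 1 (max (C0 powr s) (c0 powr (- s)))"
  show ?thesis
  proof (rule exI[of _ c], intro conjI ballI allI)
    show "1 \<le> c" by (simp add: c_def)
    fix I assume I: "I \<in> D"
    show "posdef (Vx I)" using rd[OF D_is_cube[OF I]] by blast
    fix e
    have v: "vol I > 0" by (rule D_vol_pos[OF I])
    define f where "f x = norm (R x *v e) powr s" for x
    have Rm [measurable]: "(\<lambda>x. R x *v e) \<in> borel_measurable lebesgue"
    proof -
      have "(\<lambda>M :: complex^'n^'n. M *v e) \<in> borel_measurable borel"
        unfolding matrix_vector_mult_def
        by (intro borel_measurable_continuous_onI continuous_on_vec_lambda continuous_intros continuous_on_component)
      from measurable_compose[OF R this] show ?thesis .
    qed
    have fm [measurable]: "f \<in> borel_measurable lebesgue" unfolding f_def by measurable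
    note [measurable] = D_sets[OF I]
    let ?Y = "\<integral>\<^sup>+ x\<in>I. ennreal (f x) \<partial>lebesgue"
    have Y: "(\<integral>\<^sup>+ x\<in>I. ennreal (norm (mpow (X x) (1/s) *v e) powr s) \<partial>lebesgue) = ?Y"
      by (rule nn_integral_cong_AE) (use ae in eventually_elim, simp add: f_def)
    define t where "t = norm (Vx I *v e)"
    have b: "ennreal c0 * enn_powr (ennreal (1 / vol I) * ?Y) (1/s) \<le> ennreal t"
      "ennreal t \<le> ennreal C0 * enn_powr (ennreal (1 / vol I) * ?Y) (1/s)"
      using rd[OF D_is_cube[OF I], THEN conjunct2, THEN spec, of e, unfolded Let_def Y] unfolding t_def
      by (rule conjunct1, rule conjunct2)
    \<comment> \<open>An infinite integral would force \<open>norm (Vx I *v e)\<close> to be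
      infinite.\<close>
    have "?Y < top"
    proof (rule ccontr)
      assume "\<not> ?Y < top"
      then have "?Y = top" using less_top[of ?Y] by blast
      then have "enn_powr (ennreal (1 / vol I) * ?Y) (1/s) = top" using v by (simp add: enn_powr_def ennreal_mult_top)
      then show False using b(1) c0 by (simp add: ennreal_mult_top top_unique)
    qed
    then have "integrable lebesgue (\<lambda>x. indicator I x *\<^sub>R f x)"
    proof (intro integrableI_nonneg)
      have "(\<integral>\<^sup>+ x. ennreal (indicator I x *\<^sub>R f x) \<partial>lebesgue) = ?Y"
        by (intro nn_integral_cong) (auto simp: indicator_def)
      also assume "?Y < top"
      finally show "(\<integral>\<^sup>+ x. ennreal (indicator I x *\<^sub>R f x) \<partial>lebesgue) < \<infinity>" by simp
    qed (auto simp: f_def)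
    then have fi: "set_integrable lebesgue I f" by (simp add: set_integrable_def)
    then show "set_integrable lebesgue I (\<lambda>x. norm (R x *v e) powr s)" by (simp add: f_def[abs_def])
    define z where "z = (LINT x:I|lebesgue. f x)"
    have z: "0 \<le> z" unfolding z_def set_lebesgue_integral_def f_def by (intro integral_nonneg_AE) auto
    have Yz: "?Y = ennreal z" unfolding z_def by (rule set_nn_integral_eq[OF fi]) (simp add: f_def)
    have "ennreal (1 / vol I) * ?Y = ennreal (z / vol I)" using v z by (simp add: Yz ennreal_mult'[symmetric])
    then have e: "enn_powr (ennreal (1 / vol I) * ?Y) (1/s) = ennreal ((z / vol I) powr (1/s))"
      using v z by (simp add: enn_powr_ennreal)
    have t: "0 \<le> t" by (simp add: t_def)
    have b1: "c0 * (z / vol I) powr (1/s) \<le> t"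
      using b(1) t c0 unfolding e by (simp add: ennreal_mult'[symmetric])
    have b2: "t \<le> C0 * (z / vol I) powr (1/s)"
      using b(2) t c0 unfolding e by (simp add: ennreal_mult'[symmetric])
    have "(c0 * (z / vol I) powr (1/s)) powr s \<le> t powr s" using b1 s c0 by (intro powr_mono2) auto
    then have "c0 powr s * (z / vol I) \<le> t powr s" using s c0 z v by (simp add: powr_mult powr_powr)
    then have "z \<le> c0 powr (- s) * (vol I * t powr s)" using c0 v by (simp add: powr_minus field_simps)
    also have "\<dots> \<le> c * (vol I * t powr s)" using v by (intro mult_right_mono) (auto simp: c_def)
    finally show "(LINT x:I|lebesgue. norm (R x *v e) powr s) \<le> c * (vol I * norm (Vx I *v e) powr s)"
      by (simp add: z_def f_def t_def)
    have "t powr s \<le> (C0 * (z / vol I) powr (1/s)) powr s" using b2 s t by (intro powr_mono2) auto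
    also have "\<dots> = C0 powr s * (z / vol I)" using s c0 z v by (simp add: powr_mult powr_powr)
    finally have "vol I * t powr s \<le> C0 powr s * z" using v by (simp add: field_simps)
    also have "\<dots> \<le> c * z" using z by (intro mult_right_mono) (auto simp: c_def)
    finally show "vol I * norm (Vx I *v e) powr s \<le> c * (LINT x:I|lebesgue. norm (R x *v e) powr s)"
      by (simp add: z_def f_def t_def)
  qed
qed

text \<open>For fixed \<open>x\<close> the inner average of the A_p condition controls the norm of
  \<open>Vd I ** P x\<close>, hence that of its adjoint \<open>P x ** Vd I\<close>. Integrating the
  \<open>p\<close>-th power in \<open>x\<close> and applying \<open>P_ge\<close> to the vector
  \<open>Vd I *v e\<close> gives the product bound.\<close>

lemma Ap_bound:
  fixes W :: "real^'d \<Rightarrow> complex^'n^'n"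
  assumes p: "1 < p" and q: "q = p / (p - 1)" and W: "matrix_Ap p W"
    and aeP: "AE x in lebesgue. mpow (W x) (1/p) = P x" and aeQ: "AE x in lebesgue. mpow (W x) (-1/p) = Q x"
    and Ps: "\<And>x. mat_adj (P x) = P x" and Qs: "\<And>x. mat_adj (Q x) = Q x" and c: "1 \<le> c"
    and Vdp: "\<And>I. I \<in> D \<Longrightarrow> posdef (Vd I)"
    and Pi: "\<And>I e. I \<in> D \<Longrightarrow> set_integrable lebesgue I (\<lambda>x. norm (P x *v e) powr p)"
    and Qi: "\<And>I e. I \<in> D \<Longrightarrow> set_integrable lebesgue I (\<lambda>x. norm (Q x *v e) powr q)"
    and P_ge: "\<And>I e. I \<in> D \<Longrightarrow> vol I * norm (V I *v e) powr p \<le> c * (LINT x:I|lebesgue. norm (P x *v e) powr p)"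
    and Q_ge: "\<And>I e. I \<in> D \<Longrightarrow> vol I * norm (Vd I *v e) powr q \<le> c * (LINT x:I|lebesgue. norm (Q x *v e) powr q)"
  shows "\<exists>k. \<forall>I\<in>D. mnorm (V I ** Vd I) \<le> k"
proof -
  have q1: "1 < q" using p by (simp add: q field_simps)
  define inn where "inn I x = ennreal (1 / vol I) * (\<integral>\<^sup>+ t\<in>I. ennreal (mnorm (mpow (W x) (1/p) ** mpow (W t) (-1/p)) powr q) \<partial>lebesgue)" for I x
  let ?S = "SUP I\<in>Collect is_cube. ennreal (1 / vol I) * (\<integral>\<^sup>+ x\<in>I. enn_powr (inn I x) (p / q) \<partial>lebesgue)"
  have "?S < top" using W unfolding matrix_Ap_def inn_def q by blast
  then obtain k where k: "0 \<le> k" "?S = ennreal k" by (cases ?S) auto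
  have Sk: "ennreal (1 / vol I) * (\<integral>\<^sup>+ x\<in>I. enn_powr (inn I x) (p / q) \<partial>lebesgue) \<le> ennreal k" if "I \<in> D" for I
    unfolding k(2)[symmetric] by (rule SUP_upper) (use D_is_cube[OF that] in simp)
  define K where "K = (c * (k * c powr (p/q))) powr (1/p)"
  have "mnorm (V I ** Vd I) \<le> K" if I: "I \<in> D" for I
  proof (rule mnorm_le_unit)
    fix e :: "complex^'n" assume e: "norm e \<le> 1"
    have v: "vol I > 0" by (rule D_vol_pos[OF I])
    define u where "u = Vd I *v e"
    have key: "AE x in lebesgue. ennreal (norm (P x *v u) powr p / c powr (p/q)) \<le> enn_powr (inn I x) (p / q)"
      using aeP
    proof eventually_elim
      case (elim x)
      show ?case
      proof (cases "inn I x = top")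
        \<comment> \<open>An infinite inner average makes the right-hand side \<open>top\<close>, so
          only finite ones need work.\<close>
        case True then show ?thesis by (simp add: enn_powr_def)
      next
        case False
        then obtain b where b: "0 \<le> b" "inn I x = ennreal b" by (cases "inn I x") auto
        have "norm (Vd I *v (P x *v e')) \<le> (c * b) powr (1/q)" if e': "norm e' \<le> 1" for e'
        proof -
          let ?y = "P x *v e'"
          define z where "z = (LINT t:I|lebesgue. norm (Q t *v ?y) powr q)"
          have z: "0 \<le> z" unfolding z_def set_lebesgue_integral_def by (intro integral_nonneg_AE) auto
          have "ennreal z = (\<integral>\<^sup>+ t\<in>I. ennreal (norm (Q t *v ?y) powr q) \<partial>lebesgue)"
            unfolding z_def by (rule set_nn_integral_eq[symmetric, OF Qi[OF I]]) simp
          also have "\<dots> \<le> (\<integral>\<^sup>+ t\<in>I. ennreal (mnorm (mpow (W x) (1/p) ** mpow (W t) (-1/p)) powr q) \<partial>lebesgue)"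
          proof (rule nn_integral_mono_AE, use aeQ in eventually_elim)
            fix t assume t: "mpow (W t) (-1/p) = Q t"
            have "norm (Q t *v ?y) \<le> mnorm (Q t ** P x) * norm e'"
              unfolding matrix_vector_mul_assoc by (rule mnorm_ge)
            also have "\<dots> \<le> mnorm (Q t ** P x)" using e' mnorm_nonneg[of "Q t ** P x"] by (simp add: mult_left_le)
            also have "\<dots> = mnorm (P x ** Q t)" using mnorm_mat_adj[of "Q t ** P x"] by (simp add: mat_adj_mult Ps Qs)
            finally have "norm (Q t *v ?y) powr q \<le> mnorm (mpow (W x) (1/p) ** mpow (W t) (-1/p)) powr q"
              unfolding elim t using q1 by (intro powr_mono2) auto
            then show "ennreal (norm (Q t *v ?y) powr q) * indicator I t
              \<le> ennreal (mnorm (mpow (W x) (1/p) ** mpow (W t) (-1/p)) powr q) * indicator I t"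
              by (intro mult_right_mono ennreal_leI) auto
          qed
          finally have "ennreal (1 / vol I) * ennreal z \<le> inn I x"
            unfolding inn_def by (intro mult_left_mono) auto
          then have "z / vol I \<le> b" using v z b by (simp add: ennreal_mult'[symmetric])
          then have zb: "z \<le> b * vol I" using v by (simp add: divide_le_eq)
          have "vol I * norm (Vd I *v ?y) powr q \<le> c * z" unfolding z_def by (rule Q_ge[OF I])
          also have "\<dots> \<le> c * (b * vol I)" using c zb by (intro mult_left_mono) auto
          finally have "vol I * norm (Vd I *v ?y) powr q \<le> vol I * (c * b)" by (simp add: ac_simps)
          then have "norm (Vd I *v ?y) powr q \<le> c * b" using v by simp
          then have "(norm (Vd I *v ?y) powr q) powr (1/q) \<le> (c * b) powr (1/q)"
            using q1 by (intro powr_mono2) auto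
          then show ?thesis using q1 by (simp add: powr_powr)
        qed
        then have mn: "mnorm (Vd I ** P x) \<le> (c * b) powr (1/q)"
          by (intro mnorm_le_unit) (simp add: matrix_vector_mul_assoc)
        have "norm (P x *v u) \<le> mnorm (P x ** Vd I) * norm e"
          unfolding u_def matrix_vector_mul_assoc by (rule mnorm_ge)
        also have "\<dots> \<le> mnorm (P x ** Vd I)" using e mnorm_nonneg[of "P x ** Vd I"] by (simp add: mult_left_le)
        also have "\<dots> = mnorm (Vd I ** P x)"
          using mnorm_mat_adj[of "P x ** Vd I"] by (simp add: mat_adj_mult Ps posdef_adj[OF Vdp[OF I]])
        also note mn
        finally have "norm (P x *v u) powr p \<le> ((c * b) powr (1/q)) powr p" using p by (intro powr_mono2) auto
        also have "\<dots> = c powr (p/q) * b powr (p/q)" using c b by (simp add: powr_powr powr_mult)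
        finally have "norm (P x *v u) powr p / c powr (p/q) \<le> b powr (p/q)" using c by (simp add: divide_le_eq mult.commute)
        then show ?thesis using b by (simp add: enn_powr_ennreal ennreal_leI)
      qed
    qed
    define z where "z = (LINT x:I|lebesgue. norm (P x *v u) powr p / c powr (p/q))"
    have zi: "set_integrable lebesgue I (\<lambda>x. norm (P x *v u) powr p / c powr (p/q))"
      using Pi[OF I, of u] by simp
    have z: "0 \<le> z" unfolding z_def set_lebesgue_integral_def by (intro integral_nonneg_AE) auto
    have "ennreal z = (\<integral>\<^sup>+ x\<in>I. ennreal (norm (P x *v u) powr p / c powr (p/q)) \<partial>lebesgue)"
      unfolding z_def by (rule set_nn_integral_eq[symmetric, OF zi]) simp
    also have "\<dots> \<le> (\<integral>\<^sup>+ x\<in>I. enn_powr (inn I x) (p / q) \<partial>lebesgue)"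
      by (rule nn_integral_mono_AE, use key in eventually_elim) (auto intro!: mult_right_mono)
    finally have "ennreal (1 / vol I) * ennreal z \<le> ennreal k"
      using Sk[OF I] by (meson mult_left_mono order.trans zero_le)
    then have "z / vol I \<le> k" using v z k by (simp add: ennreal_mult'[symmetric])
    then have zk: "z \<le> k * vol I" using v by (simp add: divide_le_eq)
    have zz: "(LINT x:I|lebesgue. norm (P x *v u) powr p) = z * c powr (p/q)"
      using c by (simp add: z_def)
    have "vol I * norm (V I *v u) powr p \<le> c * (z * c powr (p/q))" unfolding zz[symmetric] by (rule P_ge[OF I])
    also have "\<dots> \<le> c * (k * vol I * c powr (p/q))" using c zk by (intro mult_left_mono mult_right_mono) auto
    finally have "vol I * norm (V I *v u) powr p \<le> vol I * (c * (k * c powr (p/q)))" by (simp add: ac_simps)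
    then have "norm (V I *v u) powr p \<le> c * (k * c powr (p/q))" using v by simp
    then have "(norm (V I *v u) powr p) powr (1/p) \<le> K" unfolding K_def using p by (intro powr_mono2) auto
    then show "norm ((V I ** Vd I) *v e) \<le> K" using p by (simp add: powr_powr u_def matrix_vector_mul_assoc)
  qed
  then show ?thesis by blast
qed

lemma weight_pair_exists:
  fixes W :: "real^'d \<Rightarrow> complex^'n^'n"
  assumes p: "1 < p" and q: "q = p / (p - 1)" and W: "matrix_Ap p W"
    and V: "reducing_ops W p V" and Vd: "reducing_ops (\<lambda>x. mpow (W x) (1 - q)) q Vd"
  obtains P Q c where "weight_pair D p q P Q V Vd c"
    and "AE x in lebesgue. mpow (W x) (-1/p) = Q x"
    and "AE x in lebesgue. mpow (mpow (W x) (1 - q)) (-1/q) = P x"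
proof -
  have q1: "1 < q" and pq: "1 / p + 1 / q = 1" using p by (simp_all add: q field_simps)
  \<comment> \<open>These exponents say that passing to the dual weight and exponent exchanges the
    roles of \<open>P\<close> and \<open>Q\<close>.\<close>
  have e1: "(1 - q) * (1 / q) = -1/p" and e2: "(1 - q) * (-1/q) = 1/p"
    using p by (simp_all add: q field_simps)
  have Wm: "W \<in> borel_measurable lebesgue" and Wp: "AE x in lebesgue. posdef (W x)"
    using W locally_integrable_measurable unfolding matrix_Ap_def matrix_weight_def by auto
  \<comment> \<open>Redefining the weight as the identity on a null set makes all matrix identities
    of the locale hold at every point.\<close>
  define W0 where "W0 x = (if posdef (W x) then W x else mat 1)" for x
  have W0p: "posdef (W0 x)" for x by (simp add: W0_def posdef_mat_1)
  have W0m: "W0 \<in> borel_measurable lebesgue"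
    by (rule borel_measurable_AE[OF Wm]) (use Wp in eventually_elim, simp add: W0_def)
  define P Q where "P x = mpow (W0 x) (1/p)" and "Q x = mpow (W0 x) (-1/p)" for x
  have Pm: "P \<in> borel_measurable lebesgue" and Qm: "Q \<in> borel_measurable lebesgue"
    unfolding P_def Q_def by (rule mpow_measurable[OF W0m W0p])+
  have aeP: "AE x in lebesgue. mpow (W x) (1/p) = P x"
    using Wp by eventually_elim (simp add: P_def W0_def)
  have aeQ: "AE x in lebesgue. mpow (W x) (-1/p) = Q x"
    using Wp by eventually_elim (simp add: Q_def W0_def)
  have aeQ': "AE x in lebesgue. mpow (mpow (W x) (1 - q)) (1/q) = Q x"
    using Wp by eventually_elim (simp only: mpow_mpow e1, simp add: Q_def W0_def)
  have aeP': "AE x in lebesgue. mpow (mpow (W x) (1 - q)) (-1/q) = P x"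
    using Wp by eventually_elim (simp only: mpow_mpow e2, simp add: P_def W0_def)
  obtain c1 where c1: "1 \<le> c1" and b1: "\<forall>I\<in>D. posdef (V I) \<and> (\<forall>e. set_integrable lebesgue I (\<lambda>x. norm (P x *v e) powr p) \<and>
     (LINT x:I|lebesgue. norm (P x *v e) powr p) \<le> c1 * (vol I * norm (V I *v e) powr p) \<and>
     vol I * norm (V I *v e) powr p \<le> c1 * (LINT x:I|lebesgue. norm (P x *v e) powr p))"
    using reducing_ops_bounds[OF V p Pm aeP] by blast
  obtain c2 where c2: "1 \<le> c2" and b2: "\<forall>I\<in>D. posdef (Vd I) \<and> (\<forall>e. set_integrable lebesgue I (\<lambda>x. norm (Q x *v e) powr q) \<and>
     (LINT x:I|lebesgue. norm (Q x *v e) powr q) \<le> c2 * (vol I * norm (Vd I *v e) powr q) \<and>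
     vol I * norm (Vd I *v e) powr q \<le> c2 * (LINT x:I|lebesgue. norm (Q x *v e) powr q))"
    using reducing_ops_bounds[OF Vd q1 Qm aeQ'] by blast
  have Ps: "mat_adj (P x) = P x" "mat_adj (Q x) = Q x" for x
    unfolding P_def Q_def by (intro posdef_adj mpow_posdef W0p)+
  have v0: "0 \<le> vol I" if "I \<in> D" for I using D_vol_pos[OF that] by simp
  have l0: "0 \<le> (LINT x:I|lebesgue. norm (R x *v e) powr r)" for I r and R :: "real^'d \<Rightarrow> complex^'n^'n" and e
    unfolding set_lebesgue_integral_def by (intro integral_nonneg_AE) auto
  have up: "X \<le> c * Y" if "X \<le> c' * Y" "c' \<le> c" "0 \<le> Y" for X Y c c' :: real
    using that by (meson mult_right_mono order.trans)
  define c3 where "c3 = max c1 c2"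
  have c3: "1 \<le> c3" "c1 \<le> c3" "c2 \<le> c3" using c1 by (auto simp: c3_def)
  obtain k where k: "\<And>I. I \<in> D \<Longrightarrow> mnorm (V I ** Vd I) \<le> k"
  proof -
    have "\<exists>k. \<forall>I\<in>D. mnorm (V I ** Vd I) \<le> k"
    proof (rule Ap_bound[OF p q W aeP aeQ Ps c3(1)])
      fix I e assume I: "I \<in> D"
      show "posdef (Vd I)" "set_integrable lebesgue I (\<lambda>x. norm (P x *v e) powr p)"
        "set_integrable lebesgue I (\<lambda>x. norm (Q x *v e) powr q)" using b1 b2 I by blast+
      show "vol I * norm (V I *v e) powr p \<le> c3 * (LINT x:I|lebesgue. norm (P x *v e) powr p)"
        using b1 I by (intro up[OF _ c3(2) l0]) blast
      show "vol I * norm (Vd I *v e) powr q \<le> c3 * (LINT x:I|lebesgue. norm (Q x *v e) powr q)"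
        using b2 I by (intro up[OF _ c3(3) l0]) blast
    qed
    then show ?thesis using that by blast
  qed
  define c where "c = max c3 k"
  have c: "1 \<le> c" "c1 \<le> c" "c2 \<le> c" "k \<le> c" using c3 by (auto simp: c_def)
  have "weight_pair D p q P Q V Vd c"
  proof
    show "1 < p" "1 < q" "1 / p + 1 / q = 1" "1 \<le> c" by (fact p q1 pq c)+
    show "P \<in> borel_measurable lebesgue" "Q \<in> borel_measurable lebesgue" by (fact Pm Qm)+
    show "mat_adj (P x) = P x" "mat_adj (Q x) = Q x" for x by (fact Ps)+
    show "P x ** Q x = mat 1" "Q x ** P x = mat 1" for x
      unfolding P_def Q_def by (simp_all add: mpow_mult[OF W0p] mpow_0[OF W0p])
  next
    fix I e assume I: "I \<in> D"
    show "posdef (V I)" "posdef (Vd I)" "set_integrable lebesgue I (\<lambda>x. norm (P x *v e) powr p)"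
      "set_integrable lebesgue I (\<lambda>x. norm (Q x *v e) powr q)" using b1 b2 I by blast+
    show "(LINT x:I|lebesgue. norm (P x *v e) powr p) \<le> c * (vol I * norm (V I *v e) powr p)"
      by (rule up[OF _ c(2)]) (use b1 I v0[OF I] in auto)
    show "vol I * norm (V I *v e) powr p \<le> c * (LINT x:I|lebesgue. norm (P x *v e) powr p)"
      by (rule up[OF _ c(2) l0]) (use b1 I in blast)
    show "(LINT x:I|lebesgue. norm (Q x *v e) powr q) \<le> c * (vol I * norm (Vd I *v e) powr q)"
      by (rule up[OF _ c(3)]) (use b2 I v0[OF I] in auto)
    show "vol I * norm (Vd I *v e) powr q \<le> c * (LINT x:I|lebesgue. norm (Q x *v e) powr q)"
      by (rule up[OF _ c(3) l0]) (use b2 I in blast)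
    show "mnorm (V I ** Vd I) \<le> c" using k[OF I] c(4) by linarith
  qed
  then show ?thesis using aeQ aeP' that by blast
qed

section \<open>From extended real suprema to finite families\<close>

lemma SUP_vol_finite_iff:
  "(SUP J\<in>D. ennreal (1 / vol J) * g J) < top \<longleftrightarrow> (\<exists>B\<ge>0. \<forall>J\<in>D. g J \<le> ennreal (B * vol J))"
proof -
  have eq: "ennreal (1 / vol J) * g J \<le> ennreal B \<longleftrightarrow> g J \<le> ennreal (B * vol J)" if J: "J \<in> D" and B: "0 \<le> B" for J B
  proof -
    have v: "vol J > 0" by (rule D_vol_pos[OF J])
    have one: "ennreal (vol J) * ennreal (1 / vol J) = 1" using v by (simp add: ennreal_mult'[symmetric])
    show ?thesis
    proof
      assume "ennreal (1 / vol J) * g J \<le> ennreal B"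
      then have "ennreal (vol J) * (ennreal (1 / vol J) * g J) \<le> ennreal (vol J) * ennreal B" by (rule mult_left_mono) simp
      moreover have "ennreal (vol J) * (ennreal (1 / vol J) * g J) = g J"
        by (simp only: mult.assoc[symmetric] one mult_1_left)
      moreover have "ennreal (vol J) * ennreal B = ennreal (B * vol J)"
        unfolding ennreal_mult'[OF B] by (rule mult.commute)
      ultimately show "g J \<le> ennreal (B * vol J)" by (simp only:)
    next
      assume "g J \<le> ennreal (B * vol J)"
      then have "ennreal (1 / vol J) * g J \<le> ennreal (1 / vol J) * ennreal (B * vol J)" by (rule mult_left_mono) simp
      also have "\<dots> = ennreal B" using B v by (simp add: ennreal_mult'[symmetric])
      finally show "ennreal (1 / vol J) * g J \<le> ennreal B" .
    qed
  qed
  show ?thesis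
  proof
    let ?S = "SUP J\<in>D. ennreal (1 / vol J) * g J"
    assume "?S < top"
    then obtain B where B: "0 \<le> B" "?S = ennreal B" by (cases ?S) auto
    have "g J \<le> ennreal (B * vol J)" if "J \<in> D" for J
      unfolding eq[OF that B(1), symmetric] B(2)[symmetric] by (rule SUP_upper[OF that])
    then show "\<exists>B\<ge>0. \<forall>J\<in>D. g J \<le> ennreal (B * vol J)" using B by blast
  next
    assume "\<exists>B\<ge>0. \<forall>J\<in>D. g J \<le> ennreal (B * vol J)"
    then obtain B where B: "0 \<le> B" "\<And>J. J \<in> D \<Longrightarrow> g J \<le> ennreal (B * vol J)" by blast
    have "(SUP J\<in>D. ennreal (1 / vol J) * g J) \<le> ennreal B"
      by (rule SUP_least) (use B eq in auto)
    also have "\<dots> < top" by simp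
    finally show "(SUP J\<in>D. ennreal (1 / vol J) * g J) < top" .
  qed
qed

end

lemma infsum_ennreal_le_iff:
  fixes f :: "'a \<Rightarrow> ennreal"
  shows "infsum f A \<le> x \<longleftrightarrow> (\<forall>F. finite F \<longrightarrow> F \<subseteq> A \<longrightarrow> sum f F \<le> x)"
  by (subst nonneg_infsum_complete) (auto simp: SUP_le_iff)

context weight_pair
begin

lemma carl_sum_cong:
  fixes f :: "(real^'d) set \<Rightarrow> real"
  shows "(\<forall>F. finite F \<longrightarrow> F \<subseteq> dsub D J \<longrightarrow> (\<Sum>I\<in>F. f I) \<le> B) \<longleftrightarrow>
    (\<forall>F. finite F \<longrightarrow> F \<subseteq> D \<longrightarrow> (\<Sum>I | I \<in> F \<and> I \<subseteq> J. f I) \<le> B)"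
proof
  assume L: "\<forall>F. finite F \<longrightarrow> F \<subseteq> dsub D J \<longrightarrow> (\<Sum>I\<in>F. f I) \<le> B"
  show "\<forall>F. finite F \<longrightarrow> F \<subseteq> D \<longrightarrow> (\<Sum>I | I \<in> F \<and> I \<subseteq> J. f I) \<le> B"
  proof (intro allI impI)
    fix F assume "finite F" "F \<subseteq> D"
    then show "(\<Sum>I | I \<in> F \<and> I \<subseteq> J. f I) \<le> B" by (intro L[rule_format]) (auto simp: dsub_def)
  qed
next
  assume R: "\<forall>F. finite F \<longrightarrow> F \<subseteq> D \<longrightarrow> (\<Sum>I | I \<in> F \<and> I \<subseteq> J. f I) \<le> B"
  show "\<forall>F. finite F \<longrightarrow> F \<subseteq> dsub D J \<longrightarrow> (\<Sum>I\<in>F. f I) \<le> B"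
  proof (intro allI impI)
    fix F assume F: "finite F" "F \<subseteq> dsub D J"
    then have "{I. I \<in> F \<and> I \<subseteq> J} = F" "F \<subseteq> D" by (auto simp: dsub_def)
    then show "(\<Sum>I\<in>F. f I) \<le> B" using R[rule_format, OF F(1)] by simp
  qed
qed

lemma Bq_iff: "Bq D NW V A < top \<longleftrightarrow> (\<exists>B\<ge>0. carlB (\<lambda>I e. NW I ** A I e) B)"
proof -
  have eq: "infsum (\<lambda>I. \<Sum>eps\<in>sigS. ennreal ((mnorm (NW I ** A I eps ** Vi J))\<^sup>2)) (dsub D J) \<le> ennreal (B * vol J) \<longleftrightarrow>
     (\<forall>F. finite F \<longrightarrow> F \<subseteq> D \<longrightarrow> (\<Sum>I | I \<in> F \<and> I \<subseteq> J. \<Sum>e\<in>sigS. (mnorm (NW I ** A I e ** Vi J))\<^sup>2) \<le> B * vol J)"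
    if J: "J \<in> D" and B: "0 \<le> B" for J B
  proof -
    have "0 \<le> B * vol J" using B D_vol_pos[OF J] by simp
    then show ?thesis
      unfolding infsum_ennreal_le_iff carl_sum_cong[symmetric]
      by (simp add: sum_ennreal sum_nonneg)
  qed
  show ?thesis unfolding Bq_def SUP_vol_finite_iff carlB_def
    by (intro ex_cong1 conj_cong refl ball_cong eq)
qed

text \<open>In \<open>Cb_def\<close> the sum over signatures stands outside the infinite sum. From
  \<open>carl\<close>, each signature is bounded separately by the same constant, which costs the
  factor \<open>card sigS\<close> and is harmless for finiteness.\<close>

lemma Cb_iff: "Cb D NW V A < top \<longleftrightarrow> (\<exists>B\<ge>0. carl (\<lambda>I e. NW I ** A I e) B)"
proof -
  let ?m = "\<lambda>I e. (mnorm (NW I ** A I e ** Vi I))\<^sup>2"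
  let ?n = "real (card (sigS :: ('d \<Rightarrow> bool) set))"
  let ?s = "\<lambda>J. \<Sum>e\<in>sigS. infsum (\<lambda>I. ennreal (?m I e)) (dsub D J)"
  have n: "0 \<le> ?n" by simp
  show ?thesis
    unfolding Cb_def SUP_vol_finite_iff carl_def carl_sum_cong[symmetric]
  proof
    assume "\<exists>B\<ge>0. \<forall>J\<in>D. ?s J \<le> ennreal (B * vol J)"
    then obtain B where B: "0 \<le> B" "\<And>J. J \<in> D \<Longrightarrow> ?s J \<le> ennreal (B * vol J)" by blast
    have "(\<Sum>I\<in>F. \<Sum>e\<in>sigS. ?m I e) \<le> B * vol J" if J: "J \<in> D" and F: "finite F" "F \<subseteq> dsub D J" for J F
    proof -
      have "ennreal (\<Sum>I\<in>F. \<Sum>e\<in>sigS. ?m I e) = (\<Sum>e\<in>sigS. \<Sum>I\<in>F. ennreal (?m I e))"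
        by (subst sum.swap) (simp add: sum_ennreal sum_nonneg)
      also have "\<dots> \<le> ?s J"
      proof (rule sum_mono)
        fix e :: "'d \<Rightarrow> bool"
        show "(\<Sum>I\<in>F. ennreal (?m I e)) \<le> infsum (\<lambda>I. ennreal (?m I e)) (dsub D J)"
          using infsum_ennreal_le_iff[of "\<lambda>I. ennreal (?m I e)" "dsub D J" "infsum (\<lambda>I. ennreal (?m I e)) (dsub D J)"] F by blast
      qed
      also have "\<dots> \<le> ennreal (B * vol J)" by (rule B(2)[OF J])
      finally show ?thesis using B(1) D_vol_pos[OF J] by (simp add: ennreal_le_iff)
    qed
    then show "\<exists>B\<ge>0. \<forall>J\<in>D. \<forall>F. finite F \<longrightarrow> F \<subseteq> dsub D J \<longrightarrow> (\<Sum>I\<in>F. \<Sum>e\<in>sigS. ?m I e) \<le> B * vol J"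
      using B(1) by blast
  next
    assume "\<exists>B\<ge>0. \<forall>J\<in>D. \<forall>F. finite F \<longrightarrow> F \<subseteq> dsub D J \<longrightarrow> (\<Sum>I\<in>F. \<Sum>e\<in>sigS. ?m I e) \<le> B * vol J"
    then obtain B where B: "0 \<le> B" "\<And>J F. J \<in> D \<Longrightarrow> finite F \<Longrightarrow> F \<subseteq> dsub D J \<Longrightarrow> (\<Sum>I\<in>F. \<Sum>e\<in>sigS. ?m I e) \<le> B * vol J"
      by blast
    have "?s J \<le> ennreal ((?n * B) * vol J)" if J: "J \<in> D" for J
    proof -
      have "?s J \<le> (\<Sum>e\<in>(sigS :: ('d \<Rightarrow> bool) set). ennreal (B * vol J))"
      proof (rule sum_mono)
        fix e :: "'d \<Rightarrow> bool" assume e: "e \<in> sigS"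
        have "(\<Sum>I\<in>F. ennreal (?m I e)) \<le> ennreal (B * vol J)" if F: "finite F" "F \<subseteq> dsub D J" for F
        proof -
          have "(\<Sum>I\<in>F. ?m I e) \<le> (\<Sum>I\<in>F. \<Sum>e\<in>sigS. ?m I e)"
            by (intro sum_mono member_le_sum[OF e]) auto
          also have "\<dots> \<le> B * vol J" by (rule B(2)[OF J F])
          finally show ?thesis by (simp add: sum_ennreal ennreal_leI)
        qed
        then show "infsum (\<lambda>I. ennreal (?m I e)) (dsub D J) \<le> ennreal (B * vol J)"
          unfolding infsum_ennreal_le_iff by blast
      qed
      also have "\<dots> = ennreal ((?n * B) * vol J)"
        using B(1) D_vol_pos[OF J] by (simp add: ennreal_of_nat_eq_real_of_nat ennreal_mult'[symmetric] mult.assoc)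
      finally show ?thesis .
    qed
    moreover have "0 \<le> ?n * B" using B(1) by simp
    ultimately show "\<exists>B\<ge>0. \<forall>J\<in>D. ?s J \<le> ennreal (B * vol J)" by blast
  qed
qed

text \<open>The power of \<open>U\<close> agrees with \<open>Q\<close> only almost everywhere, but
  it enters only through averages, so the two operators agree at every point.\<close>

lemma Pi_trunc_eq:
  assumes ae: "AE x in lebesgue. mpow (U x) (-1/p) = Q x" and f: "f \<in> borel_measurable lebesgue"
    and F: "F \<subseteq> D"
  shows "Pi_trunc NW U p A F f = para (\<lambda>I e. NW I ** A I e) F f"
proof
  fix x
  have av: "avg I (\<lambda>y. mpow (U y) (-1/p) *v f y) = coef f I" if "I \<in> F" for I
  proof -
    have I: "I \<in> D" using that F by auto
    note [measurable] = D_sets[OF I] matvec_measurable[OF Qm f]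
    have m1: "(\<lambda>x. Q x *v f x) \<in> borel_measurable lebesgue" by measurable
    have ae': "AE x in lebesgue. Q x *v f x = mpow (U x) (-1/p) *v f x"
      using ae by eventually_elim simp
    have m2: "(\<lambda>x. mpow (U x) (-1/p) *v f x) \<in> borel_measurable lebesgue"
      by (rule borel_measurable_AE[OF m1 ae'])
    have "(LINT y:I|lebesgue. mpow (U y) (-1/p) *v f y) = (LINT y:I|lebesgue. Q y *v f y)"
    proof (rule set_lebesgue_integral_cong_AE[OF D_sets[OF I] m2 m1])
      show "AE x\<in>I in lebesgue. mpow (U x) (-1/p) *v f x = Q x *v f x"
        using ae' by eventually_elim simp
    qed
    then show ?thesis by (simp add: coef_def avg_def)
  qed
  have "Pi_trunc NW U p A F f x = (\<Sum>I\<in>F. \<Sum>e\<in>sigS. haar I e x *\<^sub>R ((NW I ** A I e) *v avg I (\<lambda>y. mpow (U y) (-1/p) *v f y)))"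
    unfolding Pi_trunc_def by (rule sum.swap)
  also have "\<dots> = para (\<lambda>I e. NW I ** A I e) F f x"
    unfolding para_def hsum_def by (intro sum.cong refl) (simp only: av)
  finally show "Pi_trunc NW U p A F f x = para (\<lambda>I e. NW I ** A I e) F f x" .
qed

lemma bounded_Lq_iff:
  assumes ae: "AE x in lebesgue. mpow (U x) (-1/p) = Q x"
  shows "bounded_Lq D p (Pi_trunc NW U p A) \<longleftrightarrow> (\<exists>C\<ge>0. bdd (\<lambda>I e. NW I ** A I e) C)"
proof -
  let ?N = "\<lambda>I e. NW I ** A I e"
  have fin: "(\<integral>\<^sup>+ x. ennreal (norm (f x) powr p) \<partial>lebesgue) < top \<longleftrightarrow> integrable lebesgue (\<lambda>x. norm (f x) powr p)"
    if [measurable]: "f \<in> borel_measurable lebesgue" for f :: "real^'d \<Rightarrow> complex^'n"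
  proof
    assume "(\<integral>\<^sup>+ x. ennreal (norm (f x) powr p) \<partial>lebesgue) < top"
    then show "integrable lebesgue (\<lambda>x. norm (f x) powr p)" by (intro integrableI_nonneg) auto
  next
    assume "integrable lebesgue (\<lambda>x. norm (f x) powr p)"
    then show "(\<integral>\<^sup>+ x. ennreal (norm (f x) powr p) \<partial>lebesgue) < top"
      by (subst nn_integral_eq_integral) auto
  qed
  have "((\<integral>\<^sup>+ x. ennreal (norm (Pi_trunc NW U p A F f x) powr p) \<partial>lebesgue)
           \<le> ennreal C * (\<integral>\<^sup>+ x. ennreal (norm (f x) powr p) \<partial>lebesgue)) \<longleftrightarrow>
        (\<integral>x. norm (para ?N F f x) powr p \<partial>lebesgue) \<le> C * (\<integral>x. norm (f x) powr p \<partial>lebesgue)"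
    if f: "f \<in> borel_measurable lebesgue" "integrable lebesgue (\<lambda>x. norm (f x) powr p)"
      and F: "finite F" "F \<subseteq> D" and C: "0 \<le> C" for f F C
  proof -
    have i: "integrable lebesgue (\<lambda>x. norm (para ?N F f x) powr p)"
      unfolding para_def by (rule hsum_powr_integrable[OF F]) (use p in simp)
    have n0: "0 \<le> (\<integral>x. norm (f x) powr p \<partial>lebesgue)" by (intro integral_nonneg_AE) auto
    have "(\<integral>\<^sup>+ x. ennreal (norm (para ?N F f x) powr p) \<partial>lebesgue) = ennreal (\<integral>x. norm (para ?N F f x) powr p \<partial>lebesgue)"
      "(\<integral>\<^sup>+ x. ennreal (norm (f x) powr p) \<partial>lebesgue) = ennreal (\<integral>x. norm (f x) powr p \<partial>lebesgue)"
      using i f(2) by (auto intro!: nn_integral_eq_integral)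
    then show ?thesis
      unfolding Pi_trunc_eq[OF ae f(1) F(2)] using C n0 by (simp add: ennreal_mult'[symmetric] ennreal_le_iff)
  qed
  note eq = this
  show ?thesis
    unfolding bounded_Lq_def bdd_def
    by (intro ex_cong1 conj_cong refl all_cong1 imp_cong) (auto simp: fin eq)
qed

end

section \<open>Duality and assembly\<close>

lemma transfer_bound:
  fixes A :: "complex^'n^'n"
  assumes V: "posdef VW" "posdef VWd" "posdef VU" "posdef VUd"
    and a: "mnorm (VUd ** VU) \<le> a" and b: "\<And>e. norm (matrix_inv VW *v e) \<le> b * norm (VWd *v e)" and b0: "0 \<le> b"
  shows "mnorm (VUd ** mat_adj A ** matrix_inv VWd) \<le> a * b * mnorm (VW ** A ** matrix_inv VU)"
proof -
  let ?X = "VW ** A ** matrix_inv VU"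
  have Y: "mat_adj ?X = matrix_inv VU ** mat_adj A ** VW"
    by (simp add: mat_adj_mult posdef_adj[OF V(1)] posdef_inverse(3)[OF V(3)] matrix_mul_assoc)
  \<comment> \<open>Inserting \<open>VU\<close>, \<open>VW\<close> and their inverses exhibits the
    adjoint of \<open>?X\<close> between two outer factors: \<open>VUd ** VU\<close>, bounded by
    A_p, and \<open>matrix_inv VW ** matrix_inv VWd\<close>, bounded by comparability of
    \<open>matrix_inv VW\<close> with \<open>VWd\<close>.\<close>
  have "VUd ** mat_adj A ** matrix_inv VWd = (VUd ** VU) ** (mat_adj ?X ** (matrix_inv VW ** matrix_inv VWd))"
  proof -
    have "(VUd ** VU) ** (mat_adj ?X ** (matrix_inv VW ** matrix_inv VWd)) =
        VUd ** (VU ** matrix_inv VU) ** mat_adj A ** (VW ** matrix_inv VW) ** matrix_inv VWd"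
      unfolding Y by (simp add: matrix_mul_assoc)
    then show ?thesis by (simp add: posdef_inverse(2) V)
  qed
  then have "mnorm (VUd ** mat_adj A ** matrix_inv VWd) \<le> mnorm (VUd ** VU) * mnorm (mat_adj ?X ** (matrix_inv VW ** matrix_inv VWd))"
    using mnorm_mult by metis
  also have "\<dots> \<le> a * (mnorm (mat_adj ?X) * b)"
  proof (rule mult_mono[OF a])
    have "mnorm (matrix_inv VW ** matrix_inv VWd) \<le> b"
    proof (rule mnorm_le)
      fix v show "norm (matrix_inv VW ** matrix_inv VWd *v v) \<le> b * norm v"
        using b[of "matrix_inv VWd *v v"] by (simp add: matrix_vector_mul_assoc[symmetric] posdef_mult_inv[OF V(2)])
    qed
    then show "mnorm (mat_adj ?X ** (matrix_inv VW ** matrix_inv VWd)) \<le> mnorm (mat_adj ?X) * b"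
      using mnorm_mult[of "mat_adj ?X" "matrix_inv VW ** matrix_inv VWd"] mnorm_nonneg[of "mat_adj ?X"]
      by (meson mult_left_mono order.trans)
  qed (use a mnorm_nonneg order.trans in \<open>blast+\<close>)
  finally show ?thesis by (simp only: mnorm_mat_adj ac_simps)
qed

text \<open>One implication is enough: applied to the dual pairs it gives the converse, since taking
  adjoints twice returns \<open>A\<close>.\<close>

lemma Cb_transfer:
  assumes uw: "weight_pair D p q PU QU VU VUd cU" and ww: "weight_pair D p q PW QW VW VWd cW"
    and fin: "Cb D VW VU A < top"
  shows "Cb D VUd VWd (adj_seq A) < top"
proof -
  interpret u: weight_pair D p q PU QU VU VUd cU by (rule uw)
  interpret w: weight_pair D p q PW QW VW VWd cW by (rule ww)
  interpret wd: weight_pair D q p QW PW VWd VW cW by (rule w.dual)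
  obtain B where B: "0 \<le> B" "u.carl (\<lambda>I e. VW I ** A I e) B" using fin u.Cb_iff by blast
  define b where "b = 2 * cW powr (1/p) * cW powr (1/q)"
  have b: "0 \<le> b" by (simp add: b_def)
  let ?l = "cU * b"
  have "wd.carl (\<lambda>I e. VUd I ** adj_seq A I e) (?l\<^sup>2 * B)"
    unfolding wd.carl_def
  proof (intro ballI allI impI)
    fix J F assume J: "J \<in> D" and F: "finite F" "F \<subseteq> D"
    have "(\<Sum>I | I \<in> F \<and> I \<subseteq> J. \<Sum>e\<in>sigS. (mnorm (VUd I ** adj_seq A I e ** wd.Vi I))\<^sup>2)
       \<le> ?l\<^sup>2 * (\<Sum>I | I \<in> F \<and> I \<subseteq> J. \<Sum>e\<in>sigS. (mnorm (VW I ** A I e ** u.Vi I))\<^sup>2)"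
    proof (rule u.sq_sum_mono)
      fix I e assume "I \<in> {I. I \<in> F \<and> I \<subseteq> J}"
      then have I: "I \<in> D" using F by auto
      show "mnorm (VUd I ** adj_seq A I e ** wd.Vi I) \<le> ?l * mnorm (VW I ** A I e ** u.Vi I)"
        unfolding adj_seq_def
        by (rule transfer_bound[OF w.Vp[OF I] w.Vdp[OF I] u.Vp[OF I] u.Vdp[OF I] u.VdV[OF I] w.inverse_le_dual[OF I, folded b_def] b])
    qed (rule mnorm_nonneg)
    also have "\<dots> \<le> ?l\<^sup>2 * (B * vol J)"
      using B(2)[unfolded u.carl_def, rule_format, OF J F] by (rule mult_left_mono) simp
    finally show "(\<Sum>I | I \<in> F \<and> I \<subseteq> J. \<Sum>e\<in>sigS. (mnorm (VUd I ** adj_seq A I e ** wd.Vi I))\<^sup>2) \<le> ?l\<^sup>2 * B * vol J"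
      by simp
  qed
  moreover have "0 \<le> ?l\<^sup>2 * B" using B(1) by simp
  ultimately show ?thesis unfolding wd.Cb_iff by blast
qed

lemma adj_seq_adj_seq [simp]: "adj_seq (adj_seq A) = A"
  by (simp add: adj_seq_def)

text \<open>The outer weight enters only through the arbitrary family \<open>NW\<close>. Hence the
  lemma serves both sides: the pair of \<open>U\<close> for the given data and the dual pair of
  \<open>W\<close> for the adjoint data.\<close>

lemma weight_pair_equivalences:
  assumes "weight_pair D p q P Q V Vd c" and ae: "AE x in lebesgue. mpow (U x) (-1/p) = Q x"
  shows "bounded_Lq D p (Pi_trunc NW U p A) \<longleftrightarrow> Cb D NW V A < top"
    and "Bq D NW V A < top \<Longrightarrow> Cb D NW V A < top"
    and "2 \<le> p \<Longrightarrow> Cb D NW V A < top \<Longrightarrow> Bq D NW V A < top"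
proof -
  interpret weight_pair D p q P Q V Vd c by fact
  let ?N = "\<lambda>I e. NW I ** A I e"
  show eq: "bounded_Lq D p (Pi_trunc NW U p A) \<longleftrightarrow> Cb D NW V A < top"
    unfolding bounded_Lq_iff[OF ae] Cb_iff using bdd_imp_carl[of ?N] carl_imp_bdd[of ?N] by blast
  show "Cb D NW V A < top" if "Bq D NW V A < top"
    using that carlB_imp_carl[of ?N] unfolding Bq_iff Cb_iff by blast
  show "Bq D NW V A < top" if "2 \<le> p" "Cb D NW V A < top"
    using that(2) bdd_imp_carlB[of ?N, OF _ _ that(1)] unfolding eq[symmetric] bounded_Lq_iff[OF ae] Bq_iff by blast
qed

theorem theorem2p2:
  fixes p :: real
    and W U :: "real^'d \<Rightarrow> complex^'n^'n"
    and D :: "(real^'d) set set"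
    and A :: "(real^'d) set \<Rightarrow> ('d \<Rightarrow> bool) \<Rightarrow> complex^'n^'n"
    and VW VU VWd VUd :: "(real^'d) set \<Rightarrow> complex^'n^'n"
  assumes p: "1 < p"
    and W: "matrix_Ap p W" and U: "matrix_Ap p U"
    and D: "dyadic_grid D"
    and VW: "reducing_ops W p VW"
    and VU: "reducing_ops U p VU"
    and VWd: "reducing_ops (\<lambda>x. mpow (W x) (1 - p/(p-1))) (p/(p-1)) VWd"
    and VUd: "reducing_ops (\<lambda>x. mpow (U x) (1 - p/(p-1))) (p/(p-1)) VUd"
  shows
   "(bounded_Lq D p (Pi_trunc VW U p A) \<longleftrightarrow> Cb D VW VU A < top) \<and>
    (Cb D VW VU A < top \<longleftrightarrow>
       ((2 \<le> p \<longrightarrow> Bq D VW VU A < top) \<and>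
        (p \<le> 2 \<longrightarrow> Bq D VUd VWd (adj_seq A) < top))) \<and>
    (((2 \<le> p \<longrightarrow> Bq D VW VU A < top) \<and>
      (p \<le> 2 \<longrightarrow> Bq D VUd VWd (adj_seq A) < top)) \<longleftrightarrow>
       bounded_Lq D (p/(p-1)) (Pi_trunc VUd (\<lambda>x. mpow (W x) (1 - p/(p-1))) (p/(p-1)) (adj_seq A))) \<and>
    (Bq D VW VU A < top \<longrightarrow> Cb D VW VU A < top) \<and>
    (Bq D VUd VWd (adj_seq A) < top \<longrightarrow> Cb D VW VU A < top)"
proof -
  interpret grid D by unfold_locales (rule D)
  define q where "q = p / (p - 1)"
  obtain PU QU cU where u: "weight_pair D p q PU QU VU VUd cU" and QU: "AE x in lebesgue. mpow (U x) (-1/p) = QU x"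
    by (rule weight_pair_exists[OF p q_def U VU VUd[folded q_def]])
  obtain PW QW cW where w: "weight_pair D p q PW QW VW VWd cW"
    and PW: "AE x in lebesgue. mpow (mpow (W x) (1 - q)) (-1/q) = PW x"
    by (rule weight_pair_exists[OF p q_def W VW VWd[folded q_def]])
  \<comment> \<open>The dual operator averages against the power \<open>-1/q\<close> of the dual
    weight of \<open>W\<close>, which is \<open>PW\<close>; so the pair of \<open>W\<close> with
    exponents exchanged takes over the role of the pair of \<open>U\<close>.\<close>
  note ud = weight_pair.dual[OF u] and wd = weight_pair.dual[OF w]
  have C: "Cb D VW VU A < top \<longleftrightarrow> Cb D VUd VWd (adj_seq A) < top"
    using Cb_transfer[OF u w, of A] Cb_transfer[OF wd ud, of "adj_seq A"] by auto
  \<comment> \<open>For \<open>p <= 2\<close> condition (c) is the dual one, and the necessity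
    argument at exponent \<open>q\<close> requires \<open>2 <= q\<close>.\<close>
  have q2: "2 \<le> q" if "p \<le> 2" using p that by (simp add: q_def field_simps)
  note eu = weight_pair_equivalences[OF u QU, of VW A]
  note ew = weight_pair_equivalences[OF wd PW, of VUd "adj_seq A"]
  show ?thesis
    unfolding q_def[symmetric] using eu ew C q2 by (meson linear)
qed

end
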